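(* Suppose Assumptions 1–8 hold. Then (i) $LR_T(\bullet)\Rightarrow Z_{\vartheta\bullet}'(\mathcal I_\bullet^{-1})_{\vartheta\vartheta}^{-1}Z_{\vartheta\bullet}-\inf_{\boldsymbol\lambda_\vartheta\in\Lambda_\vartheta}\{(\boldsymbol\lambda_\vartheta-Z_{\vartheta\bullet})'(\mathcal I_\bullet^{-1})_{\vartheta\vartheta}^{-1}(\boldsymbol\lambda_\vartheta-Z_{\vartheta\bullet})\}$ (weak convergence of processes indexed by $\alpha\in A$, in $\mathcal B(A,\mathbb R)$), and (ii) $LR_T=\sup_{\alpha\in A}LR_T(\alpha)\xrightarrow{d}\sup_{\alpha\in A}\Big\{Z_{\vartheta\alpha}'(\mathcal I_\alpha^{-1})_{\vartheta\vartheta}^{-1}Z_{\vartheta\alpha}-\inf_{\boldsymbol\lambda_\vartheta\in\Lambda_\vartheta}\{(\boldsymbol\lambda_\vartheta-Z_{\vartheta\alpha})'(\mathcal I_\alpha^{-1})_{\vartheta\vartheta}^{-1}(\boldsymbol\lambda_\vartheta-Z_{\vartheta\alpha})\}\Big\}$.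
   Context: Setting. Fix an integer $p\ge1$. $\{y_t\}$ is a real-valued time series observed for $t=-p+1,\dots,T$; write $\boldsymbol y_{t-1}=(y_{t-1},\dots,y_{t-p})$ and $\mathcal F_t=\sigma(y_s,\ s\le t)$. For $\tilde\phi=(\tilde\phi_0,\tilde\phi_1,\dots,\tilde\phi_p,\tilde\sigma^2)\in\mathbb R^{p+1}\times(0,\infty)$ let $f_t(\tilde\phi)=\tilde\sigma^{-1}\mathfrak N\big((y_t-\tilde\phi_0-\sum_{i=1}^p\tilde\phi_iy_{t-i})/\tilde\sigma\big)$ with $\mathfrak N(u)=(2\pi)^{-1/2}e^{-u^2/2}$; $\nabla f_t$ denotes the gradient with respect to $\tilde\phi$. Integers $q_1\ge0$, $q_2\ge1$ with $q_1+q_2=p+2$ and a known $(p+2)\times(p+2)$ permutation matrix $P$ are fixed; for $\beta\in\mathbb R^{q_1},\phi\in\mathbb R^{q_2}$ write $f_t(\beta,\phi)=f_t(P^{-1}(\beta,\phi))$. Given a mixing weight $\alpha_t(\alpha,\beta,\phi,\varphi)$ depending on an additional parameter $\alpha$, the two-regime mixture autoregressive log-likelihood is $L_T(\alpha,\beta,\phi,\varphi)=\sum_{t=1}^T\log[\alpha_tf_t(\beta,\phi)+(1-\alpha_t)f_t(\beta,\varphi)]$; the null (linear AR) log-likelihood is $L^0_T(\tilde\phi)=\sum_{t=1}^T\log f_t(\tilde\phi)$. Let $\hat{\tilde\phi}_T$ satisfy $L^0_T(\hat{\tilde\phi}_T)=\sup_{\tilde\phi\in\tilde\Phi}L^0_T(\tilde\phi)+o_p(1)$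 and $\hat{\tilde\phi}_T=\tilde\phi^*+o_p(1)$. Define $LR_T(\alpha)=2[\sup_{(\beta,\phi,\varphi)\in B\times\Phi\times\Phi}L_T(\alpha,\beta,\phi,\varphi)-\sup_{\tilde\phi\in\tilde\Phi}L^0_T(\tilde\phi)]$ and $LR_T=\sup_{\alpha\in A}LR_T(\alpha)$. Notation. For random quantities $X_{T\alpha}$ indexed by $\alpha\in A$, $X_{T\alpha}=o_{p\alpha}(1)$ (resp. $O_{p\alpha}(1)$) means $\sup_{\alpha\in A}\|X_{T\alpha}\|=o_p(1)$ (resp. $O_p(1)$). $\mathcal B(A,\mathbb R^k)$ (resp. $\mathcal C(A,\mathbb R^k)$) is the space of bounded (resp. continuous) $\mathbb R^k$-valued functions on $A$ with the uniform metric; $\Rightarrow$ denotes weak convergence of processes in such spaces. A set $\Lambda\subset\mathbb R^r$ is a cone if $\lambda\in\Lambda$ implies $a\lambda\in\Lambda$ for all real $a>0$. A collection $\{\Gamma_\alpha,\alpha\in A\}$ of subsets of $\mathbb R^r$ is locally uniformly equal to $\Lambda\subset\mathbb R^r$ if there is $\delta>0$ with $\Gamma_\alpha\cap(-\delta,\delta)^r=\Lambda\cap(-\delta,\delta)^r$ for all $\alpha\in A$. $\lambda_{\min},\lambda_{\max}$ denote smallest/largest eigenvalues. Assumption 1. (i) $y_t=\tilde\phi^*_0+\sum_{i=1}^p\tilde\phi^*_iy_{t-i}+\tilde\sigma^*\varepsilon_t$ is a stationary linear Gaussian AR($p$) process, $\varepsilon_t$ i.i.d. $N(0,1)$ with $\varepsilon_t$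 independent of $\{y_{t-j},j>0\}$, where $\tilde\phi^*$ is an interior point of a compact set $\tilde\Phi\subset\{\tilde\phi:\tilde\phi_0\in\mathbb R,\ 1-\sum_{i=1}^p\tilde\phi_iz^i\ne0\text{ for }|z|\le1,\ \tilde\sigma^2\in(0,\infty)\}$. (ii) The parameter space of $(\alpha,\beta,\phi,\varphi)$ is $A\times B\times\Phi\times\Phi$ with $A\subset\mathbb R^a$ compact and $B\subset\mathbb R^{q_1}$, $\Phi\subset\mathbb R^{q_2}$ compact such that $(\beta,\phi)\in B\times\Phi$ iff $P^{-1}(\beta,\phi)\in\tilde\Phi$; write $(\beta^*,\phi^* )=P\tilde\phi^*$. (iii) For all $t$ and all parameter values, $\alpha_t(\alpha,\beta,\phi,\varphi)$ is $\sigma(\boldsymbol y_{t-1})$-measurable and lies in $(0,1)$. Assumption 2. For each $\alpha\in A$, estimators $(\hat\beta_{T\alpha},\hat\phi_{T\alpha},\hat\varphi_{T\alpha})\in B\times\Phi\times\Phi$ satisfy (i) $L_T(\alpha,\hat\beta_{T\alpha},\hat\phi_{T\alpha},\hat\varphi_{T\alpha})=\sup_{(\beta,\phi,\varphi)\in B\times\Phi\times\Phi}L_T(\alpha,\beta,\phi,\varphi)+o_{p\alpha}(1)$ and (ii) $(\hat\beta_{T\alpha},\hat\phi_{T\alpha},\hat\varphi_{T\alpha})=(\beta^*,\phi^*,\phi^* )+o_{p\alpha}(1)$. Assumption 3. (i) For every $\alpha\in A$ the map $(\pi,\varpi)=\boldsymbol\pi_\alpha(\phi,\varphi)$ from $\Phi\times\Phi$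 onto $\Pi_\alpha:=\boldsymbol\pi_\alpha(\Phi\times\Phi)\subset\mathbb R^{2q_2}$ is one-to-one with $\boldsymbol\pi_\alpha$ and $\boldsymbol\pi_\alpha^{-1}$ continuous. (ii) $\boldsymbol\pi_\alpha(\{(\phi,\phi):\phi\in\Phi\})=\Phi\times\{0\}$ and $\boldsymbol\pi_\alpha(\phi^*,\phi^* )=(\pi^*,0)$ with $\pi^*:=\phi^*$. (iii) $(\hat\beta_{T\alpha},\hat\pi_{T\alpha},\hat\varpi_{T\alpha})=(\beta^*,\pi^*,0)+o_{p\alpha}(1)$, where $(\hat\pi_{T\alpha},\hat\varpi_{T\alpha})=\boldsymbol\pi_\alpha(\hat\phi_{T\alpha},\hat\varphi_{T\alpha})$. The reparameterized log-likelihood is $L^\pi_T(\alpha,\beta,\pi,\varpi)=L_T(\alpha,\beta,\boldsymbol\pi_\alpha^{-1}(\pi,\varpi))$. Assumption 4. For some integer $k\ge2$ and every $\alpha\in A$, $\alpha_t(\alpha,\cdot)$ and $\boldsymbol\pi^{-1}_\alpha$ are $k$ times continuously differentiable on the interiors of $B\times\Phi\times\Phi$ and $\Pi_\alpha$, respectively. Assumption 5. For each $\alpha\in A$ and $(\beta,\pi,\varpi)\in B\times\Pi_\alpha$, with $\boldsymbol\theta=\boldsymbol\theta(\alpha,\beta,\pi,\varpi)$, $L^\pi_T(\alpha,\beta,\pi,\varpi)-L^\pi_T(\alpha,\beta^*,\pi^*,0)=(T^{-1/2}S_{T\alpha})'[T^{1/2}\boldsymbol\theta]-\tfrac12[T^{1/2}\boldsymbol\theta]'\mathcal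 I_\alpha[T^{1/2}\boldsymbol\theta]+R_T(\alpha,\beta,\pi,\varpi)$, where: (i) for each $\alpha$, $\boldsymbol\theta(\alpha,\cdot)$ maps $B\times\Pi_\alpha$ onto $\Theta_\alpha\subset\mathbb R^r$, with (a) $\boldsymbol\theta(\alpha,\beta^*,\pi^*,0)=0$ and (b) for every $\epsilon>0$ there is $\delta_\epsilon>0$ with $\inf_{\alpha\in A}\inf_{(\beta,\pi,\varpi)\in B\times\Pi_\alpha:\|(\beta,\pi,\varpi)-(\beta^*,\pi^*,0)\|\ge\epsilon}\|\boldsymbol\theta(\alpha,\beta,\pi,\varpi)\|\ge\delta_\epsilon$; (ii) $S_{T\alpha}=\sum_{t=1}^Ts_{t\alpha}$ is an $\mathbb R^r$-valued $\mathcal F_T$-measurable process indexed by $\alpha\in A$, not depending on $(\beta,\pi,\varpi)$, with sample paths continuous in $\alpha$, and $T^{-1/2}S_{T\bullet}\Rightarrow S_\bullet$ for a mean-zero $\mathbb R^r$-valued Gaussian process $\{S_\alpha:\alpha\in A\}$ with a.s. continuous sample paths and $E[S_\alpha S_\alpha']=E[s_{t\alpha}s_{t\alpha}']=\mathcal I_\alpha$; (iii) $\mathcal I_\alpha$ is a nonrandom symmetric $r\times r$ matrix not depending on $(\beta,\pi,\varpi)$, continuous in $\alpha$, with $0<\inf_{\alpha\in A}\lambda_{\min}(\mathcal I_\alpha)$ and $\sup_{\alpha\in A}\lambda_{\max}(\mathcal I_\alpha)<\infty$; (iv) for every nonrandom sequence of positive scalars $\gamma_T\to0$, $\sup_{(\beta,\pi,\varpi)\in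 B\times\Pi_\alpha:\|(\beta,\pi,\varpi)-(\beta^*,\pi^*,0)\|\le\gamma_T}|R_T(\alpha,\beta,\pi,\varpi)|/(1+\|T^{1/2}\boldsymbol\theta(\alpha,\beta,\pi,\varpi)\|)^2=o_{p\alpha}(1)$. Assumption 6. $\{\Theta_\alpha,\alpha\in A\}$ is locally uniformly equal to a cone $\Lambda\subset\mathbb R^r$. Assumption 7. With $q_\theta=q_1+q_2$ and $q_\vartheta=r-q_\theta$, $\Lambda=\mathbb R^{q_\theta}\times\Lambda_\vartheta$ for a cone $\Lambda_\vartheta\subset\mathbb R^{q_\vartheta}$. Assumption 8. Partitioning $S_{T\alpha}=(S_{T\theta\alpha},S_{T\vartheta\alpha})$ with $S_{T\theta\alpha}$ of dimension $q_\theta$, $S_{T\theta\alpha}=S^0_T:=\sum_{t=1}^T\nabla f_t(\tilde\phi^* )/f_t(\tilde\phi^* )$ for all $\alpha$. Let $\mathcal I^0=E[(\nabla f_t(\tilde\phi^* )/f_t(\tilde\phi^* ))(\nabla f_t(\tilde\phi^* )/f_t(\tilde\phi^* ))']$. Further notation. $Z_{T\alpha}=\mathcal I_\alpha^{-1}T^{-1/2}S_{T\alpha}$, $Z_\alpha=\mathcal I_\alpha^{-1}S_\alpha$. Partition $S_\alpha=(S_{\theta\alpha},S_{\vartheta\alpha})$, $Z_\alpha=(Z_{\theta\alpha},Z_{\vartheta\alpha})$, $\boldsymbol\lambda=(\boldsymbol\lambda_\theta,\boldsymbol\lambda_\vartheta)$ and $\mathcal I_\alpha$ into blocks $\mathcal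 I_{\theta\theta\alpha},\mathcal I_{\theta\vartheta\alpha},\mathcal I_{\vartheta\theta\alpha},\mathcal I_{\vartheta\vartheta\alpha}$ conformably with dimensions $q_\theta,q_\vartheta$; $(\mathcal I_\alpha^{-1})_{\vartheta\vartheta}$ is the bottom-right $q_\vartheta\times q_\vartheta$ block of $\mathcal I_\alpha^{-1}$. $\Theta_{\alpha,T}=\{T^{1/2}\boldsymbol\theta:\boldsymbol\theta\in\Theta_\alpha\}$. *)

theory Defs
  imports "HOL-Probability.Probability"
begin

text \<open>A vector of R^k is a function nat => real vanishing at indices >= k;
a k x k matrix is a function nat => nat => real vanishing outside {..<k} x {..<k}.\<close>

type_synonym vec = "nat \<Rightarrow> real"
type_synonym mat = "nat \<Rightarrow> nat \<Rightarrow> real"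

definition Rn :: "nat \<Rightarrow> vec set" where
  "Rn k = {x. \<forall>i\<ge>k. x i = 0}"

definition zvec :: vec where "zvec = (\<lambda>_. 0)"

definition vnorm :: "nat \<Rightarrow> vec \<Rightarrow> real" where
  "vnorm k x = sqrt (\<Sum>i<k. (x i)\<^sup>2)"

definition vdot :: "nat \<Rightarrow> vec \<Rightarrow> vec \<Rightarrow> real" where
  "vdot k x z = (\<Sum>i<k. x i * z i)"

definition vminus :: "vec \<Rightarrow> vec \<Rightarrow> vec" where
  "vminus x z = (\<lambda>i. x i - z i)"

definition vscale :: "real \<Rightarrow> vec \<Rightarrow> vec" where
  "vscale c x = (\<lambda>i. c * x i)"

definition vjoin :: "nat \<Rightarrow> vec \<Rightarrow> vec \<Rightarrow> vec" where
  "vjoin m x z = (\<lambda>i. if i < m then x i else z (i - m))"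

definition vtake :: "nat \<Rightarrow> vec \<Rightarrow> vec" where
  "vtake m x = (\<lambda>i. if i < m then x i else 0)"

definition vdrop :: "nat \<Rightarrow> vec \<Rightarrow> vec" where
  "vdrop m x = (\<lambda>i. x (i + m))"

definition is_mat :: "nat \<Rightarrow> mat \<Rightarrow> bool" where
  "is_mat n A \<longleftrightarrow> (\<forall>i j. n \<le> i \<or> n \<le> j \<longrightarrow> A i j = 0)"

definition mvmul :: "nat \<Rightarrow> mat \<Rightarrow> vec \<Rightarrow> vec" where
  "mvmul n A x = (\<lambda>i. if i < n then (\<Sum>j<n. A i j * x j) else 0)"

definition mmul :: "nat \<Rightarrow> mat \<Rightarrow> mat \<Rightarrow> mat" where
  "mmul n A C = (\<lambda>i j. if i < n \<and> j < n then (\<Sum>l<n. A i l * C l j) else 0)"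

definition idm :: "nat \<Rightarrow> mat" where
  "idm n = (\<lambda>i j. if i < n \<and> j < n \<and> i = j then 1 else 0)"

definition minv :: "nat \<Rightarrow> mat \<Rightarrow> mat" where
  "minv n A = (THE C. is_mat n C \<and> mmul n A C = idm n \<and> mmul n C A = idm n)"

definition mblock :: "nat \<Rightarrow> nat \<Rightarrow> mat \<Rightarrow> mat" where
  "mblock m n A = (\<lambda>i j. if i < n \<and> j < n then A (i + m) (j + m) else 0)"

definition qform :: "nat \<Rightarrow> mat \<Rightarrow> vec \<Rightarrow> real" where
  "qform n A x = (\<Sum>i<n. \<Sum>j<n. x i * A i j * x j)"

definition symmetric_mat :: "nat \<Rightarrow> mat \<Rightarrow> bool" where
  "symmetric_mat n A \<longleftrightarrow> is_mat n A \<and> (\<forall>i<n. \<forall>j<n. A i j = A j i)"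

definition eigenvalues :: "nat \<Rightarrow> mat \<Rightarrow> real set" where
  "eigenvalues n A = {l. \<exists>x\<in>Rn n. x \<noteq> zvec \<and> mvmul n A x = vscale l x}"

definition lambda_min :: "nat \<Rightarrow> mat \<Rightarrow> real" where
  "lambda_min n A = Min (eigenvalues n A)"

definition lambda_max :: "nat \<Rightarrow> mat \<Rightarrow> real" where
  "lambda_max n A = Max (eigenvalues n A)"

definition perm_matrix :: "nat \<Rightarrow> mat \<Rightarrow> bool" where
  "perm_matrix n P \<longleftrightarrow> (\<exists>\<sigma>. \<sigma> permutes {..<n} \<and>
      (\<forall>i j. P i j = (if i < n \<and> j < n \<and> j = \<sigma> i then 1 else 0)))"

text \<open>Topology: nat => real carries the product topology; on Rn k it is the Euclidean one.
Interiors are taken relative to R^k.\<close>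
definition rint :: "nat \<Rightarrow> vec set \<Rightarrow> vec set" where
  "rint n S = (top_of_set (Rn n)) interior_of S"

definition is_cone :: "nat \<Rightarrow> vec set \<Rightarrow> bool" where
  "is_cone k L \<longleftrightarrow> L \<subseteq> Rn k \<and> (\<forall>x\<in>L. \<forall>c>0. vscale c x \<in> L)"

definition cube :: "nat \<Rightarrow> real \<Rightarrow> vec set" where
  "cube k d = {x\<in>Rn k. \<forall>i<k. \<bar>x i\<bar> < d}"

definition loc_unif_eq :: "nat \<Rightarrow> ('a \<Rightarrow> vec set) \<Rightarrow> 'a set \<Rightarrow> vec set \<Rightarrow> bool" where
  "loc_unif_eq k G A L \<longleftrightarrow> (\<exists>d>0. \<forall>a\<in>A. G a \<inter> cube k d = L \<inter> cube k d)"

definition pdiff :: "(vec \<Rightarrow> real) \<Rightarrow> nat \<Rightarrow> vec \<Rightarrow> real" where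
  "pdiff g i x = deriv (\<lambda>s. g (x(i := s))) (x i)"

definition grad :: "nat \<Rightarrow> (vec \<Rightarrow> real) \<Rightarrow> vec \<Rightarrow> vec" where
  "grad n g x = (\<lambda>i. if i < n then pdiff g i x else 0)"

primrec pdiffs :: "nat \<Rightarrow> nat \<Rightarrow> (vec \<Rightarrow> real) \<Rightarrow> (vec \<Rightarrow> real) set" where
  "pdiffs n 0 g = {g}"
| "pdiffs n (Suc j) g = {pdiff d i | d i. d \<in> pdiffs n j g \<and> i < n}"

definition Ck_on :: "nat \<Rightarrow> nat \<Rightarrow> vec set \<Rightarrow> (vec \<Rightarrow> real) \<Rightarrow> bool" where
  "Ck_on n k U g \<longleftrightarrow> U \<subseteq> Rn n \<and>
     (\<forall>j<k. \<forall>d\<in>pdiffs n j g. \<forall>i<n. \<forall>x\<in>U. (\<lambda>s. d (x(i := s))) differentiable (at (x i))) \<and>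
     (\<forall>j\<le>k. \<forall>d\<in>pdiffs n j g. continuous_on U d)"

definition outer_prob :: "'w measure \<Rightarrow> 'w set \<Rightarrow> real" where
  "outer_prob M S = Inf {measure M C | C. C \<in> sets M \<and> S \<inter> space M \<subseteq> C}"

definition outer_exp :: "'w measure \<Rightarrow> ('w \<Rightarrow> real) \<Rightarrow> real" where
  "outer_exp M Y = Inf {integral\<^sup>L M U | U. integrable M U \<and> (\<forall>\<omega>\<in>space M. Y \<omega> \<le> U \<omega>)}"

text \<open>X_T = o_p(1) for nonnegative random quantities (outer probability).\<close>
definition o_p :: "'w measure \<Rightarrow> (nat \<Rightarrow> 'w \<Rightarrow> real) \<Rightarrow> bool" where
  "o_p M X \<longleftrightarrow> (\<forall>e>0. (\<lambda>T. outer_prob M {\<omega>\<in>space M. e < X T \<omega>}) \<longlonglongrightarrow> 0)"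

definition o_p_unif :: "'w measure \<Rightarrow> 'a set \<Rightarrow> (nat \<Rightarrow> 'a \<Rightarrow> 'w \<Rightarrow> real) \<Rightarrow> bool" where
  "o_p_unif M A X \<longleftrightarrow>
     (\<forall>e>0. (\<lambda>T. outer_prob M {\<omega>\<in>space M. \<exists>a\<in>A. e < X T a \<omega>}) \<longlonglongrightarrow> 0)"

definition bnd_fun :: "nat \<Rightarrow> 'a set \<Rightarrow> ('a \<Rightarrow> vec) \<Rightarrow> bool" where
  "bnd_fun k A f \<longleftrightarrow> (\<forall>a\<in>A. f a \<in> Rn k) \<and> (\<exists>C. \<forall>a\<in>A. vnorm k (f a) \<le> C)"

definition sup_dist :: "nat \<Rightarrow> 'a set \<Rightarrow> ('a \<Rightarrow> vec) \<Rightarrow> ('a \<Rightarrow> vec) \<Rightarrow> real" where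
  "sup_dist k A f g = (SUP a\<in>A. vnorm k (vminus (f a) (g a)))"

definition bc_functional :: "nat \<Rightarrow> 'a set \<Rightarrow> (('a \<Rightarrow> vec) \<Rightarrow> real) \<Rightarrow> bool" where
  "bc_functional k A h \<longleftrightarrow>
     (\<forall>f g. (\<forall>a\<in>A. f a = g a) \<longrightarrow> h f = h g) \<and>
     (\<exists>C. \<forall>f. bnd_fun k A f \<longrightarrow> \<bar>h f\<bar> \<le> C) \<and>
     (\<forall>f. bnd_fun k A f \<longrightarrow> (\<forall>e>0. \<exists>d>0. \<forall>g. bnd_fun k A g \<and> sup_dist k A f g < d \<longrightarrow>
          \<bar>h f - h g\<bar> < e))"

text \<open>Weak convergence (Hoffmann-Joergensen) of processes X_T indexed by A, defined on M,
to the process X defined on N, in B(A,R^k).\<close>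
definition weak_conv_proc ::
  "nat \<Rightarrow> 'a set \<Rightarrow> 'w measure \<Rightarrow> (nat \<Rightarrow> 'a \<Rightarrow> 'w \<Rightarrow> vec) \<Rightarrow> 'v measure \<Rightarrow> ('a \<Rightarrow> 'v \<Rightarrow> vec) \<Rightarrow> bool" where
  "weak_conv_proc k A M X N Xl \<longleftrightarrow>
     (\<forall>h. bc_functional k A h \<longrightarrow>
        (\<lambda>T. outer_exp M (\<lambda>\<omega>. h (\<lambda>a. X T a \<omega>))) \<longlonglongrightarrow> integral\<^sup>L N (\<lambda>\<eta>. h (\<lambda>a. Xl a \<eta>)))"

definition conv_distr :: "'w measure \<Rightarrow> (nat \<Rightarrow> 'w \<Rightarrow> real) \<Rightarrow> 'v measure \<Rightarrow> ('v \<Rightarrow> real) \<Rightarrow> bool" where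
  "conv_distr M X N Y \<longleftrightarrow>
     (\<forall>h::real \<Rightarrow> real. bounded (range h) \<and> continuous_on UNIV h \<longrightarrow>
        (\<lambda>T. outer_exp M (\<lambda>\<omega>. h (X T \<omega>))) \<longlonglongrightarrow> integral\<^sup>L N (\<lambda>\<eta>. h (Y \<eta>)))"

definition vec1 :: "real \<Rightarrow> vec" where
  "vec1 x = (\<lambda>i. if i = 0 then x else 0)"

definition centered_normal :: "'v measure \<Rightarrow> ('v \<Rightarrow> real) \<Rightarrow> bool" where
  "centered_normal N X \<longleftrightarrow> X \<in> borel_measurable N \<and>
     ((AE \<eta> in N. X \<eta> = 0) \<or>
      (\<exists>\<sigma>>0. distributed N lborel X (\<lambda>x. ennreal (normal_density 0 \<sigma> x))))"

definition gaussian_process :: "nat \<Rightarrow> 'a set \<Rightarrow> 'v measure \<Rightarrow> ('a \<Rightarrow> 'v \<Rightarrow> vec) \<Rightarrow> bool" where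
  "gaussian_process k A N S \<longleftrightarrow>
     (\<forall>F c. finite F \<and> F \<subseteq> A \<times> {..<k} \<longrightarrow>
        centered_normal N (\<lambda>\<eta>. \<Sum>(a, i)\<in>F. c a i * S a \<eta> i))"

definition gen_sigma :: "'w measure \<Rightarrow> ('w \<Rightarrow> real) set \<Rightarrow> 'w measure" where
  "gen_sigma M Ys = sigma (space M) {X -` C \<inter> space M | X C. X \<in> Ys \<and> C \<in> sets borel}"

definition strictly_stationary :: "'w measure \<Rightarrow> (int \<Rightarrow> 'w \<Rightarrow> real) \<Rightarrow> bool" where
  "strictly_stationary M y \<longleftrightarrow>
     (\<forall>J s. finite J \<longrightarrow>
        distr M (Pi\<^sub>M J (\<lambda>_. borel)) (\<lambda>\<omega>. restrict (\<lambda>j. y (j + s) \<omega>) J)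
      = distr M (Pi\<^sub>M J (\<lambda>_. borel)) (\<lambda>\<omega>. restrict (\<lambda>j. y j \<omega>) J))"

text \<open>Parameter tilde-phi in R^(p+2): index 0 = phi_0, indices 1..p = phi_1..phi_p,
index p+1 = sigma^2.\<close>

definition ar_stable :: "nat \<Rightarrow> vec \<Rightarrow> bool" where
  "ar_stable p ph \<longleftrightarrow>
     (\<forall>z::complex. cmod z \<le> 1 \<longrightarrow> 1 - (\<Sum>i=1..p. complex_of_real (ph i) * z ^ i) \<noteq> 0)"

definition dens :: "nat \<Rightarrow> (int \<Rightarrow> 'w \<Rightarrow> real) \<Rightarrow> int \<Rightarrow> vec \<Rightarrow> 'w \<Rightarrow> real" where
  "dens p y t ph \<omega> =
     (1 / sqrt (ph (p + 1))) *
     std_normal_density ((y t \<omega> - ph 0 - (\<Sum>i=1..p. ph i * y (t - int i) \<omega>)) / sqrt (ph (p + 1)))"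

definition Pinv_join :: "nat \<Rightarrow> nat \<Rightarrow> mat \<Rightarrow> vec \<Rightarrow> vec \<Rightarrow> vec" where
  "Pinv_join p q1 P b ph = mvmul (p + 2) (minv (p + 2) P) (vjoin q1 b ph)"

definition Lmix :: "nat \<Rightarrow> nat \<Rightarrow> mat \<Rightarrow> (int \<Rightarrow> 'w \<Rightarrow> real)
     \<Rightarrow> (int \<Rightarrow> vec \<Rightarrow> vec \<Rightarrow> vec \<Rightarrow> vec \<Rightarrow> 'w \<Rightarrow> real)
     \<Rightarrow> nat \<Rightarrow> vec \<Rightarrow> vec \<Rightarrow> vec \<Rightarrow> vec \<Rightarrow> 'w \<Rightarrow> real" where
  "Lmix p q1 P y wt T a b ph vph \<omega> =
     (\<Sum>t\<in>{1..T}. ln (wt (int t) a b ph vph \<omega> * dens p y (int t) (Pinv_join p q1 P b ph) \<omega>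
                   + (1 - wt (int t) a b ph vph \<omega>) * dens p y (int t) (Pinv_join p q1 P b vph) \<omega>))"

definition L0 :: "nat \<Rightarrow> (int \<Rightarrow> 'w \<Rightarrow> real) \<Rightarrow> nat \<Rightarrow> vec \<Rightarrow> 'w \<Rightarrow> real" where
  "L0 p y T ph \<omega> = (\<Sum>t\<in>{1..T}. ln (dens p y (int t) ph \<omega>))"

definition supLmix where
  "supLmix p q1 P y wt B Phi T a \<omega> =
     (SUP x\<in>B \<times> Phi \<times> Phi. Lmix p q1 P y wt T a (fst x) (fst (snd x)) (snd (snd x)) \<omega>)"

definition supL0 where
  "supL0 p y Phit T \<omega> = (SUP ph\<in>Phit. L0 p y T ph \<omega>)"

definition LR where
  "LR p q1 P y wt B Phi Phit T a \<omega> =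
     2 * (supLmix p q1 P y wt B Phi T a \<omega> - supL0 p y Phit T \<omega>)"

definition LRsup where
  "LRsup p q1 P y wt A B Phi Phit T \<omega> = (SUP a\<in>A. LR p q1 P y wt B Phi Phit T a \<omega>)"

definition tnorm :: "nat \<Rightarrow> nat \<Rightarrow> vec \<Rightarrow> vec \<Rightarrow> vec \<Rightarrow> real" where
  "tnorm q1 q2 b u v = sqrt ((vnorm q1 b)\<^sup>2 + (vnorm q2 u)\<^sup>2 + (vnorm q2 v)\<^sup>2)"

definition pack3 :: "nat \<Rightarrow> nat \<Rightarrow> vec \<times> vec \<times> vec \<Rightarrow> vec" where
  "pack3 q1 q2 x = vjoin q1 (fst x) (vjoin q2 (fst (snd x)) (snd (snd x)))"

definition unpack3 :: "nat \<Rightarrow> nat \<Rightarrow> vec \<Rightarrow> vec \<times> vec \<times> vec" where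
  "unpack3 q1 q2 v = (vtake q1 v, vtake q2 (vdrop q1 v), vtake q2 (vdrop (q1 + q2) v))"

definition pack2 :: "nat \<Rightarrow> vec \<times> vec \<Rightarrow> vec" where
  "pack2 q2 x = vjoin q2 (fst x) (snd x)"

definition unpack2 :: "nat \<Rightarrow> vec \<Rightarrow> vec \<times> vec" where
  "unpack2 q2 v = (vtake q2 v, vtake q2 (vdrop q2 v))"

definition Ssum :: "(nat \<Rightarrow> 'a \<Rightarrow> 'w \<Rightarrow> vec) \<Rightarrow> nat \<Rightarrow> 'a \<Rightarrow> 'w \<Rightarrow> vec" where
  "Ssum s T a \<omega> = (\<lambda>i. \<Sum>t\<in>{1..T}. s t a \<omega> i)"

definition lr_limit :: "nat \<Rightarrow> nat \<Rightarrow> mat \<Rightarrow> vec set \<Rightarrow> vec \<Rightarrow> real" where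
  "lr_limit r qth I Lv S =
     (let Z = mvmul r (minv r I) S;
          qv = r - qth;
          Zv = vtake qv (vdrop qth Z);
          W = minv qv (mblock qth qv (minv r I))
      in qform qv W Zv - (INF l\<in>Lv. qform qv W (vminus l Zv)))"

end

theory Submission
  imports Defs
begin

text \<open>
Relative to its value at the truth, the mixture likelihood is a quadratic \<open>q_a(l) = S_a \<bullet> l - l'I_a l / 2\<close> up to
a negligible remainder, and locally its parameter ranges over the cone \<open>\<Lambda>\<close>; hence its supremum is
\<open>sup_\<Lambda> q_a + o_p(1)\<close> uniformly in \<open>a\<close>. The Gaussian null likelihood is exactly quadratic in the regression
coefficients, and its supremum is \<open>sup q_a + o_p(1)\<close> over the first \<open>p + 2\<close> coordinates. By the Schur complement
the doubled difference of the two suprema is the stated functional of \<open>S_a\<close>, which is locally Lipschitz in \<open>S\<close>,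
so the continuous mapping theorem and Slutsky's lemma conclude.

The null expansion needs the normalised Hessian of the autoregression to converge to the information matrix.
Instead of an ergodic theorem this uses the mixture expansion along null parameters: two quadratic
expansions of the same likelihood ratio have to agree, and since the Hessian is nonnegative while a
nondegenerate Gaussian limit is unbounded below, their linear parts must coincide in the limit.
\<close>

section \<open>Vectors and quadratic forms\<close>

text \<open>Suprema over parameters and estimators are not assumed measurable, so probabilistic
  statements are phrased as inequalities valid off a measurable set of small measure. The comparison
  of suprema is then a deterministic lemma, applied path by path and for all \<open>a\<close> at
  once. The order of choices matters: the bound on the score is fixed before the radius on which the
  expansion is used, so the remainder condition, given along shrinking neighbourhoods, has to be
  turned into one on a fixed neighbourhood.

  The obstacle on the null side is that nothing ties a null direction h to the scaled image t under
  \<open>theta\<close> of the path in that direction. The two expansions give S.(h - t) = Q/2 -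
  t'It/2 + o(1), with Q the Hessian form. Since t is nonrandom, its boundedness can be read off a
  single good path, and compactness then provides limit points of h - t. Once h - t is known to
  vanish, the same identity yields Q -> h'Ih, the missing law of large numbers.\<close>

lemma vdot_self: "vdot k x x = (vnorm k x)\<^sup>2"
  by (simp add: vdot_def vnorm_def sum_nonneg power2_eq_square)

lemma vdot_commute: "vdot k x y = vdot k y x"
  by (simp add: vdot_def mult.commute)

lemma vnorm_nonneg [simp]: "0 \<le> vnorm k x"
  by (simp add: vnorm_def sum_nonneg)

lemma vnorm_L2: "vnorm k x = L2_set x {..<k}"
  by (simp add: vnorm_def L2_set_def)

lemma vdot_le: "\<bar>vdot k x y\<bar> \<le> vnorm k x * vnorm k y"
proof -
  have "\<bar>vdot k x y\<bar> \<le> (\<Sum>i<k. \<bar>x i\<bar> * \<bar>y i\<bar>)"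
    unfolding vdot_def by (rule order_trans[OF sum_abs]) (simp add: abs_mult)
  also have "\<dots> \<le> vnorm k x * vnorm k y"
    unfolding vnorm_L2 by (rule L2_set_mult_ineq)
  finally show ?thesis .
qed

lemma vnorm_triangle: "vnorm k (\<lambda>i. x i + y i) \<le> vnorm k x + vnorm k y"
  unfolding vnorm_L2 by (rule L2_set_triangle_ineq)

lemma vnorm_scale: "vnorm k (\<lambda>i. c * x i) = \<bar>c\<bar> * vnorm k x"
  by (simp add: vnorm_def power_mult_distrib sum_distrib_left[symmetric] real_sqrt_mult)

lemma vnorm_divide: "vnorm k (\<lambda>i. x i / c) = vnorm k x / \<bar>c\<bar>"
  using vnorm_scale[of k "1 / c" x] by simp

lemma vnorm_minus_commute: "vnorm k (\<lambda>i. x i - y i) = vnorm k (\<lambda>i. y i - x i)"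
  by (simp add: vnorm_def power2_commute)

lemma vnorm_minus_le: "vnorm k (\<lambda>i. x i - y i) \<le> vnorm k x + vnorm k y"
proof -
  have "vnorm k (\<lambda>i. x i - y i) = vnorm k (\<lambda>i. x i + (-1) * y i)" by simp
  also have "\<dots> \<le> vnorm k x + vnorm k (\<lambda>i. (-1) * y i)" by (rule vnorm_triangle)
  finally show ?thesis unfolding vnorm_scale by simp
qed

lemma vnorm_le_add_minus: "vnorm k x \<le> vnorm k y + vnorm k (\<lambda>i. x i - y i)"
  using vnorm_triangle[of k y "\<lambda>i. x i - y i"] by simp

lemma vnorm_cong: "(\<And>i. i < k \<Longrightarrow> x i = y i) \<Longrightarrow> vnorm k x = vnorm k y"
  by (simp add: vnorm_def)

lemma component_le_vnorm: "i < k \<Longrightarrow> \<bar>x i\<bar> \<le> vnorm k x"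
  unfolding vnorm_L2 using member_le_L2_set[of "{..<k}" i "\<lambda>i. \<bar>x i\<bar>"]
  by (simp add: L2_set_def)

lemma vnorm_eq_0: "x \<in> Rn k \<Longrightarrow> vnorm k x = 0 \<Longrightarrow> x = zvec"
  by (auto simp: vnorm_def Rn_def zvec_def sum_nonneg_eq_0_iff fun_eq_iff) (metis lessThan_iff not_le)

lemma vnorm_mono: "k \<le> m \<Longrightarrow> vnorm k x \<le> vnorm m x"
  unfolding vnorm_def by (intro real_sqrt_le_mono sum_mono2) auto

lemma zvec_Rn [simp]: "zvec \<in> Rn k" by (simp add: zvec_def Rn_def)

lemma vnorm_zvec [simp]: "vnorm k zvec = 0" by (simp add: vnorm_def zvec_def)

lemma Rn_lincomb: "x \<in> Rn k \<Longrightarrow> y \<in> Rn k \<Longrightarrow> (\<lambda>i. a * x i + b * y i) \<in> Rn k"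
  by (simp add: Rn_def)

lemma Rn_minus: "x \<in> Rn k \<Longrightarrow> y \<in> Rn k \<Longrightarrow> (\<lambda>i. x i - y i) \<in> Rn k"
  by (simp add: Rn_def)

lemma Rn_scale: "x \<in> Rn k \<Longrightarrow> (\<lambda>i. c * x i) \<in> Rn k"
  by (simp add: Rn_def)

lemma Rn_divide: "x \<in> Rn k \<Longrightarrow> (\<lambda>i. x i / c) \<in> Rn k"
  by (simp add: Rn_def)

lemma Rn_mono: "k \<le> m \<Longrightarrow> Rn k \<subseteq> Rn m" by (auto simp: Rn_def)

lemma mvmul_Rn [simp]: "mvmul n A x \<in> Rn n" by (simp add: mvmul_def Rn_def)

lemma mvmul_zvec [simp]: "mvmul n A zvec = zvec" by (auto simp: mvmul_def zvec_def)

section \<open>Continuity and compactness in the product topology\<close>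

lemma continuous_on_coord: "continuous_on S (\<lambda>x::nat \<Rightarrow> real. x i)"
  by (rule continuous_on_subset[OF continuous_on_product_coordinates]) auto

lemma continuous_on_vnorm: "continuous_on S (vnorm k)"
  unfolding vnorm_def by (intro continuous_intros continuous_on_coord)

lemma continuous_on_qform: "continuous_on S (qform k A)"
  unfolding qform_def by (intro continuous_intros continuous_on_coord)

lemma continuous_on_vdot: "continuous_on S (vdot k v)"
  unfolding vdot_def by (intro continuous_intros continuous_on_coord)

text \<open>The product of [-K, K] over the first k coordinates and of the singleton 0 over the
  others is compact by Tychonoff and contains the ball; the norm constraint cuts out a closed part
  of it.\<close>

lemma compact_ball_Rn: "compact {x \<in> Rn k. vnorm k x \<le> K}"
proof -
  let ?B = "Pi\<^sub>E UNIV (\<lambda>i. if i < k then {-K..K} else {0::real})"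
  have "compactin (product_topology (\<lambda>i::nat. euclidean) UNIV) ?B"
    unfolding compactin_PiE by (auto simp: compactin_euclidean_iff)
  then have c: "compact ?B" by (simp add: euclidean_product_topology compactin_euclidean_iff)
  have "closed {x. vnorm k x \<le> K}"
    by (intro closed_Collect_le continuous_on_vnorm continuous_on_const)
  then have "compact (?B \<inter> {x. vnorm k x \<le> K})" by (rule compact_Int_closed[OF c])
  also have "?B \<inter> {x. vnorm k x \<le> K} = {x \<in> Rn k. vnorm k x \<le> K}"
  proof -
    have "x \<in> ?B" if "x \<in> Rn k" "vnorm k x \<le> K" for x
      using that component_le_vnorm[of _ k x] by (fastforce simp: Rn_def PiE_def Pi_def)
    moreover have "x \<in> Rn k" if "x \<in> ?B" for x
    proof -
      have "x i = 0" if "k \<le> i" for i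
        using PiE_mem[OF \<open>x \<in> ?B\<close>, of i] that by simp
      then show ?thesis by (simp add: Rn_def)
    qed
    ultimately show ?thesis by auto
  qed
  finally show ?thesis .
qed

lemma compact_sphere_Rn: "compact {x \<in> Rn k. vnorm k x = 1}"
proof -
  have eq: "{x \<in> Rn k. vnorm k x = 1} = {x \<in> Rn k. vnorm k x \<le> 1} \<inter> {x. vnorm k x = 1}" by auto
  have "closed {x. vnorm k x = 1}"
    by (intro closed_Collect_eq continuous_on_vnorm continuous_on_const)
  then show ?thesis unfolding eq by (rule compact_Int_closed[OF compact_ball_Rn])
qed

section \<open>Bilinear and quadratic forms\<close>

definition unitv :: "nat \<Rightarrow> vec" where "unitv i = (\<lambda>j. if j = i then 1 else 0)"

lemma unitv_Rn: "i < k \<Longrightarrow> unitv i \<in> Rn k" by (auto simp: unitv_def Rn_def)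

lemma vdot_unitv: "i < k \<Longrightarrow> vdot k (unitv i) v = v i"
  by (simp add: vdot_def unitv_def if_distrib[of "\<lambda>x. x * _"] cong: if_cong)

lemma qform_vdot: "qform n A x = vdot n x (mvmul n A x)"
  by (simp add: qform_def vdot_def mvmul_def sum_distrib_left mult.assoc)

lemma vdot_mvmul_sym:
  assumes "symmetric_mat n A" shows "vdot n x (mvmul n A y) = vdot n y (mvmul n A x)"
proof -
  have "vdot n x (mvmul n A y) = (\<Sum>i<n. \<Sum>j<n. x i * A i j * y j)"
    by (simp add: vdot_def mvmul_def sum_distrib_left mult.assoc)
  also have "\<dots> = (\<Sum>j<n. \<Sum>i<n. x i * A i j * y j)" by (rule sum.swap)
  also have "\<dots> = (\<Sum>j<n. \<Sum>i<n. y j * A j i * x i)"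
    using assms by (intro sum.cong refl) (auto simp: symmetric_mat_def mult_ac)
  also have "\<dots> = vdot n y (mvmul n A x)"
    by (simp add: vdot_def mvmul_def sum_distrib_left mult.assoc)
  finally show ?thesis .
qed

lemma mvmul_add: "mvmul n A (\<lambda>i. a * x i + b * y i) = (\<lambda>i. a * mvmul n A x i + b * mvmul n A y i)"
  by (auto simp: mvmul_def fun_eq_iff sum_distrib_left sum.distrib[symmetric] algebra_simps)

lemma vdot_add: "vdot n v (\<lambda>i. a * x i + b * y i) = a * vdot n v x + b * vdot n v y"
  by (simp add: vdot_def sum_distrib_left sum.distrib[symmetric] algebra_simps)

lemma vdot_add_left: "vdot n (\<lambda>i. a * x i + b * y i) v = a * vdot n x v + b * vdot n y v"
  by (simp add: vdot_def sum_distrib_left sum.distrib[symmetric] algebra_simps)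

lemma qform_add:
  assumes "symmetric_mat n A"
  shows "qform n A (\<lambda>i. a * x i + b * y i)
    = a\<^sup>2 * qform n A x + 2 * a * b * vdot n y (mvmul n A x) + b\<^sup>2 * qform n A y"
proof -
  have "qform n A (\<lambda>i. a * x i + b * y i)
      = a * vdot n (\<lambda>i. a * x i + b * y i) (mvmul n A x) + b * vdot n (\<lambda>i. a * x i + b * y i) (mvmul n A y)"
    unfolding qform_vdot mvmul_add vdot_add by simp
  also have "\<dots> = a * (a * vdot n x (mvmul n A x) + b * vdot n y (mvmul n A x))
                + b * (a * vdot n x (mvmul n A y) + b * vdot n y (mvmul n A y))"
    unfolding vdot_add_left ..
  also have "\<dots> = a\<^sup>2 * qform n A x + 2 * a * b * vdot n y (mvmul n A x) + b\<^sup>2 * qform n A y"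
    unfolding qform_vdot vdot_mvmul_sym[OF assms, of x y] by (simp add: power2_eq_square algebra_simps)
  finally show ?thesis .
qed

lemma qform_scale: "qform n A (\<lambda>i. c * x i) = c\<^sup>2 * qform n A x"
  by (simp add: qform_def sum_distrib_left power2_eq_square mult_ac)

lemma qform_divide: "qform n A (\<lambda>i. x i / c) = qform n A x / c\<^sup>2"
  using qform_scale[of n A "1 / c" x] by (simp add: power_divide)

lemma abs_entry_le_sum:
  fixes A :: mat assumes "i < n" "j < n" shows "\<bar>A i j\<bar> \<le> (\<Sum>i<n. \<Sum>j<n. \<bar>A i j\<bar>)"
proof -
  have "\<bar>A i j\<bar> \<le> (\<Sum>j<n. \<bar>A i j\<bar>)" using assms by (intro member_le_sum) auto
  also have "\<dots> \<le> (\<Sum>i<n. \<Sum>j<n. \<bar>A i j\<bar>)" using assms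
    by (intro member_le_sum[where f="\<lambda>i. \<Sum>j<n. \<bar>A i j\<bar>"]) (auto simp: sum_nonneg)
  finally show ?thesis .
qed

text \<open>Each of the n^2 terms is at most C |x|^2. The crude constant is harmless, since the
  tolerances that use it are chosen after it.\<close>

lemma qform_abs_le:
  assumes "\<And>i j. i < n \<Longrightarrow> j < n \<Longrightarrow> \<bar>A i j\<bar> \<le> C"
  shows "\<bar>qform n A x\<bar> \<le> (real n)\<^sup>2 * C * (vnorm n x)\<^sup>2"
proof -
  have "\<bar>qform n A x\<bar> \<le> (\<Sum>i<n. \<Sum>j<n. \<bar>x i * A i j * x j\<bar>)"
    unfolding qform_def by (intro order_trans[OF sum_abs] sum_mono order_refl)
  also have "\<dots> \<le> (\<Sum>i<n. \<Sum>j<n. C * (vnorm n x)\<^sup>2)"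
  proof (intro sum_mono)
    fix i j assume ij: "i \<in> {..<n}" "j \<in> {..<n}"
    have "\<bar>x i\<bar> * \<bar>x j\<bar> \<le> vnorm n x * vnorm n x"
      using ij by (intro mult_mono component_le_vnorm) auto
    moreover have "\<bar>A i j\<bar> \<le> C" "0 \<le> C" using assms[of i j] ij by auto
    ultimately have "\<bar>A i j\<bar> * (\<bar>x i\<bar> * \<bar>x j\<bar>) \<le> C * (vnorm n x * vnorm n x)"
      using mult_mono[of "\<bar>A i j\<bar>" C "\<bar>x i\<bar> * \<bar>x j\<bar>" "vnorm n x * vnorm n x"] by simp
    then show "\<bar>x i * A i j * x j\<bar> \<le> C * (vnorm n x)\<^sup>2"
      by (simp add: abs_mult power2_eq_square mult_ac)
  qed
  also have "\<dots> = (real n)\<^sup>2 * C * (vnorm n x)\<^sup>2" by (simp add: power2_eq_square)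
  finally show ?thesis .
qed

text \<open>The first-order condition at a minimum of a quadratic, free of derivatives: otherwise a
  small step against the sign of \<open>a\<close>, scaled by |b| + 1, would give a negative
  value.\<close>

lemma linear_quadratic_nonneg_imp:
  fixes a b :: real
  assumes "\<And>t. 0 \<le> t * a + t\<^sup>2 * b" shows "a = 0"
proof (rule ccontr)
  assume "a \<noteq> 0"
  define t where "t = - a / (\<bar>b\<bar> + 1)"
  have "t * a + t\<^sup>2 * b = (a\<^sup>2 / (\<bar>b\<bar> + 1)\<^sup>2) * (b - (\<bar>b\<bar> + 1))"
  proof -
    define s where "s = \<bar>b\<bar> + 1"
    have "s > 0" by (simp add: s_def)
    then show ?thesis unfolding t_def s_def[symmetric] by (simp add: field_simps power2_eq_square)
  qed
  also have "\<dots> < 0"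
  proof (rule mult_pos_neg)
    show "0 < a\<^sup>2 / (\<bar>b\<bar> + 1)\<^sup>2" using \<open>a \<noteq> 0\<close>
      by (intro divide_pos_pos) (auto simp: zero_less_power2 add_nonneg_eq_0_iff)
  qed auto
  finally show False using assms[of t] by linarith
qed

section \<open>Eigenvalues and positive definite matrices\<close>

definition posdef :: "nat \<Rightarrow> mat \<Rightarrow> bool" where
  "posdef n A \<longleftrightarrow> symmetric_mat n A \<and> (\<forall>x\<in>Rn n. x \<noteq> zvec \<longrightarrow> 0 < qform n A x)"

text \<open>Moving \<open>A\<close> across the inner product evaluates x'Ay both as m x'y and as l
  x'y.\<close>

lemma eigenvectors_orthogonal:
  assumes "symmetric_mat n A" "mvmul n A x = vscale l x" "mvmul n A y = vscale m y" "l \<noteq> m"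
  shows "vdot n x y = 0"
proof -
  have "m * vdot n x y = l * vdot n x y"
    using vdot_mvmul_sym[OF assms(1), of x y] assms(2,3)
    by (simp add: vscale_def vdot_def sum_distrib_left mult_ac)
  then show ?thesis using assms(4) by simp
qed

text \<open>Bessel's inequality bounds the number of orthonormal eigenvectors.\<close>
lemma finite_eigenvalues:
  assumes sym: "symmetric_mat n A" shows "finite (eigenvalues n A)"
proof (rule ccontr)
  assume "infinite (eigenvalues n A)"
  then obtain F where F: "F \<subseteq> eigenvalues n A" "finite F" "card F = Suc n"
    using infinite_arbitrarily_large by metis
  have "\<exists>x. x \<in> Rn n \<and> mvmul n A x = vscale l x \<and> vnorm n x = 1" if l: "l \<in> F" for l
  proof -
    obtain x where x: "x \<in> Rn n" "x \<noteq> zvec" "mvmul n A x = vscale l x"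
      using l F(1) by (auto simp: eigenvalues_def)
    have nz: "vnorm n x \<noteq> 0" using x vnorm_eq_0 by blast
    have "mvmul n A (\<lambda>i. x i / vnorm n x) = vscale l (\<lambda>i. x i / vnorm n x)"
      using mvmul_add[of n A "1 / vnorm n x" x 0 x] x(3) by (simp add: vscale_def fun_eq_iff)
    then show ?thesis using x nz
      by (intro exI[of _ "\<lambda>i. x i / vnorm n x"]) (simp add: vnorm_divide Rn_divide)
  qed
  then obtain e where e: "\<And>l. l \<in> F \<Longrightarrow> mvmul n A (e l) = vscale l (e l)" "\<And>l. l \<in> F \<Longrightarrow> vnorm n (e l) = 1"
    by metis
  have orth: "vdot n (e l) (e m) = (if l = m then 1 else 0)" if "l \<in> F" "m \<in> F" for l m
    using eigenvectors_orthogonal[OF sym e(1) e(1)] that e(2) by (auto simp: vdot_self)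
  \<comment> \<open>The squared distance of the i-th unit vector from its projection on the span of
    the \<open>e l\<close> is nonnegative; expanding it gives Bessel's inequality for one
    coordinate.\<close>
  have bessel: "(\<Sum>l\<in>F. (e l i)\<^sup>2) \<le> 1" if i: "i < n" for i
  proof -
    let ?s = "\<lambda>j. \<Sum>l\<in>F. e l i * e l j"
    have "vdot n ?s ?s = (\<Sum>j<n. \<Sum>l\<in>F. \<Sum>m\<in>F. e l i * e m i * (e l j * e m j))"
      by (simp add: vdot_def sum_product mult_ac)
    also have "\<dots> = (\<Sum>l\<in>F. \<Sum>j<n. \<Sum>m\<in>F. e l i * e m i * (e l j * e m j))" by (rule sum.swap)
    also have "\<dots> = (\<Sum>l\<in>F. \<Sum>m\<in>F. \<Sum>j<n. e l i * e m i * (e l j * e m j))"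
      by (intro sum.cong refl sum.swap)
    also have "\<dots> = (\<Sum>l\<in>F. \<Sum>m\<in>F. e l i * e m i * vdot n (e l) (e m))"
      by (simp add: vdot_def sum_distrib_left)
    also have "\<dots> = (\<Sum>l\<in>F. \<Sum>m\<in>F. if l = m then (e l i)\<^sup>2 else 0)"
      by (intro sum.cong refl) (auto simp: orth power2_eq_square)
    also have "\<dots> = (\<Sum>l\<in>F. (e l i)\<^sup>2)" using F(2) by simp
    finally have ss: "vdot n ?s ?s = (\<Sum>l\<in>F. (e l i)\<^sup>2)" .
    have us: "vdot n (unitv i) ?s = (\<Sum>l\<in>F. (e l i)\<^sup>2)"
      using i by (simp add: vdot_unitv power2_eq_square)
    have "0 \<le> vdot n (\<lambda>j. 1 * unitv i j + (-1) * ?s j) (\<lambda>j. 1 * unitv i j + (-1) * ?s j)"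
      by (simp only: vdot_self zero_le_power2)
    also have "\<dots> = vdot n (unitv i) (unitv i) - 2 * vdot n (unitv i) ?s + vdot n ?s ?s"
      unfolding vdot_add vdot_add_left vdot_commute[of n ?s "unitv i"] by simp
    also have "\<dots> = 1 - (\<Sum>l\<in>F. (e l i)\<^sup>2)"
      unfolding ss us using i by (simp add: vdot_unitv) (simp add: unitv_def)
    finally show ?thesis by simp
  qed
  \<comment> \<open>Summed over the n coordinates, the bound leaves room for a total squared norm of
    n only, while n + 1 unit vectors were chosen.\<close>
  have "real (Suc n) = (\<Sum>l\<in>F. vdot n (e l) (e l))" using F by (simp add: orth)
  also have "\<dots> = (\<Sum>i<n. \<Sum>l\<in>F. (e l i)\<^sup>2)"
    unfolding vdot_def by (subst sum.swap) (simp add: power2_eq_square)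
  also have "\<dots> \<le> (\<Sum>i<n. 1)" by (intro sum_mono bessel) auto
  finally show False by simp
qed

text \<open>The form attains its minimum on the compact unit sphere, and homogeneity extends the
  inequality to all vectors. The vector \<open>u\<close> guarantees that the sphere is not empty, as
  it would be for n = 0.\<close>

lemma rayleigh_minimiser:
  assumes "u \<in> Rn n" "vnorm n u \<noteq> 0"
  obtains v where "v \<in> Rn n" "vnorm n v = 1" "\<And>z. z \<in> Rn n \<Longrightarrow> qform n A v * (vnorm n z)\<^sup>2 \<le> qform n A z"
proof -
  let ?S = "{x \<in> Rn n. vnorm n x = 1}"
  have normalise: "(\<lambda>i. z i / vnorm n z) \<in> ?S" if "z \<in> Rn n" "vnorm n z \<noteq> 0" for z
    using that by (simp add: vnorm_divide Rn_divide)
  have "?S \<noteq> {}" using normalise[OF assms] by blast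
  then obtain v where v: "v \<in> ?S" "\<And>z. z \<in> ?S \<Longrightarrow> qform n A v \<le> qform n A z"
    using continuous_attains_inf[OF compact_sphere_Rn _ continuous_on_qform, of n n A] by blast
  have "qform n A v * (vnorm n z)\<^sup>2 \<le> qform n A z" if z: "z \<in> Rn n" for z
  proof (cases "vnorm n z = 0")
    case True
    then show ?thesis using vnorm_eq_0[OF z] by (simp add: qform_def zvec_def)
  next
    case nz: False
    have "qform n A v \<le> qform n A (\<lambda>i. z i / vnorm n z)" by (rule v(2)[OF normalise[OF z nz]])
    also have "\<dots> = qform n A z / (vnorm n z)\<^sup>2" by (rule qform_divide)
    finally show ?thesis using nz by (simp add: field_simps)
  qed
  then show ?thesis using that v(1) by blast
qed

text \<open>A minimiser of the Rayleigh quotient is an eigenvector, so the minimal quotient is an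
  eigenvalue and \<open>lambda_min\<close> is at most that. Finiteness of the spectrum makes
  \<open>Min\<close> meaningful.\<close>

lemma lambda_min_le_rayleigh:
  assumes sym: "symmetric_mat n A" and x: "x \<in> Rn n"
  shows "lambda_min n A * (vnorm n x)\<^sup>2 \<le> qform n A x"
proof (cases "vnorm n x = 0")
  case True
  then have "x = zvec" using vnorm_eq_0 x by blast
  then show ?thesis by (simp add: qform_def zvec_def vnorm_def)
next
  case False
  obtain v where v: "v \<in> Rn n" "vnorm n v = 1"
    and ray0: "\<And>z. z \<in> Rn n \<Longrightarrow> qform n A v * (vnorm n z)\<^sup>2 \<le> qform n A z"
    by (rule rayleigh_minimiser[OF x False]) (rule that)
  define m where "m = qform n A v"
  note ray = ray0[folded m_def]
  \<comment> \<open>The vector \<open>v\<close> minimises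
    \<open>qform n A z - m * (vnorm n z)\<^sup>2\<close>, with minimum 0. Along
    \<open>unitv i\<close> this is a quadratic in t, so its linear coefficient vanishes, which is
    one coordinate of Av = mv.\<close>
  have eig: "mvmul n A v i = m * v i" if i: "i < n" for i
  proof -
    have "0 \<le> t * (2 * (mvmul n A v i - m * v i)) + t\<^sup>2 * (qform n A (unitv i) - m * (vnorm n (unitv i))\<^sup>2)" for t
    proof -
      let ?z = "\<lambda>j. 1 * v j + t * unitv i j"
      have z: "?z \<in> Rn n" using v(1) unitv_Rn[OF i] by (intro Rn_lincomb) auto
      have "(vnorm n ?z)\<^sup>2 = (vnorm n v)\<^sup>2 + 2 * t * v i + t\<^sup>2 * (vnorm n (unitv i))\<^sup>2"
        unfolding vdot_self[symmetric] vdot_add vdot_add_left vdot_commute[of n v "unitv i"]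
        by (simp add: vdot_unitv[OF i] power2_eq_square algebra_simps)
      moreover have "qform n A ?z = qform n A v + 2 * t * mvmul n A v i + t\<^sup>2 * qform n A (unitv i)"
        unfolding qform_add[OF sym] vdot_unitv[OF i] by simp
      ultimately show ?thesis using ray[OF z] v(2) by (simp add: m_def algebra_simps)
    qed
    from linear_quadratic_nonneg_imp[OF this] show ?thesis by simp
  qed
  have "mvmul n A v = vscale m v"
    using eig v(1) by (auto simp: fun_eq_iff vscale_def mvmul_def Rn_def not_less)
  moreover have "v \<noteq> zvec" using v(2) by auto
  ultimately have "m \<in> eigenvalues n A" using v(1) by (auto simp: eigenvalues_def)
  then have "lambda_min n A \<le> m"
    unfolding lambda_min_def using finite_eigenvalues[OF sym] by (rule Min_le[rotated])
  then show ?thesis using ray[OF x] mult_right_mono[of "lambda_min n A" m "(vnorm n x)\<^sup>2"] by simp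
qed

text \<open>The minimum over the unit sphere is attained and therefore positive. If all vectors have
  norm 0 the sphere is empty and any constant serves.\<close>

lemma posdef_coercive:
  assumes "posdef n A" shows "\<exists>c>0. \<forall>x\<in>Rn n. c * (vnorm n x)\<^sup>2 \<le> qform n A x"
proof (cases "\<forall>x\<in>Rn n. vnorm n x = 0")
  case True
  then have "1 * (vnorm n x)\<^sup>2 \<le> qform n A x" if "x \<in> Rn n" for x
    using that vnorm_eq_0[OF that] by (simp add: qform_def zvec_def)
  then show ?thesis using zero_less_one by blast
next
  case False
  then obtain u where u: "u \<in> Rn n" "vnorm n u \<noteq> 0" by blast
  obtain v where v: "v \<in> Rn n" "vnorm n v = 1"
    and ray: "\<And>z. z \<in> Rn n \<Longrightarrow> qform n A v * (vnorm n z)\<^sup>2 \<le> qform n A z"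
    by (rule rayleigh_minimiser[OF u]) (rule that)
  have "v \<noteq> zvec" using v(2) by auto
  then have "0 < qform n A v" using assms v(1) by (auto simp: posdef_def)
  then show ?thesis using ray by blast
qed

text \<open>The solution minimises the coercive function x'Ax / 2 - b'x.\<close>
lemma posdef_solve:
  assumes pd: "posdef n A" and b: "b \<in> Rn n"
  obtains x where "x \<in> Rn n" "mvmul n A x = b"
proof -
  have sym: "symmetric_mat n A" using pd by (simp add: posdef_def)
  obtain c where c: "c > 0" "\<And>x. x \<in> Rn n \<Longrightarrow> c * (vnorm n x)\<^sup>2 \<le> qform n A x"
    using posdef_coercive[OF pd] by blast
  define f where "f x = qform n A x / 2 - vdot n b x" for x
  \<comment> \<open>Beyond this radius b'x is at most (c/2) |x|^2, so \<open>f\<close> is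
    nonnegative there, while \<open>f\<close> vanishes at 0; a minimum over the ball is therefore
    global.\<close>
  define K where "K = 2 * vnorm n b / c"
  have K: "0 \<le> K" using c by (simp add: K_def)
  let ?B = "{x \<in> Rn n. vnorm n x \<le> K}"
  have z: "zvec \<in> ?B" using K by simp
  have "continuous_on ?B f"
    unfolding f_def by (intro continuous_intros continuous_on_qform continuous_on_vdot) auto
  then obtain x where x: "x \<in> ?B" "\<And>y. y \<in> ?B \<Longrightarrow> f x \<le> f y"
    using continuous_attains_inf[OF compact_ball_Rn[of n K], of f] z by blast
  have f0: "f zvec = 0" by (simp add: f_def qform_def vdot_def zvec_def)
  have min: "f x \<le> f y" if y: "y \<in> Rn n" for y
  proof (cases "vnorm n y \<le> K")
    case False
    have "vdot n b y \<le> vnorm n b * vnorm n y" using vdot_le[of n b y] by linarith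
    also have "\<dots> = (c / 2) * K * vnorm n y" using c by (simp add: K_def)
    also have "\<dots> \<le> (c / 2) * vnorm n y * vnorm n y"
      using False c by (intro mult_right_mono mult_left_mono) auto
    also have "\<dots> \<le> qform n A y / 2" using c(2)[OF y] by (simp add: power2_eq_square)
    finally have "0 \<le> f y" by (simp add: f_def)
    then show ?thesis using x(2)[OF z] f0 by linarith
  qed (use x(2) y in auto)
  have eq: "mvmul n A x i = b i" if i: "i < n" for i
  proof -
    have "0 \<le> t * (mvmul n A x i - b i) + t\<^sup>2 * (qform n A (unitv i) / 2)" for t
    proof -
      let ?z = "\<lambda>j. 1 * x j + t * unitv i j"
      have "?z \<in> Rn n" using x(1) unitv_Rn[OF i] by (intro Rn_lincomb) auto
      from min[OF this] show ?thesis
        unfolding f_def qform_add[OF sym] vdot_add vdot_unitv[OF i] vdot_commute[of n b "unitv i"]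
        by (simp add: algebra_simps)
    qed
    from linear_quadratic_nonneg_imp[OF this] show ?thesis by simp
  qed
  have "mvmul n A x = b"
    using eq b by (auto simp: fun_eq_iff mvmul_def Rn_def not_less)
  then show ?thesis using that x(1) by blast
qed

lemma posdef_inj:
  assumes "posdef n A" "x \<in> Rn n" "y \<in> Rn n" "mvmul n A x = mvmul n A y"
  shows "x = y"
proof -
  let ?d = "\<lambda>i. 1 * x i + (-1) * y i"
  have d: "?d \<in> Rn n" using assms by (intro Rn_lincomb)
  have "mvmul n A ?d = zvec" unfolding mvmul_add assms(4) by (simp add: zvec_def)
  then have "qform n A ?d = 0" unfolding qform_vdot by (simp add: vdot_def zvec_def)
  then have "?d = zvec" using assms(1) d by (fastforce simp: posdef_def)
  then show ?thesis by (simp add: fun_eq_iff zvec_def)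
qed

section \<open>Inverse matrices\<close>

lemma mmul_col: "j < n \<Longrightarrow> (\<lambda>i. mmul n A C i j) = mvmul n A (\<lambda>l. C l j)"
  by (auto simp: mmul_def mvmul_def)

lemma mvmul_mmul: "mvmul n (mmul n A C) x = mvmul n A (mvmul n C x)"
proof -
  have "(\<Sum>j<n. (\<Sum>l<n. A i l * C l j) * x j) = (\<Sum>l<n. A i l * (\<Sum>j<n. C l j * x j))" for i
  proof -
    have "(\<Sum>j<n. (\<Sum>l<n. A i l * C l j) * x j) = (\<Sum>j<n. \<Sum>l<n. A i l * C l j * x j)"
      by (simp add: sum_distrib_right)
    also have "\<dots> = (\<Sum>l<n. \<Sum>j<n. A i l * C l j * x j)" by (rule sum.swap)
    also have "\<dots> = (\<Sum>l<n. A i l * (\<Sum>j<n. C l j * x j))" by (simp add: sum_distrib_left mult.assoc)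
    finally show ?thesis .
  qed
  then show ?thesis by (auto simp: mvmul_def mmul_def fun_eq_iff)
qed

lemma mvmul_idm: "x \<in> Rn n \<Longrightarrow> mvmul n (idm n) x = x"
  by (auto simp: mvmul_def idm_def Rn_def fun_eq_iff if_distrib[of "\<lambda>x. x * _"] cong: if_cong)

lemma mmul_is_mat: "is_mat n (mmul n A C)" by (simp add: is_mat_def mmul_def)
lemma idm_is_mat: "is_mat n (idm n)" by (simp add: is_mat_def idm_def)

lemma mat_eq_by_cols:
  assumes "is_mat n A" "is_mat n C" "\<And>j. j < n \<Longrightarrow> (\<lambda>i. A i j) = (\<lambda>i. C i j)"
  shows "A = C"
  using assms by (auto simp: is_mat_def fun_eq_iff) (metis not_le)

text \<open>The definite description behind \<open>minv\<close> is resolved by the usual computation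
  D = D(AC) = (DA)C = C, carried out column by column.\<close>

lemma minv_unique:
  assumes C: "is_mat n C" "mmul n A C = idm n" "mmul n C A = idm n"
  shows "minv n A = C"
  unfolding minv_def
proof (rule the_equality)
  fix D assume D: "is_mat n D \<and> mmul n A D = idm n \<and> mmul n D A = idm n"
  show "D = C"
  proof (rule mat_eq_by_cols[of n])
    fix j assume j: "j < n"
    have cR: "(\<lambda>i. C i j) \<in> Rn n" "(\<lambda>i. D i j) \<in> Rn n"
      using C(1) D by (auto simp: is_mat_def Rn_def)
    have "(\<lambda>i. D i j) = mvmul n (mmul n D A) (\<lambda>i. C i j)"
      unfolding mvmul_mmul mmul_col[OF j, symmetric] C(2)
      using mmul_col[OF j, of D "idm n"] D j
      by (auto simp: mvmul_def idm_def is_mat_def fun_eq_iff if_distrib[of "\<lambda>x. _ * x"] cong: if_cong)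
    also have "\<dots> = (\<lambda>i. C i j)" using D cR by (simp add: mvmul_idm)
    finally show "(\<lambda>i. D i j) = (\<lambda>i. C i j)" .
  qed (use C D in auto)
qed (use assms in auto)

text \<open>The columns of the inverse solve Ax = e_j. That the right inverse C is also a left
  inverse follows from A(CA) = A and injectivity of A.\<close>

lemma posdef_minv:
  assumes pd: "posdef n A"
  shows "is_mat n (minv n A)" "mmul n A (minv n A) = idm n" "mmul n (minv n A) A = idm n"
proof -
  have sym: "is_mat n A" using pd by (simp add: posdef_def symmetric_mat_def)
  have "\<exists>x. x \<in> Rn n \<and> mvmul n A x = unitv j" if "j < n" for j
    using posdef_solve[OF pd unitv_Rn[OF that]] by blast
  then obtain x where x: "\<And>j. j < n \<Longrightarrow> x j \<in> Rn n" "\<And>j. j < n \<Longrightarrow> mvmul n A (x j) = unitv j"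
    by metis
  define C where "C i j = (if j < n then x j i else 0)" for i j
  have C: "is_mat n C" using x(1) by (auto simp: C_def is_mat_def Rn_def)
  have 1: "mmul n A C = idm n"
  proof (rule mat_eq_by_cols[OF mmul_is_mat idm_is_mat])
    fix j assume j: "j < n"
    show "(\<lambda>i. mmul n A C i j) = (\<lambda>i. idm n i j)"
      unfolding mmul_col[OF j] using j x(2)[OF j] by (auto simp: C_def unitv_def idm_def fun_eq_iff)
  qed
  have 2: "mmul n C A = idm n"
  proof (rule mat_eq_by_cols[OF mmul_is_mat idm_is_mat])
    fix j assume j: "j < n"
    have A: "(\<lambda>l. A l j) \<in> Rn n" using sym by (auto simp: is_mat_def Rn_def)
    have "mvmul n A (mvmul n C (\<lambda>l. A l j)) = mvmul n (mmul n A C) (\<lambda>l. A l j)"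
      by (simp add: mvmul_mmul)
    also have "\<dots> = (\<lambda>l. A l j)" using A by (simp add: 1 mvmul_idm)
    also have "\<dots> = mvmul n A (\<lambda>i. idm n i j)"
      using sym j by (auto simp: mvmul_def idm_def is_mat_def fun_eq_iff if_distrib[of "\<lambda>x. _ * x"] cong: if_cong)
    finally show "(\<lambda>i. mmul n C A i j) = (\<lambda>i. idm n i j)"
      unfolding mmul_col[OF j] using posdef_inj[OF pd] by (auto simp: Rn_def idm_def mvmul_def)
  qed
  have "minv n A = C" by (rule minv_unique[OF C 1 2])
  then show "is_mat n (minv n A)" "mmul n A (minv n A) = idm n" "mmul n (minv n A) A = idm n"
    using C 1 2 by auto
qed

lemma posdef_minv_mult:
  assumes "posdef n A" "x \<in> Rn n"
  shows "mvmul n A (mvmul n (minv n A) x) = x" "mvmul n (minv n A) (mvmul n A x) = x"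
  using assms by (simp_all add: mvmul_mmul[symmetric] posdef_minv mvmul_idm)

text \<open>With w the solution of Aw = x, the form of the inverse at x equals w'Aw; symmetry is
  transported by the same substitution.\<close>

lemma posdef_minv_posdef:
  assumes pd: "posdef n A" shows "posdef n (minv n A)"
proof -
  let ?J = "minv n A"
  have sym: "symmetric_mat n A" using pd by (simp add: posdef_def)
  have s: "vdot n x (mvmul n ?J y) = vdot n y (mvmul n ?J x)" if "x \<in> Rn n" "y \<in> Rn n" for x y
    using vdot_mvmul_sym[OF sym, of "mvmul n ?J x" "mvmul n ?J y"] posdef_minv_mult[OF pd] that
    by (simp add: vdot_commute)
  have col: "mvmul n ?J (unitv j) i = ?J i j" if "i < n" "j < n" for i j
    using that by (simp add: mvmul_def unitv_def if_distrib[of "\<lambda>x. _ * x"] cong: if_cong)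
  have "?J i j = ?J j i" if "i < n" "j < n" for i j
    using s[OF unitv_Rn unitv_Rn, of i j] that by (simp add: vdot_unitv col)
  then have "symmetric_mat n ?J" using posdef_minv(1)[OF pd] by (simp add: symmetric_mat_def)
  moreover have "0 < qform n ?J x" if x: "x \<in> Rn n" "x \<noteq> zvec" for x
  proof -
    have "mvmul n ?J x \<noteq> zvec"
      using posdef_minv_mult(1)[OF pd x(1)] x(2) mvmul_zvec[of n A] by auto
    then have "0 < qform n A (mvmul n ?J x)" using pd by (auto simp: posdef_def)
    also have "\<dots> = qform n ?J x"
      unfolding qform_vdot posdef_minv_mult(1)[OF pd x(1)] by (rule vdot_commute)
    finally show ?thesis .
  qed
  ultimately show ?thesis by (simp add: posdef_def)
qed

section \<open>Block decompositions and the Schur complement\<close>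

lemma sum_split_lessThan: "m \<le> (n::nat) \<Longrightarrow> (\<Sum>i<n. f i) = (\<Sum>i<m. f i) + (\<Sum>i<n - m. f (i + m))" for f :: "nat \<Rightarrow> real"
  using sum.atLeastLessThan_concat[of 0 m n f] sum.shift_bounds_nat_ivl[of f 0 m "n - m"]
  by (simp add: lessThan_atLeast0)

lemma vdot_split: "m \<le> n \<Longrightarrow> vdot n x y = vdot m x y + vdot (n - m) (vdrop m x) (vdrop m y)"
  by (simp add: vdot_def vdrop_def sum_split_lessThan)

text \<open>The form of the tail block at x is the full form at x padded by a zero first
  block.\<close>

lemma posdef_mblock:
  assumes pd: "posdef n A" and mn: "m \<le> n" shows "posdef (n - m) (mblock m (n - m) A)"
proof -
  let ?k = "n - m"
  have sym: "symmetric_mat n A" using pd by (simp add: posdef_def)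
  have "symmetric_mat ?k (mblock m ?k A)"
    using sym mn by (auto simp: symmetric_mat_def mblock_def is_mat_def)
  moreover have "0 < qform ?k (mblock m ?k A) x" if x: "x \<in> Rn ?k" "x \<noteq> zvec" for x
  proof -
    let ?x = "vjoin m zvec x"
    have "?x \<in> Rn n" using x(1) mn by (auto simp: Rn_def vjoin_def)
    moreover have "?x \<noteq> zvec"
    proof
      assume eq: "?x = zvec"
      have "x i = 0" for i using fun_cong[OF eq, of "i + m"] by (simp add: vjoin_def zvec_def)
      then show False using x(2) by (auto simp: zvec_def)
    qed
    ultimately have "0 < qform n A ?x" using pd by (auto simp: posdef_def)
    also have "qform n A ?x = qform ?k (mblock m ?k A) x"
      unfolding qform_def sum_split_lessThan[OF mn] by (simp add: vjoin_def zvec_def mblock_def)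
    finally show ?thesis .
  qed
  ultimately show ?thesis by (simp add: posdef_def)
qed

lemma qform_nonneg: "posdef n A \<Longrightarrow> x \<in> Rn n \<Longrightarrow> 0 \<le> qform n A x"
  by (cases "x = zvec") (auto simp: posdef_def less_imp_le qform_def zvec_def)

text \<open>Minimising a quadratic form over the first block: the minimiser is J(0, W xv).\<close>
lemma schur_complement:
  assumes pd: "posdef r A" and m: "m \<le> r"
  defines "W \<equiv> minv (r - m) (mblock m (r - m) (minv r A))"
  assumes xv: "xv \<in> Rn (r - m)"
  shows "\<exists>y\<in>Rn r. vdrop m y = xv \<and> qform r A y = qform (r - m) W xv"
    and "\<And>x. x \<in> Rn r \<Longrightarrow> vdrop m x = xv \<Longrightarrow> qform (r - m) W xv \<le> qform r A x"
proof -
  let ?k = "r - m" and ?J = "minv r A"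
  let ?w = "mvmul ?k W xv"
  have sym: "symmetric_mat r A" using pd by (simp add: posdef_def)
  have pb: "posdef ?k (mblock m ?k ?J)"
    by (rule posdef_mblock[OF posdef_minv_posdef[OF pd] m])
  \<comment> \<open>Stationarity under displacements of the first block forces Ay to vanish on that
    block. The tail \<open>?w\<close> of Ay is then the multiplier of the constraint, and inverting
    the tail block of the inverse of A makes the tail of y the prescribed one.\<close>
  define b where "b = vjoin m zvec ?w"
  have b: "b \<in> Rn r" using m by (auto simp: b_def vjoin_def Rn_def mvmul_def)
  define y where "y = mvmul r ?J b"
  have yR: "y \<in> Rn r" by (simp add: y_def)
  have Ay: "mvmul r A y = b" unfolding y_def by (rule posdef_minv_mult(1)[OF pd b])
  have "vdrop m y = mvmul ?k (mblock m ?k ?J) ?w"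
  proof
    fix i
    show "vdrop m y i = mvmul ?k (mblock m ?k ?J) ?w i"
    proof (cases "i < ?k")
      case True
      then have "y (i + m) = (\<Sum>j<?k. ?J (i + m) (j + m) * ?w j)"
        unfolding y_def mvmul_def[of r] sum_split_lessThan[OF m]
        by (simp add: b_def vjoin_def zvec_def)
      also have "\<dots> = mvmul ?k (mblock m ?k ?J) ?w i"
        using True unfolding mvmul_def[of ?k "mblock m ?k ?J"] by (simp add: mblock_def)
      finally show ?thesis by (simp add: vdrop_def)
    qed (auto simp: vdrop_def y_def mvmul_def)
  qed
  also have "\<dots> = xv" unfolding W_def by (rule posdef_minv_mult(1)[OF pb xv])
  finally have yv: "vdrop m y = xv" .
  have db: "vdrop m b = ?w" by (simp add: vdrop_def b_def vjoin_def)
  \<comment> \<open>Pairing with \<open>b\<close> sees the tail only, so a displacement with zero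
    tail is orthogonal to Ay = \<open>b\<close> and the cross term in the expansion of the form
    disappears.\<close>
  have inner: "vdot r z b = vdot ?k (vdrop m z) ?w" for z
    unfolding vdot_split[OF m] db by (simp add: vdot_def b_def vjoin_def zvec_def)
  have qy: "qform r A y = qform ?k W xv"
    unfolding qform_vdot Ay inner yv ..
  show "\<exists>y\<in>Rn r. vdrop m y = xv \<and> qform r A y = qform ?k W xv"
    using yR yv qy by blast
  show "qform ?k W xv \<le> qform r A x" if x: "x \<in> Rn r" "vdrop m x = xv" for x
  proof -
    let ?d = "\<lambda>i. x i - y i"
    have d: "?d \<in> Rn r" using x yR by (intro Rn_minus)
    have dv: "vdrop m ?d = zvec"
    proof
      fix i show "vdrop m ?d i = zvec i"
        using fun_cong[OF x(2), of i] fun_cong[OF yv, of i] by (simp add: vdrop_def zvec_def)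
    qed
    have "qform r A x = qform r A (\<lambda>i. 1 * y i + 1 * ?d i)" by simp
    also have "\<dots> = qform r A y + 2 * vdot r ?d b + qform r A ?d"
      unfolding qform_add[OF sym] Ay by simp
    also have "vdot r ?d b = 0" unfolding inner dv by (simp add: vdot_def zvec_def)
    finally show ?thesis using qform_nonneg[OF pd d] qy by simp
  qed
qed

section \<open>Suprema of concave quadratics over cones\<close>

definition quad :: "nat \<Rightarrow> mat \<Rightarrow> vec \<Rightarrow> vec \<Rightarrow> real" where
  "quad r A S l = vdot r S l - qform r A l / 2"

lemma quad_complete_square:
  assumes pd: "posdef r A" and S: "S \<in> Rn r"
  defines "Z \<equiv> mvmul r (minv r A) S"
  shows "quad r A S l = qform r A Z / 2 - qform r A (\<lambda>i. l i - Z i) / 2"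
proof -
  have sym: "symmetric_mat r A" using pd by (simp add: posdef_def)
  have AZ: "mvmul r A Z = S" unfolding Z_def by (rule posdef_minv_mult(1)[OF pd S])
  have "qform r A (\<lambda>i. 1 * l i + (-1) * Z i) = qform r A l - 2 * vdot r Z (mvmul r A l) + qform r A Z"
    unfolding qform_add[OF sym] by simp
  also have "vdot r Z (mvmul r A l) = vdot r S l"
    unfolding vdot_mvmul_sym[OF sym, of Z l] AZ by (rule vdot_commute)
  finally show ?thesis by (simp add: quad_def field_simps)
qed

text \<open>Completing the square turns the supremum into a minimal distance to \<open>Z\<close>.
  The first block is unrestricted and is minimised out by the Schur complement, which leaves the
  tail of l - Z measured by \<open>W\<close>. Two inequalities are proved because the infimum over
  \<open>Lv\<close> need not be attained.\<close>

lemma sup_quad_partial: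
  assumes pd: "posdef r A" and m: "m \<le> r" and S: "S \<in> Rn r"
    and Lv: "Lv \<subseteq> Rn (r - m)" "Lv \<noteq> {}"
  defines "Z \<equiv> mvmul r (minv r A) S"
    and "W \<equiv> minv (r - m) (mblock m (r - m) (minv r A))"
  shows "(SUP l\<in>{vjoin m u v | u v. u \<in> Rn m \<and> v \<in> Lv}. quad r A S l)
     = qform r A Z / 2 - (INF l\<in>Lv. qform (r - m) W (vminus l (vtake (r - m) (vdrop m Z)))) / 2"
    (is "(SUP l\<in>?L. _) = ?c - (INF l\<in>_. ?g l) / 2")
proof -
  let ?k = "r - m"
  have ZR: "Z \<in> Rn r" by (simp add: Z_def)
  have Zv: "vtake ?k (vdrop m Z) = vdrop m Z" "vdrop m Z \<in> Rn ?k"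
    using ZR by (auto simp: vtake_def vdrop_def Rn_def)
  have quad: "quad r A S l = ?c - qform r A (\<lambda>i. l i - Z i) / 2" for l
    unfolding Z_def by (rule quad_complete_square[OF pd S])
  have vR: "vminus v (vdrop m Z) \<in> Rn ?k" if "v \<in> Lv" for v
    using Zv(2) Lv(1) that by (auto simp: vminus_def Rn_def)
  have le: "quad r A S (vjoin m u v) \<le> ?c - ?g v / 2" if "u \<in> Rn m" "v \<in> Lv" for u v
  proof -
    have "(\<lambda>i. vjoin m u v i - Z i) \<in> Rn r"
      using that Lv(1) ZR m by (intro Rn_minus) (auto simp: vjoin_def Rn_def)
    moreover have "vdrop m (\<lambda>i. vjoin m u v i - Z i) = vminus v (vdrop m Z)"
      by (simp add: vdrop_def vjoin_def vminus_def)
    ultimately have "qform ?k W (vminus v (vdrop m Z)) \<le> qform r A (\<lambda>i. vjoin m u v i - Z i)"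
      unfolding W_def by (rule schur_complement(2)[OF pd m vR[OF that(2)]])
    then show ?thesis unfolding quad Zv(1) by simp
  qed
  have gnn: "0 \<le> ?g v" if "v \<in> Lv" for v
    unfolding Zv(1) W_def
    by (intro qform_nonneg posdef_minv_posdef posdef_mblock pd m vR that)
  then have bddg: "bdd_below (?g ` Lv)" by (auto simp: bdd_below_def)
  have bddq: "bdd_above (quad r A S ` ?L)"
    using le gnn by (intro bdd_aboveI[of _ ?c]) fastforce
  have "quad r A S l \<le> ?c - (INF l\<in>Lv. ?g l) / 2" if "l \<in> ?L" for l
    using that le cINF_lower[OF bddg] by fastforce
  moreover have "?L \<noteq> {}" using Lv(2) zvec_Rn by fast
  ultimately have 1: "(SUP l\<in>?L. quad r A S l) \<le> ?c - (INF l\<in>Lv. ?g l) / 2"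
    by (intro cSUP_least)
  have "2 * (?c - (SUP l\<in>?L. quad r A S l)) \<le> ?g v" if v: "v \<in> Lv" for v
  proof -
    obtain y where y: "y \<in> Rn r" "vdrop m y = vminus v (vdrop m Z)"
        "qform r A y = qform ?k W (vminus v (vdrop m Z))"
      using schur_complement(1)[OF pd m vR[OF v]] unfolding W_def by blast
    let ?l = "\<lambda>i. y i + Z i"
    have "?l = vjoin m (vtake m ?l) v"
    proof
      fix i show "?l i = vjoin m (vtake m ?l) v i"
        using fun_cong[OF y(2), of "i - m"] by (auto simp: vjoin_def vtake_def vdrop_def vminus_def)
    qed
    moreover have "vtake m ?l \<in> Rn m" by (simp add: vtake_def Rn_def)
    ultimately have "?l \<in> ?L" using v by blast
    then have "quad r A S ?l \<le> (SUP l\<in>?L. quad r A S l)" by (rule cSUP_upper[OF _ bddq])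
    then show ?thesis unfolding quad Zv(1) using y(3) by simp
  qed
  then have "2 * (?c - (SUP l\<in>?L. quad r A S l)) \<le> (INF l\<in>Lv. ?g l)"
    by (rule cINF_greatest[OF Lv(2)])
  with 1 show ?thesis by simp
qed

text \<open>The null supremum is the same formula with the tail restricted to 0. In the difference
  Z'AZ/2 cancels, and the penalty at the zero tail supplies the leading term of
  \<open>lr_limit\<close>.\<close>

lemma lr_limit_eq:
  assumes pd: "posdef r A" and m: "m \<le> r" and S: "S \<in> Rn r"
    and Lv: "Lv \<subseteq> Rn (r - m)" "Lv \<noteq> {}"
  shows "lr_limit r m A Lv S
     = 2 * ((SUP l\<in>{vjoin m u v | u v. u \<in> Rn m \<and> v \<in> Lv}. quad r A S l) - (SUP l\<in>Rn m. quad r A S l))"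
proof -
  let ?k = "r - m"
  have "Rn m = {vjoin m u v | u v. u \<in> Rn m \<and> v \<in> {zvec}}"
  proof -
    have "vjoin m u zvec = u" if "u \<in> Rn m" for u
      using that by (auto simp: vjoin_def zvec_def Rn_def fun_eq_iff)
    then show ?thesis by force
  qed
  then have "(SUP l\<in>Rn m. quad r A S l) = (SUP l\<in>{vjoin m u v | u v. u \<in> Rn m \<and> v \<in> {zvec}}. quad r A S l)"
    by simp
  also have "\<dots> = qform r A (mvmul r (minv r A) S) / 2
     - qform ?k (minv ?k (mblock m ?k (minv r A))) (vminus zvec (vtake ?k (vdrop m (mvmul r (minv r A) S)))) / 2"
    by (subst sup_quad_partial[OF pd m S]) auto
  also have "vminus zvec z = (\<lambda>i. (-1) * z i)" for z by (simp add: vminus_def zvec_def)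
  finally show ?thesis
    unfolding sup_quad_partial[OF pd m S Lv] lr_limit_def Let_def qform_scale by simp
qed

lemma quad_le:
  assumes c: "0 < c" "\<And>x. x \<in> Rn r \<Longrightarrow> c * (vnorm r x)\<^sup>2 \<le> qform r A x"
    and S: "vnorm r S \<le> K" and l: "l \<in> Rn r"
  shows "quad r A S l \<le> K * vnorm r l - c / 2 * (vnorm r l)\<^sup>2"
proof -
  have "vdot r S l \<le> vnorm r S * vnorm r l" using vdot_le[of r S l] by linarith
  also have "\<dots> \<le> K * vnorm r l" using S by (rule mult_right_mono) simp
  finally show ?thesis using c(2)[OF l] by (simp add: quad_def)
qed

text \<open>Cauchy-Schwarz and coercivity bound the value by the parabola Kx - cx^2/2, whose
  positive root is 2K/c.\<close>

lemma quad_le_0: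
  assumes c: "0 < c" "\<And>x. x \<in> Rn r \<Longrightarrow> c * (vnorm r x)\<^sup>2 \<le> qform r A x"
    and S: "vnorm r S \<le> K" and l: "l \<in> Rn r" "2 * K / c \<le> vnorm r l"
  shows "quad r A S l \<le> 0"
proof -
  have "K * vnorm r l \<le> c / 2 * vnorm r l * vnorm r l"
    using l(2) c(1) by (intro mult_right_mono) (auto simp: field_simps)
  then show ?thesis using quad_le[OF c S l(1)] by (simp add: power2_eq_square)
qed

text \<open>The same parabola has maximum K^2/(2c), read off by completing the square.\<close>

lemma quad_le_const:
  assumes c: "0 < c" "\<And>x. x \<in> Rn r \<Longrightarrow> c * (vnorm r x)\<^sup>2 \<le> qform r A x"
    and S: "vnorm r S \<le> K" and l: "l \<in> Rn r"
  shows "quad r A S l \<le> K\<^sup>2 / (2 * c)"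
proof -
  have "0 \<le> (K - c * vnorm r l)\<^sup>2 / (2 * c)" using c(1) by simp
  also have "\<dots> = K\<^sup>2 / (2 * c) - (K * vnorm r l - c / 2 * (vnorm r l)\<^sup>2)"
    using c(1) by (simp add: field_simps power2_eq_square)
  finally show ?thesis using quad_le[OF c S l] by linarith
qed

lemma bdd_above_quad:
  assumes c: "0 < c" "\<And>x. x \<in> Rn r \<Longrightarrow> c * (vnorm r x)\<^sup>2 \<le> qform r A x" and L: "L \<subseteq> Rn r"
  shows "bdd_above (quad r A S ` L)"
  using quad_le_const[OF c order_refl] L by (intro bdd_aboveI[of _ "(vnorm r S)\<^sup>2 / (2 * c)"]) auto

lemma quad_zvec [simp]: "quad r A S zvec = 0" by (simp add: quad_def vdot_def qform_def zvec_def)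

lemma sup_quad_bounds:
  assumes c: "0 < c" "\<And>x. x \<in> Rn r \<Longrightarrow> c * (vnorm r x)\<^sup>2 \<le> qform r A x"
    and L: "L \<subseteq> Rn r" "zvec \<in> L" and S: "vnorm r S \<le> K"
  shows "0 \<le> (SUP l\<in>L. quad r A S l)" "(SUP l\<in>L. quad r A S l) \<le> K\<^sup>2 / (2 * c)"
proof -
  show "0 \<le> (SUP l\<in>L. quad r A S l)"
    using cSUP_upper[OF L(2) bdd_above_quad[OF c L(1), of S]] by simp
  show "(SUP l\<in>L. quad r A S l) \<le> K\<^sup>2 / (2 * c)"
    using L quad_le_const[OF c S] by (intro cSUP_least) auto
qed

text \<open>Only points of norm below 2K/c matter: beyond that the value is at most 0, which
  \<open>zvec\<close> already attains. Below it the value is linear in \<open>S\<close> with slope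
  at most that radius.\<close>

lemma sup_quad_lipschitz_le:
  assumes c: "0 < c" "\<And>x. x \<in> Rn r \<Longrightarrow> c * (vnorm r x)\<^sup>2 \<le> qform r A x"
    and L: "L \<subseteq> Rn r" "zvec \<in> L" and S: "vnorm r S \<le> K"
  shows "(SUP l\<in>L. quad r A S l) \<le> (SUP l\<in>L. quad r A S' l) + 2 * K / c * vnorm r (\<lambda>i. S i - S' i)"
proof (rule cSUP_least)
  show "L \<noteq> {}" using L by auto
  have K: "0 \<le> K" using S vnorm_nonneg order_trans by blast
  have G: "0 \<le> (SUP l\<in>L. quad r A S' l)" using sup_quad_bounds(1)[OF c L order_refl] .
  have nn: "0 \<le> 2 * K / c * vnorm r (\<lambda>i. S i - S' i)" using K c(1) by simp
  fix l assume l: "l \<in> L"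
  show "quad r A S l \<le> (SUP l\<in>L. quad r A S' l) + 2 * K / c * vnorm r (\<lambda>i. S i - S' i)"
  proof (cases "2 * K / c \<le> vnorm r l")
    case True
    then show ?thesis using quad_le_0[OF c S _ True] l L(1) G nn by force
  next
    case False
    have "vdot r S l - vdot r S' l = vdot r (\<lambda>i. S i - S' i) l"
      by (simp add: vdot_def sum_subtractf[symmetric] algebra_simps)
    also have "\<dots> \<le> vnorm r (\<lambda>i. S i - S' i) * vnorm r l"
      using vdot_le[of r "\<lambda>i. S i - S' i" l] by linarith
    also have "\<dots> \<le> vnorm r (\<lambda>i. S i - S' i) * (2 * K / c)"
      using False by (intro mult_left_mono) auto
    finally have "quad r A S l \<le> quad r A S' l + 2 * K / c * vnorm r (\<lambda>i. S i - S' i)"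
      by (simp add: quad_def mult_ac)
    moreover have "quad r A S' l \<le> (SUP l\<in>L. quad r A S' l)"
      by (rule cSUP_upper[OF l bdd_above_quad[OF c L(1)]])
    ultimately show ?thesis by linarith
  qed
qed

lemma sup_quad_lipschitz:
  assumes c: "0 < c" "\<And>x. x \<in> Rn r \<Longrightarrow> c * (vnorm r x)\<^sup>2 \<le> qform r A x"
    and L: "L \<subseteq> Rn r" "zvec \<in> L" and S: "vnorm r S \<le> K" "vnorm r S' \<le> K"
  shows "\<bar>(SUP l\<in>L. quad r A S l) - (SUP l\<in>L. quad r A S' l)\<bar> \<le> 2 * K / c * vnorm r (\<lambda>i. S i - S' i)"
  using sup_quad_lipschitz_le[OF c L S(1), of S'] sup_quad_lipschitz_le[OF c L S(2), of S]
  by (simp add: vnorm_minus_commute[of r S'])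

text \<open>Applied twice: to the mixture likelihood with the cone of Assumption 6, and to the null likelihood
  with \<open>L\<close> the full space of the first \<open>p + 2\<close> coordinates.\<close>
lemma sup_criterion_approx:
  fixes ell dst :: "'x \<Rightarrow> real" and theta :: "'x \<Rightarrow> vec"
  assumes c: "0 < c" "\<And>x. x \<in> Rn r \<Longrightarrow> c * (vnorm r x)\<^sup>2 \<le> qform r A x"
    and L: "L \<subseteq> Rn r" "zvec \<in> L" "\<And>x a. x \<in> L \<Longrightarrow> 0 < a \<Longrightarrow> (\<lambda>i. a * x i) \<in> L"
    and S: "vnorm r S \<le> K" and K: "0 \<le> K"
    and R: "R = 4 * K / c + 2"
    and eps: "0 < eps" "eps \<le> c / 8"
    and tau: "0 < tau" "R / tau < rho" "R / tau < d"
    and theta: "\<And>x. x \<in> X \<Longrightarrow> theta x \<in> Rn r"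
    and far: "\<And>x. x \<in> X \<Longrightarrow> delta \<le> dst x \<Longrightarrow> d \<le> vnorm r (theta x)"
    and loc: "theta ` X \<inter> cube r rho = L \<inter> cube r rho"
    and expan: "\<And>x. x \<in> X \<Longrightarrow> dst x \<le> delta \<Longrightarrow>
        \<bar>ell x - quad r A S (\<lambda>i. tau * theta x i)\<bar> \<le> eps * (1 + vnorm r (\<lambda>i. tau * theta x i))\<^sup>2"
    and bdd: "bdd_above (ell ` X)"
    and xt: "xt \<in> X" "ell xt = 0"
    and xh: "xh \<in> X" "dst xh \<le> delta" "(SUP x\<in>X. ell x) - eps \<le> ell xh"
  shows "\<bar>(SUP x\<in>X. ell x) - (SUP l\<in>L. quad r A S l)\<bar> \<le> eps * ((1 + R)\<^sup>2 + 1)"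
proof -
  let ?M = "SUP x\<in>X. ell x" and ?G = "SUP l\<in>L. quad r A S l"
  let ?t = "\<lambda>x i. tau * theta x i"
  have R0: "0 \<le> R" using R K c(1) by simp
  have M0: "0 \<le> ?M" using cSUP_upper[OF xt(1) bdd] xt(2) by simp
  have tR: "?t x \<in> Rn r" if "x \<in> X" for x using theta[OF that] by (rule Rn_scale)
  have G_upper: "quad r A S l \<le> ?G" if "l \<in> L" for l
    by (rule cSUP_upper[OF that bdd_above_quad[OF c L(1)]])
  let ?v = "vnorm r (?t xh)"
  \<comment> \<open>A near maximiser has criterion at least -eps, while the quadratic falls like
    -(c/2)v^2. The choice eps <= c/8 spends at most half of this decay on the remainder, and R =
    4K/c + 2 is where the other half, (c/4)v^2, exceeds Kv + c/2.\<close>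
  have bound: "?v \<le> R"
  proof (rule ccontr)
    assume "\<not> ?v \<le> R"
    then have gt: "R < ?v" by simp
    have "- eps \<le> ell xh" using xh(3) M0 by linarith
    also have "\<dots> \<le> quad r A S (?t xh) + eps * (1 + ?v)\<^sup>2" using expan[OF xh(1,2)] by linarith
    also have "\<dots> \<le> K * ?v - c / 2 * ?v\<^sup>2 + eps * (2 + 2 * ?v\<^sup>2)"
    proof -
      have "(1 + ?v)\<^sup>2 \<le> 2 + 2 * ?v\<^sup>2" using sum_squares_ge_zero[of "1 - ?v" 0]
        by (simp add: power2_eq_square algebra_simps)
      then show ?thesis using quad_le[OF c S tR[OF xh(1)]] eps(1) by (intro add_mono mult_left_mono) auto
    qed
    finally have "c / 2 * ?v\<^sup>2 \<le> K * ?v + 3 * eps + 2 * eps * ?v\<^sup>2" by (simp add: algebra_simps)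
    also have "\<dots> \<le> K * ?v + c / 2 + c / 4 * ?v\<^sup>2"
      using eps mult_right_mono[of "2 * eps" "c / 4" "?v\<^sup>2"] by auto
    finally have "c / 4 * ?v\<^sup>2 \<le> K * ?v + c / 2" by simp
    moreover have "c / 4 * ?v\<^sup>2 > K * ?v + c / 2"
    proof -
      have "c / 4 * (R * ?v) < c / 4 * ?v\<^sup>2"
        using gt R0 c(1) by (simp add: power2_eq_square)
      moreover have "c / 4 * (R * ?v) = K * ?v + c / 2 * ?v" using c(1) by (simp add: R field_simps)
      moreover have "c / 2 * 1 \<le> c / 2 * ?v" using gt R K c(1)
        by (intro mult_left_mono) (auto intro: order_trans[of 1 "4 * K / c + 2"])
      ultimately show ?thesis by linarith
    qed
    ultimately show False by simp
  qed
  \<comment> \<open>Within R the unscaled parameter is at most R/tau and lies in the cube where the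
    image of X is the cone; homogeneity then puts the scaled point into \<open>L\<close> as
    well.\<close>
  have "theta xh \<in> cube r rho"
  proof -
    have "\<bar>theta xh i\<bar> < rho" if "i < r" for i
    proof -
      have "tau * \<bar>theta xh i\<bar> \<le> R"
        using component_le_vnorm[OF that, of "?t xh"] bound tau(1) by (simp add: abs_mult)
      then have "\<bar>theta xh i\<bar> \<le> R / tau" using tau(1) by (simp add: pos_le_divide_eq mult.commute)
      then show ?thesis using tau(2) by linarith
    qed
    then show ?thesis using theta[OF xh(1)] by (simp add: cube_def)
  qed
  then have "theta xh \<in> L" using loc xh(1) by blast
  then have "?t xh \<in> L" using L(3) tau(1) by simp
  moreover have "eps * (1 + ?v)\<^sup>2 \<le> eps * (1 + R)\<^sup>2"
    using bound eps(1) by (intro mult_left_mono power_mono) auto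
  moreover have "eps * ((1 + R)\<^sup>2 + 1) = eps * (1 + R)\<^sup>2 + eps" by (simp add: distrib_left)
  ultimately have up: "?M \<le> ?G + eps * ((1 + R)\<^sup>2 + 1)"
    using G_upper[of "?t xh"] expan[OF xh(1,2)] xh(3) by linarith
  \<comment> \<open>Conversely, a cone point of norm at most R shrinks by 1/tau into that cube and
    is the image of some x. The contrapositive of \<open>far\<close> places x close enough for the
    expansion to apply.\<close>
  have "quad r A S l \<le> ?M + eps * ((1 + R)\<^sup>2 + 1)" if l: "l \<in> L" for l
  proof (cases "vnorm r l \<le> R")
    case False
    have "2 * K / c \<le> R" using R K c(1) by (simp add: field_simps)
    then have "quad r A S l \<le> 0" using False l L(1) by (intro quad_le_0[OF c S]) auto
    moreover have "0 \<le> eps * ((1 + R)\<^sup>2 + 1)" using eps(1) by simp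
    ultimately show ?thesis using M0 by linarith
  next
    case True
    let ?u = "\<lambda>i. l i / tau"
    have "?u \<in> L" using L(3)[OF l, of "1 / tau"] tau(1) by simp
    have nu: "vnorm r ?u \<le> R / tau" using True tau(1) by (simp add: vnorm_divide divide_right_mono)
    have "\<bar>?u i\<bar> < rho" if "i < r" for i
      using component_le_vnorm[OF that, of ?u] nu tau(2) by linarith
    then have "?u \<in> L \<inter> cube r rho" using \<open>?u \<in> L\<close> L(1) by (auto simp: cube_def)
    then obtain x where x: "x \<in> X" "theta x = ?u" unfolding loc[symmetric] by force
    have "dst x \<le> delta" using far[OF x(1)] nu tau(3) unfolding x(2) by linarith
    from expan[OF x(1) this] have "quad r A S l \<le> ell x + eps * (1 + vnorm r l)\<^sup>2"
      unfolding x(2) using tau(1) by simp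
    moreover have "eps * (1 + vnorm r l)\<^sup>2 \<le> eps * (1 + R)\<^sup>2"
      using True eps(1) by (intro mult_left_mono power_mono) auto
    moreover have "ell x \<le> ?M" by (rule cSUP_upper[OF x(1) bdd])
    moreover have "eps * ((1 + R)\<^sup>2 + 1) = eps * (1 + R)\<^sup>2 + eps" by (simp add: distrib_left)
    ultimately show ?thesis using eps(1) by linarith
  qed
  then have "?G \<le> ?M + eps * ((1 + R)\<^sup>2 + 1)" using L(2) by (intro cSUP_least) auto
  with up show ?thesis by linarith
qed

section \<open>Outer probability\<close>

text \<open>The predicate need not describe a measurable set, hence the measurable exceptional set.
  The level \<eta> stays visible because constants obtained from tightness depend on it;
  \<open>whp\<close> is for statements whose constants do not.\<close>

definition evp :: "'w measure \<Rightarrow> real \<Rightarrow> (nat \<Rightarrow> 'w \<Rightarrow> bool) \<Rightarrow> bool" where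
  "evp M \<eta> P \<longleftrightarrow> (\<forall>\<^sub>F T in sequentially. \<exists>C\<in>sets M. measure M C < \<eta> \<and> (\<forall>\<omega>\<in>space M - C. P T \<omega>))"

definition whp :: "'w measure \<Rightarrow> (nat \<Rightarrow> 'w \<Rightarrow> bool) \<Rightarrow> bool" where
  "whp M P \<longleftrightarrow> (\<forall>\<eta>>0. evp M \<eta> P)"

lemma outer_prob_less_iff:
  "outer_prob M S < \<eta> \<longleftrightarrow> (\<exists>C\<in>sets M. S \<inter> space M \<subseteq> C \<and> measure M C < \<eta>)"
proof -
  let ?I = "{measure M C | C. C \<in> sets M \<and> S \<inter> space M \<subseteq> C}"
  have "measure M (space M) \<in> ?I" by auto
  moreover have "bdd_below ?I" by (rule bdd_belowI[of _ 0]) auto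
  ultimately show ?thesis unfolding outer_prob_def by (subst cInf_less_iff) auto
qed

lemma outer_prob_nonneg: "0 \<le> outer_prob M S"
  unfolding outer_prob_def by (rule cInf_greatest) (auto intro!: exI[of _ "space M"])

text \<open>The dictionary between the outer-probability form of stochastic order symbols and good
  events: a covering set in the infimum is an exceptional set.\<close>

lemma tendsto_outer_prob_iff_whp:
  "(\<lambda>T. outer_prob M {\<omega> \<in> space M. \<not> P T \<omega>}) \<longlonglongrightarrow> 0 \<longleftrightarrow> whp M P"
proof -
  have "(\<lambda>T. outer_prob M {\<omega> \<in> space M. \<not> P T \<omega>}) \<longlonglongrightarrow> 0 \<longleftrightarrow>
    (\<forall>\<eta>>0. \<forall>\<^sub>F T in sequentially. outer_prob M {\<omega> \<in> space M. \<not> P T \<omega>} < \<eta>)"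
    by (auto simp: tendsto_iff dist_real_def outer_prob_nonneg abs_of_nonneg)
  also have "\<dots> \<longleftrightarrow> whp M P"
    unfolding whp_def evp_def outer_prob_less_iff
    by (intro arg_cong[of _ _ All] ext imp_cong refl arg_cong2[of _ _ _ _ eventually] bex_cong) blast
  finally show ?thesis .
qed

lemma o_p_unif_iff: "o_p_unif M A X \<longleftrightarrow> (\<forall>e>0. whp M (\<lambda>T \<omega>. \<forall>a\<in>A. X T a \<omega> \<le> e))"
  unfolding o_p_unif_def tendsto_outer_prob_iff_whp[symmetric]
  by (simp add: not_le Bex_def)

lemma o_p_iff: "o_p M X \<longleftrightarrow> (\<forall>e>0. whp M (\<lambda>T \<omega>. X T \<omega> \<le> e))"
  unfolding o_p_def tendsto_outer_prob_iff_whp[symmetric] by (simp add: not_le)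

lemma evp_mono:
  assumes "evp M \<eta> P" "\<eta> \<le> \<eta>'" "\<forall>\<^sub>F T in sequentially. \<forall>\<omega>\<in>space M. P T \<omega> \<longrightarrow> Q T \<omega>"
  shows "evp M \<eta>' Q"
  using assms(1,3) unfolding evp_def
proof eventually_elim
  case (elim T)
  then show ?case using assms(2) by (meson Diff_iff less_le_trans)
qed

lemma evp_mono':
  assumes "evp M \<eta> P" "\<And>T \<omega>. \<omega> \<in> space M \<Longrightarrow> P T \<omega> \<Longrightarrow> Q T \<omega>"
  shows "evp M \<eta> Q"
  by (rule evp_mono[OF assms(1) order_refl]) (use assms(2) in auto)

lemma evp_conj:
  assumes M: "finite_measure M" and P: "evp M \<eta> P" and Q: "evp M \<eta>' Q"
  shows "evp M (\<eta> + \<eta>') (\<lambda>T \<omega>. P T \<omega> \<and> Q T \<omega>)"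
  using P Q unfolding evp_def
proof eventually_elim
  case (elim T)
  then obtain C D where C: "C \<in> sets M" "measure M C < \<eta>" "\<forall>\<omega>\<in>space M - C. P T \<omega>"
    and D: "D \<in> sets M" "measure M D < \<eta>'" "\<forall>\<omega>\<in>space M - D. Q T \<omega>" by blast
  have "measure M (C \<union> D) \<le> measure M C + measure M D"
    by (rule measure_Un_le) (use C D in auto)
  then show ?case using C D by (intro bexI[of _ "C \<union> D"]) auto
qed

lemma whpD: "whp M P \<Longrightarrow> 0 < \<eta> \<Longrightarrow> evp M \<eta> P" by (simp add: whp_def)

lemma whp_mono:
  assumes "whp M P" "\<forall>\<^sub>F T in sequentially. \<forall>\<omega>\<in>space M. P T \<omega> \<longrightarrow> Q T \<omega>"
  shows "whp M Q"
  using assms evp_mono unfolding whp_def by blast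

lemma whp_mono':
  assumes "whp M P" "\<And>T \<omega>. \<omega> \<in> space M \<Longrightarrow> P T \<omega> \<Longrightarrow> Q T \<omega>"
  shows "whp M Q"
  by (rule whp_mono[OF assms(1)]) (use assms(2) in auto)

lemma whp_conj:
  assumes M: "finite_measure M" and P: "whp M P" and Q: "whp M Q"
  shows "whp M (\<lambda>T \<omega>. P T \<omega> \<and> Q T \<omega>)"
  unfolding whp_def
proof (intro allI impI)
  fix \<eta> :: real assume "0 < \<eta>"
  then have "evp M (\<eta> / 2 + \<eta> / 2) (\<lambda>T \<omega>. P T \<omega> \<and> Q T \<omega>)"
    by (intro evp_conj[OF M] whpD P Q) auto
  then show "evp M \<eta> (\<lambda>T \<omega>. P T \<omega> \<and> Q T \<omega>)" by simp
qed

lemma whp_True: "finite_measure M \<Longrightarrow> whp M (\<lambda>T \<omega>. True)"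
  unfolding whp_def evp_def by (auto intro!: always_eventually bexI[of _ "{}"])

lemma whp_ball_finite:
  assumes M: "finite_measure M" and "finite I" "\<And>i. i \<in> I \<Longrightarrow> whp M (P i)"
  shows "whp M (\<lambda>T \<omega>. \<forall>i\<in>I. P i T \<omega>)"
  using assms(2,3)
proof (induction I)
  case empty
  then show ?case using whp_True[OF M] by simp
next
  case (insert i I)
  then show ?case using whp_conj[OF M, of "P i" "\<lambda>T \<omega>. \<forall>i\<in>I. P i T \<omega>"] by simp
qed

text \<open>An exceptional set of measure below 1 is not the whole space. In this way statements
  about nonrandom sequences are extracted from statements in probability.\<close>

lemma evp_frequently_ex:
  assumes M: "prob_space M" and "evp M \<eta> P" "\<eta> \<le> 1"
  shows "\<forall>\<^sub>F T in sequentially. \<exists>\<omega>\<in>space M. P T \<omega>"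
  using assms(2) unfolding evp_def
proof eventually_elim
  case (elim T)
  then obtain C where C: "C \<in> sets M" "measure M C < \<eta>" "\<forall>\<omega>\<in>space M - C. P T \<omega>" by blast
  have "space M - C \<noteq> {}"
  proof
    assume "space M - C = {}"
    then have "C = space M" using sets.sets_into_space[OF C(1)] by blast
    then show False using C(2) assms(3) prob_space.prob_space[OF M] by simp
  qed
  then show ?case using C(3) by blast
qed

text \<open>If every fixed radius failed, radius 1/(n+1) would fail at arbitrarily late times.
  Selecting one such time for each n, in increasing order, produces a null sequence of radii along
  which \<open>f\<close> does not tend to 0.\<close>

lemma null_sequences_imp_fixed_radius:
  fixes f :: "real \<Rightarrow> nat \<Rightarrow> real"
  assumes "\<And>\<gamma>. (\<And>T. 0 < \<gamma> T) \<Longrightarrow> \<gamma> \<longlonglongrightarrow> 0 \<Longrightarrow> (\<lambda>T. f (\<gamma> T) T) \<longlonglongrightarrow> 0" and "0 < \<eta>"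
  shows "\<exists>\<delta>>0. \<forall>\<^sub>F T in sequentially. f \<delta> T < \<eta>"
proof (rule ccontr)
  assume "\<not> ?thesis"
  then have neg: "\<exists>T>N. \<eta> \<le> f \<delta> T" if "0 < \<delta>" for \<delta> N
    using that unfolding eventually_sequentially
    by (metis (no_types, lifting) Suc_le_eq not_le)
  define nxt where "nxt n N = (SOME T. N < T \<and> \<eta> \<le> f (1 / real (Suc n)) T)" for n N
  have nxt: "N < nxt n N" "\<eta> \<le> f (1 / real (Suc n)) (nxt n N)" for n N
    using someI_ex[OF neg[of "1 / real (Suc n)" N, unfolded Bex_def]] unfolding nxt_def by auto
  define tt where "tt = rec_nat (nxt 0 0) (\<lambda>n N. nxt (Suc n) N)"
  have tt_Suc: "tt (Suc n) = nxt (Suc n) (tt n)" for n by (simp add: tt_def)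
  have mono: "strict_mono tt" by (rule strict_monoI_Suc) (simp add: tt_Suc nxt)
  have val: "\<eta> \<le> f (1 / real (Suc n)) (tt n)" for n
  proof (cases n)
    case 0
    then show ?thesis using nxt(2)[where n=0 and N=0] by (simp add: tt_def)
  next
    case (Suc m)
    then show ?thesis using nxt(2)[where n="Suc m" and N="tt m"] by (simp add: tt_Suc)
  qed
  \<comment> \<open>Off the selected times any positive null sequence will do; 1/(T+1) keeps the
    value below 1/(n+1) once T >= n.\<close>
  define \<gamma> where "\<gamma> T = (if T \<in> range tt then 1 / real (Suc (inv tt T)) else 1 / real (Suc T))" for T
  have inv: "inv tt (tt n) = n" for n
    using strict_mono_imp_inj_on[OF mono] by (simp add: inv_f_f)
  have "\<gamma> \<longlonglongrightarrow> 0"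
  proof (rule LIMSEQ_I)
    fix e :: real assume "0 < e"
    then obtain n where n: "1 / real (Suc n) < e" using nat_approx_posE by blast
    have "norm (\<gamma> T - 0) < e" if T: "max (tt n) n \<le> T" for T
    proof -
      have "\<gamma> T \<le> 1 / real (Suc n)"
      proof (cases "T \<in> range tt")
        case True
        then obtain m where m: "T = tt m" by blast
        then have "n \<le> m" using T strict_mono_less_eq[OF mono] by simp
        then show ?thesis by (simp add: \<gamma>_def m inv frac_le)
      next
        case False
        then show ?thesis using T by (simp add: \<gamma>_def frac_le)
      qed
      moreover have "0 \<le> \<gamma> T" by (simp add: \<gamma>_def)
      ultimately show ?thesis using n by simp
    qed
    then show "\<exists>no. \<forall>T\<ge>no. norm (\<gamma> T - 0) < e" by blast
  qed
  moreover have "0 < \<gamma> T" for T by (simp add: \<gamma>_def)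
  ultimately have "(\<lambda>T. f (\<gamma> T) T) \<longlonglongrightarrow> 0" by (intro assms(1))
  then have "\<forall>\<^sub>F T in sequentially. f (\<gamma> T) T < \<eta>" using assms(2) by (rule order_tendstoD(2))
  then obtain N where "\<And>T. N \<le> T \<Longrightarrow> f (\<gamma> T) T < \<eta>" by (auto simp: eventually_sequentially)
  from this[of "tt N"] val[of N] strict_mono_imp_increasing[OF mono, of N]
  show False by (simp add: \<gamma>_def inv)
qed

section \<open>Outer expectation and weak convergence\<close>

context prob_space begin

text \<open>The lower bound on \<open>Y\<close> bounds the integrals of all majorants from below,
  without which their infimum carries no information.\<close>

lemma outer_exp_le:
  assumes "integrable M U" "\<And>\<omega>. \<omega> \<in> space M \<Longrightarrow> Y \<omega> \<le> U \<omega>" "\<And>\<omega>. \<omega> \<in> space M \<Longrightarrow> - B \<le> Y \<omega>"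
  shows "outer_exp M Y \<le> integral\<^sup>L M U"
  unfolding outer_exp_def
proof (rule cInf_lower)
  show "bdd_below {integral\<^sup>L M U | U. integrable M U \<and> (\<forall>\<omega>\<in>space M. Y \<omega> \<le> U \<omega>)}"
  proof (rule bdd_belowI[of _ "-B"], clarify)
    fix V assume V: "integrable M V" "\<forall>\<omega>\<in>space M. Y \<omega> \<le> V \<omega>"
    have "(\<integral>\<omega>. - B \<partial>M) \<le> integral\<^sup>L M V"
      using V assms(3) by (intro integral_mono) (auto intro: order_trans)
    then show "- B \<le> integral\<^sup>L M V" by (simp add: prob_space)
  qed
qed (use assms in auto)

lemma outer_exp_lessE:
  assumes "outer_exp M Y < x" "\<And>\<omega>. \<omega> \<in> space M \<Longrightarrow> \<bar>Y \<omega>\<bar> \<le> B"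
  obtains U where "integrable M U" "\<And>\<omega>. \<omega> \<in> space M \<Longrightarrow> Y \<omega> \<le> U \<omega>" "integral\<^sup>L M U < x"
proof -
  let ?I = "{integral\<^sup>L M U | U. integrable M U \<and> (\<forall>\<omega>\<in>space M. Y \<omega> \<le> U \<omega>)}"
  have "\<exists>v. v \<in> ?I" using assms(2) by (intro exI CollectI exI[of _ "\<lambda>_. B"]) (auto simp: abs_le_iff)
  then have "?I \<noteq> {}" by blast
  from cInf_lessD[OF this assms(1)[unfolded outer_exp_def]] have "\<exists>v\<in>?I. v < x" .
  then show ?thesis using that by blast
qed

text \<open>A majorant U of \<open>Y'\<close> yields the majorant U + d, raised by 2B on
  \<open>C\<close>, of \<open>Y\<close>, since there the two differ by at most 2B. The detour
  through \<open>dense_le\<close> selects a nearly optimal U, as the infimum need not be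
  attained.\<close>

lemma outer_exp_perturb:
  assumes Y: "\<And>\<omega>. \<omega> \<in> space M \<Longrightarrow> \<bar>Y \<omega>\<bar> \<le> B" and Y': "\<And>\<omega>. \<omega> \<in> space M \<Longrightarrow> \<bar>Y' \<omega>\<bar> \<le> B"
    and C: "C \<in> sets M" and le: "\<And>\<omega>. \<omega> \<in> space M - C \<Longrightarrow> Y \<omega> \<le> Y' \<omega> + d" and d: "0 \<le> d"
  shows "outer_exp M Y \<le> outer_exp M Y' + d + 2 * B * measure M C"
proof (rule dense_le)
  fix x assume x: "x < outer_exp M Y"
  show "x \<le> outer_exp M Y' + d + 2 * B * measure M C"
  proof (rule ccontr)
    assume "\<not> ?thesis"
    then have "outer_exp M Y' < x - d - 2 * B * measure M C" by simp
    then obtain U where U: "integrable M U" "\<And>\<omega>. \<omega> \<in> space M \<Longrightarrow> Y' \<omega> \<le> U \<omega>"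
      "integral\<^sup>L M U < x - d - 2 * B * measure M C" using outer_exp_lessE Y' by blast
    let ?V = "\<lambda>\<omega>. U \<omega> + d + 2 * B * indicator C \<omega>"
    have ind: "integrable M (indicat_real C)"
      using C by (intro integrable_real_indicator) (simp_all add: emeasure_eq_measure)
    then have int: "integrable M ?V" using U(1) by (intro Bochner_Integration.integrable_add) auto
    have "outer_exp M Y \<le> integral\<^sup>L M ?V"
    proof (rule outer_exp_le[OF int])
      fix \<omega> assume w: "\<omega> \<in> space M"
      show "- B \<le> Y \<omega>" using Y[OF w] by simp
      show "Y \<omega> \<le> ?V \<omega>"
        using le[of \<omega>] U(2)[OF w] Y[OF w] Y'[OF w] d w by (cases "\<omega> \<in> C") auto
    qed
    also have "integral\<^sup>L M ?V = integral\<^sup>L M U + d + 2 * B * measure M C"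
      using U(1) C ind by (simp add: prob_space)
    finally show False using U(3) x by simp
  qed
qed

lemma outer_exp_const: "outer_exp M (\<lambda>_. c) = c"
proof (rule antisym)
  show "outer_exp M (\<lambda>_. c) \<le> c"
    using outer_exp_le[of "\<lambda>_. c" "\<lambda>_. c" "-c"] by (simp add: prob_space)
  show "c \<le> outer_exp M (\<lambda>_. c)"
  proof (rule ccontr)
    assume "\<not> ?thesis"
    then obtain U where U: "integrable M U" "\<And>\<omega>. \<omega> \<in> space M \<Longrightarrow> c \<le> U \<omega>" "integral\<^sup>L M U < c"
      using outer_exp_lessE[of "\<lambda>_. c" c "\<bar>c\<bar>"] by (auto simp: not_le)
    have "(\<integral>\<omega>. c \<partial>M) \<le> integral\<^sup>L M U" using U by (intro integral_mono) auto
    then show False using U(3) by (simp add: prob_space)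
  qed
qed

lemma outer_exp_add_const_le:
  assumes Z: "\<And>\<omega>. \<omega> \<in> space M \<Longrightarrow> \<bar>Z \<omega>\<bar> \<le> D"
  shows "outer_exp M (\<lambda>\<omega>. Z \<omega> + e) \<le> outer_exp M Z + e"
proof (rule dense_le)
  fix x assume x: "x < outer_exp M (\<lambda>\<omega>. Z \<omega> + e)"
  show "x \<le> outer_exp M Z + e"
  proof (rule ccontr)
    assume "\<not> ?thesis"
    then have "outer_exp M Z < x - e" by simp
    then obtain U where U: "integrable M U" "\<And>\<omega>. \<omega> \<in> space M \<Longrightarrow> Z \<omega> \<le> U \<omega>" "integral\<^sup>L M U < x - e"
      using outer_exp_lessE Z by blast
    have "- (D + \<bar>e\<bar>) \<le> Z \<omega> + e" if "\<omega> \<in> space M" for \<omega> using Z[OF that] by simp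
    then have "outer_exp M (\<lambda>\<omega>. Z \<omega> + e) \<le> integral\<^sup>L M (\<lambda>\<omega>. U \<omega> + e)"
      using U by (intro outer_exp_le[where B="D + \<bar>e\<bar>"]) auto
    also have "\<dots> = integral\<^sup>L M U + e" using U(1) by (simp add: prob_space)
    finally show False using x U(3) by simp
  qed
qed

lemma outer_exp_add_const:
  assumes "\<And>\<omega>. \<omega> \<in> space M \<Longrightarrow> \<bar>Y \<omega>\<bar> \<le> B"
  shows "outer_exp M (\<lambda>\<omega>. Y \<omega> + c) = outer_exp M Y + c"
proof (rule antisym)
  have "\<bar>Y \<omega> + c\<bar> \<le> B + \<bar>c\<bar>" if "\<omega> \<in> space M" for \<omega> using assms[OF that] by simp
  then show "outer_exp M Y + c \<le> outer_exp M (\<lambda>\<omega>. Y \<omega> + c)"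
    using outer_exp_add_const_le[where Z="\<lambda>\<omega>. Y \<omega> + c" and D="B + \<bar>c\<bar>" and e="-c"] by simp
qed (rule outer_exp_add_const_le[OF assms])

text \<open>Markov's inequality is applied to an integrable majorant of \<open>Y\<close>, because
  \<open>Y\<close> itself may fail to be measurable.\<close>

lemma outer_exp_markov:
  assumes "outer_exp M Y < \<eta>" "\<And>\<omega>. \<omega> \<in> space M \<Longrightarrow> 0 \<le> Y \<omega> \<and> Y \<omega> \<le> B"
  shows "\<exists>C\<in>sets M. measure M C < \<eta> \<and> (\<forall>\<omega>\<in>space M - C. Y \<omega> < 1)"
proof -
  have "\<bar>Y \<omega>\<bar> \<le> B" if "\<omega> \<in> space M" for \<omega> using assms(2)[OF that] by simp
  then obtain U where U: "integrable M U" "\<And>\<omega>. \<omega> \<in> space M \<Longrightarrow> Y \<omega> \<le> U \<omega>" "integral\<^sup>L M U < \<eta>"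
    using outer_exp_lessE[OF assms(1)] by blast
  let ?C = "{\<omega> \<in> space M. 1 \<le> U \<omega>}"
  have [measurable]: "U \<in> borel_measurable M" using U(1) by auto
  have nn: "0 \<le> U \<omega>" if "\<omega> \<in> space M" for \<omega> using U(2)[OF that] assms(2)[OF that] by linarith
  have "measure M ?C \<le> integral\<^sup>L M U / 1"
    by (rule integral_Markov_inequality_measure[OF U(1), of "{}"]) (auto simp: nn)
  moreover have "?C \<in> sets M" by measurable
  moreover have "Y \<omega> < 1" if "\<omega> \<in> space M - ?C" for \<omega>
    using U(2)[of \<omega>] that by auto
  ultimately show ?thesis using U(3) by (intro bexI[of _ ?C]) auto
qed

end

section \<open>Uniform distance and bounded continuous functionals\<close>

lemma vnorm_minus_triangle:
  "vnorm k (vminus f h) \<le> vnorm k (vminus f g) + vnorm k (vminus g h)"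
  using vnorm_triangle[of k "\<lambda>i. f i - g i" "\<lambda>i. g i - h i"] by (simp add: vminus_def)

lemma vnorm_vminus_commute: "vnorm k (vminus f g) = vnorm k (vminus g f)"
  unfolding vminus_def by (rule vnorm_minus_commute)

lemma bnd_fun_bound:
  assumes "bnd_fun k A f" shows "\<exists>C\<ge>0. \<forall>a\<in>A. vnorm k (f a) \<le> C"
proof -
  obtain C where "\<forall>a\<in>A. vnorm k (f a) \<le> C" using assms by (auto simp: bnd_fun_def)
  then show ?thesis by (intro exI[of _ "max 0 C"]) (auto intro: max.coboundedI2)
qed

lemma sup_dist_bdd:
  assumes "bnd_fun k A f" "bnd_fun k A g"
  shows "bdd_above ((\<lambda>a. vnorm k (vminus (f a) (g a))) ` A)"
proof -
  obtain C where C: "\<forall>a\<in>A. vnorm k (f a) \<le> C" using bnd_fun_bound[OF assms(1)] by blast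
  obtain D where D: "\<forall>a\<in>A. vnorm k (g a) \<le> D" using bnd_fun_bound[OF assms(2)] by blast
  show ?thesis
  proof (rule bdd_aboveI2)
    fix a assume "a \<in> A"
    then show "vnorm k (vminus (f a) (g a)) \<le> C + D"
      using vnorm_minus_le[of k "f a" "g a"] C D unfolding vminus_def by fastforce
  qed
qed

lemma sup_dist_upper:
  assumes "bnd_fun k A f" "bnd_fun k A g" "a \<in> A"
  shows "vnorm k (vminus (f a) (g a)) \<le> sup_dist k A f g"
  unfolding sup_dist_def by (rule cSUP_upper[OF assms(3) sup_dist_bdd[OF assms(1,2)]])

lemma sup_dist_least:
  assumes "A \<noteq> {}" "\<And>a. a \<in> A \<Longrightarrow> vnorm k (vminus (f a) (g a)) \<le> e"
  shows "sup_dist k A f g \<le> e"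
  unfolding sup_dist_def by (rule cSUP_least[OF assms])

lemma sup_dist_nonneg:
  assumes "A \<noteq> {}" "bnd_fun k A f" "bnd_fun k A g" shows "0 \<le> sup_dist k A f g"
proof -
  obtain a where "a \<in> A" using assms(1) by blast
  then show ?thesis using sup_dist_upper[OF assms(2,3)] order_trans[OF vnorm_nonneg] by blast
qed

lemma sup_dist_triangle:
  assumes A: "A \<noteq> {}" and f: "bnd_fun k A f" and g: "bnd_fun k A g" and h: "bnd_fun k A h"
  shows "sup_dist k A f h \<le> sup_dist k A f g + sup_dist k A g h"
proof (rule sup_dist_least[OF A])
  fix a assume "a \<in> A"
  then show "vnorm k (vminus (f a) (h a)) \<le> sup_dist k A f g + sup_dist k A g h"
    using vnorm_minus_triangle[of k "f a" "h a" "g a"] sup_dist_upper[OF f g] sup_dist_upper[OF g h]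
    by fastforce
qed

lemma sup_dist_commute: "sup_dist k A f g = sup_dist k A g f"
  unfolding sup_dist_def by (simp add: vnorm_vminus_commute)

lemma sup_dist_self: "A \<noteq> {} \<Longrightarrow> sup_dist k A f f = 0"
  by (simp add: sup_dist_def vminus_def vnorm_def)

lemma sup_dist_cong: "(\<And>a. a \<in> A \<Longrightarrow> f a = f' a) \<Longrightarrow> sup_dist k A f g = sup_dist k A f' g"
  unfolding sup_dist_def by (rule SUP_cong) auto

lemma bc_functional_cong: "bc_functional k A h \<Longrightarrow> (\<And>a. a \<in> A \<Longrightarrow> f a = g a) \<Longrightarrow> h f = h g"
  unfolding bc_functional_def by blast

lemma bc_functional_bounded:
  assumes "bc_functional k A h" shows "\<exists>C\<ge>0. \<forall>f. bnd_fun k A f \<longrightarrow> \<bar>h f\<bar> \<le> C"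
proof -
  obtain C where "\<forall>f. bnd_fun k A f \<longrightarrow> \<bar>h f\<bar> \<le> C" using assms unfolding bc_functional_def by blast
  then show ?thesis by (intro exI[of _ "max 0 C"]) (auto intro: max.coboundedI2)
qed

lemma bc_functional_continuous:
  assumes "bc_functional k A h" "bnd_fun k A f" "0 < e"
  shows "\<exists>d>0. \<forall>g. bnd_fun k A g \<and> sup_dist k A f g < d \<longrightarrow> \<bar>h f - h g\<bar> < e"
  using assms unfolding bc_functional_def by blast

lemma bc_functionalI:
  assumes "\<And>f g. (\<And>a. a \<in> A \<Longrightarrow> f a = g a) \<Longrightarrow> h f = h g"
    and "\<And>f. bnd_fun k A f \<Longrightarrow> \<bar>h f\<bar> \<le> C"
    and "\<And>f e. bnd_fun k A f \<Longrightarrow> 0 < e \<Longrightarrow> \<exists>d>0. \<forall>g. bnd_fun k A g \<and> sup_dist k A f g < d \<longrightarrow> \<bar>h f - h g\<bar> < e"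
  shows "bc_functional k A h"
  unfolding bc_functional_def using assms by blast

lemma bc_functional_add_const:
  assumes "bc_functional k A h" shows "bc_functional k A (\<lambda>f. h f + c)"
proof -
  obtain C where C: "\<forall>f. bnd_fun k A f \<longrightarrow> \<bar>h f\<bar> \<le> C" using bc_functional_bounded[OF assms] by blast
  show ?thesis
  proof (rule bc_functionalI[where C="C + \<bar>c\<bar>"])
    fix f :: "'a \<Rightarrow> vec" assume "bnd_fun k A f"
    then have "\<bar>h f\<bar> \<le> C" using C by blast
    then show "\<bar>h f + c\<bar> \<le> C + \<bar>c\<bar>" by linarith
  next
    fix f g :: "'a \<Rightarrow> vec" assume "\<And>a. a \<in> A \<Longrightarrow> f a = g a"
    then have "h f = h g" by (rule bc_functional_cong[OF assms])
    then show "h f + c = h g + c" by (rule arg_cong)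
  next
    fix f :: "'a \<Rightarrow> vec" and e :: real assume "bnd_fun k A f" "0 < e"
    from bc_functional_continuous[OF assms this]
    show "\<exists>d>0. \<forall>g. bnd_fun k A g \<and> sup_dist k A f g < d \<longrightarrow> \<bar>h f + c - (h g + c)\<bar> < e" by simp
  qed
qed

lemma bc_functional_minus:
  assumes "bc_functional k A h" shows "bc_functional k A (\<lambda>f. - h f)"
  using assms unfolding bc_functional_def by (simp add: abs_minus_commute)

text \<open>A one-sided Lipschitz bound for all pairs is two-sided, because \<open>sup_dist\<close>
  is symmetric. Dividing by L + 1 instead of L covers L = 0.\<close>

lemma bc_functional_lipschitz:
  assumes ext: "\<And>f g. (\<And>a. a \<in> A \<Longrightarrow> f a = g a) \<Longrightarrow> h f = h g"
    and bdd: "\<And>f. bnd_fun k A f \<Longrightarrow> \<bar>h f\<bar> \<le> C"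
    and lip: "\<And>f g. bnd_fun k A f \<Longrightarrow> bnd_fun k A g \<Longrightarrow> h f \<le> h g + L * sup_dist k A f g"
    and L: "0 \<le> L"
  shows "bc_functional k A h"
proof (rule bc_functionalI[where C=C])
  fix f :: "'a \<Rightarrow> vec" and e :: real assume f: "bnd_fun k A f" and e: "0 < e"
  show "\<exists>d>0. \<forall>g. bnd_fun k A g \<and> sup_dist k A f g < d \<longrightarrow> \<bar>h f - h g\<bar> < e"
  proof (intro exI[of _ "e / (L + 1)"] conjI allI impI)
    fix g assume g: "bnd_fun k A g \<and> sup_dist k A f g < e / (L + 1)"
    have "\<bar>h f - h g\<bar> \<le> L * sup_dist k A f g"
      using lip[OF f] lip[OF _ f] g sup_dist_commute[of k A f g] by (smt (verit))
    also have "\<dots> \<le> L * (e / (L + 1))" using g L by (intro mult_left_mono) auto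
    also have "\<dots> < e" using L e by (simp add: field_simps)
    finally show "\<bar>h f - h g\<bar> < e" .
  qed (use e L in auto)
next
  fix f g :: "'a \<Rightarrow> vec" assume "\<And>a. a \<in> A \<Longrightarrow> f a = g a"
  then show "h f = h g" by (rule ext)
qed (rule bdd)

text \<open>Pasch--Hausdorff regularisation.\<close>
lemma bc_functional_envelope:
  assumes A: "A \<noteq> {}" and h: "bc_functional k A h"
  obtains C U where "0 \<le> C" "\<And>n. bc_functional k A (U n)"
    "\<And>n f. bnd_fun k A f \<Longrightarrow> h f \<le> U n f" "\<And>n f. bnd_fun k A f \<Longrightarrow> \<bar>U n f\<bar> \<le> C"
    "\<And>n f g. bnd_fun k A f \<Longrightarrow> bnd_fun k A g \<Longrightarrow> U n f \<le> U n g + real n * sup_dist k A f g"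
    "\<And>f. bnd_fun k A f \<Longrightarrow> (\<lambda>n. U n f) \<longlonglongrightarrow> h f"
proof -
  let ?B = "Collect (bnd_fun k A)" and ?d = "sup_dist k A"
  obtain C where C0: "0 \<le> C" "\<forall>f. bnd_fun k A f \<longrightarrow> \<bar>h f\<bar> \<le> C"
    using bc_functional_bounded[OF h] by blast
  note C = C0(1) C0(2)[rule_format]
  \<comment> \<open>The penalty of slope n makes the supremum n-Lipschitz, and g = f keeps it above
    h. As n grows, distant g are priced out and continuity of h at f forces convergence.\<close>
  define U where "U n f = (SUP g\<in>?B. h g - real n * ?d f g)" for n f
  have ne: "?B \<noteq> {}"
  proof -
    have "bnd_fun k A (\<lambda>_. zvec)" by (auto simp: bnd_fun_def)
    then show ?thesis by blast
  qed
  have le: "h g - real n * ?d f g \<le> C" if "bnd_fun k A f" "bnd_fun k A g" for f g n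
  proof -
    have "0 \<le> real n * ?d f g" using sup_dist_nonneg[OF A that] by simp
    then show ?thesis using C(2)[OF that(2)] by linarith
  qed
  have bdd: "bdd_above ((\<lambda>g. h g - real n * ?d f g) ` ?B)" if "bnd_fun k A f" for f n
    using le[OF that] by (intro bdd_aboveI2[of _ _ C]) auto
  have hU: "h f \<le> U n f" if f: "bnd_fun k A f" for n f
    using cSUP_upper[OF _ bdd[OF f, of n], of f] f sup_dist_self[OF A, of k f] by (simp add: U_def)
  have UC: "U n f \<le> C" if f: "bnd_fun k A f" for n f
    unfolding U_def by (rule cSUP_least[OF ne]) (use le[OF f] in auto)
  have absU: "\<bar>U n f\<bar> \<le> C" if f: "bnd_fun k A f" for n f
    using hU[OF f, of n] UC[OF f, of n] C(2)[OF f] by linarith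
  have lip: "U n f \<le> U n g + real n * ?d f g" if f: "bnd_fun k A f" and g: "bnd_fun k A g" for n f g
    unfolding U_def[of n f]
  proof (rule cSUP_least[OF ne])
    fix l assume l: "l \<in> ?B"
    have "real n * ?d g l \<le> real n * (?d f g + ?d f l)"
      using sup_dist_triangle[OF A g f, of l] l sup_dist_commute[of k A g f] by (intro mult_left_mono) auto
    moreover have "h l - real n * ?d g l \<le> U n g" unfolding U_def by (rule cSUP_upper[OF l bdd[OF g]])
    ultimately show "h l - real n * ?d f l \<le> U n g + real n * ?d f g"
      by (simp add: distrib_left)
  qed
  have bc: "bc_functional k A (U n)" for n
  proof (rule bc_functional_lipschitz[where C=C and L="real n"])
    fix f g :: "'a \<Rightarrow> vec" assume "\<And>a. a \<in> A \<Longrightarrow> f a = g a"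
    then show "U n f = U n g" unfolding U_def using sup_dist_cong[of A f g] by simp
  qed (use absU lip in auto)
  have lim: "(\<lambda>n. U n f) \<longlonglongrightarrow> h f" if f: "bnd_fun k A f" for f
  proof (rule LIMSEQ_I)
    fix e :: real assume e: "0 < e"
    have "0 < e / 2" using e by simp
    from bc_functional_continuous[OF h f this]
    obtain d where d: "0 < d" "\<forall>g. bnd_fun k A g \<and> ?d f g < d \<longrightarrow> \<bar>h f - h g\<bar> < e / 2" by blast
    \<comment> \<open>From this index on, the penalty outside the d-ball is at least 2C, the largest
      possible oscillation of h.\<close>
    obtain N where N: "2 * C / d \<le> real N" using real_arch_simple by blast
    have "norm (U n f - h f) < e" if n: "N \<le> n" for n
    proof -
      have "U n f \<le> h f + e / 2"
        unfolding U_def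
      proof (rule cSUP_least[OF ne])
        fix g assume g: "g \<in> ?B"
        have dnn: "0 \<le> ?d f g" using sup_dist_nonneg[OF A f] g by simp
        show "h g - real n * ?d f g \<le> h f + e / 2"
        proof (cases "?d f g < d")
          case True
          have "0 \<le> real n * ?d f g" using dnn by simp
          moreover have "\<bar>h f - h g\<bar> < e / 2" using d(2) g True by blast
          ultimately show ?thesis by linarith
        next
          case False
          have "2 * C \<le> real N * d" using N d(1) by (simp add: field_simps)
          also have "\<dots> \<le> real n * ?d f g" using n False d(1) by (intro mult_mono) auto
          finally show ?thesis using C(2)[of g] C(2)[OF f] g e by (simp add: abs_le_iff)
        qed
      qed
      then show ?thesis using hU[OF f, of n] e by simp
    qed
    then show "\<exists>no. \<forall>n\<ge>no. norm (U n f - h f) < e" by blast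
  qed
  show ?thesis by (rule that[OF C(1) bc hU absU lip lim])
qed

text \<open>Since \<open>h\<close> and \<open>h + 1\<close> cannot both have integral 0 in the limit, a weak limit composed with
  any bounded continuous functional is automatically measurable.\<close>
lemma weak_conv_integrable:
  assumes M: "prob_space M" and N: "prob_space N"
    and X: "weak_conv_proc k A M X N Xl" "\<And>T \<omega>. \<omega> \<in> space M \<Longrightarrow> bnd_fun k A (\<lambda>a. X T a \<omega>)"
    and h: "bc_functional k A h"
  shows "integrable N (\<lambda>\<eta>. h (\<lambda>a. Xl a \<eta>))"
proof (rule ccontr)
  interpret M: prob_space M by fact
  interpret N: prob_space N by fact
  assume ni: "\<not> ?thesis"
  then have ni1: "\<not> integrable N (\<lambda>\<eta>. h (\<lambda>a. Xl a \<eta>) + 1)"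
    using Bochner_Integration.integrable_diff[of N "\<lambda>\<eta>. h (\<lambda>a. Xl a \<eta>) + 1" "\<lambda>_. 1"] by auto
  obtain C where C: "\<forall>f. bnd_fun k A f \<longrightarrow> \<bar>h f\<bar> \<le> C" using bc_functional_bounded[OF h] by blast
  have 1: "(\<lambda>T. outer_exp M (\<lambda>\<omega>. h (\<lambda>a. X T a \<omega>))) \<longlonglongrightarrow> 0"
    using X(1) h not_integrable_integral_eq[OF ni] unfolding weak_conv_proc_def by fastforce
  have "(\<lambda>T. outer_exp M (\<lambda>\<omega>. h (\<lambda>a. X T a \<omega>) + 1)) \<longlonglongrightarrow> 0"
    using X(1) bc_functional_add_const[OF h, of 1] not_integrable_integral_eq[OF ni1]
    unfolding weak_conv_proc_def by fastforce
  moreover have "outer_exp M (\<lambda>\<omega>. h (\<lambda>a. X T a \<omega>) + 1) = outer_exp M (\<lambda>\<omega>. h (\<lambda>a. X T a \<omega>)) + 1" for T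
    by (rule M.outer_exp_add_const[where B=C]) (use C X(2) in auto)
  ultimately have "(\<lambda>T. outer_exp M (\<lambda>\<omega>. h (\<lambda>a. X T a \<omega>)) + 1) \<longlonglongrightarrow> 0" by simp
  moreover have "(\<lambda>T. outer_exp M (\<lambda>\<omega>. h (\<lambda>a. X T a \<omega>)) + 1) \<longlonglongrightarrow> 0 + 1"
    by (intro tendsto_intros 1)
  ultimately show False using LIMSEQ_unique by fastforce
qed

lemma weak_convD:
  "weak_conv_proc k A M X N Xl \<Longrightarrow> bc_functional k A h \<Longrightarrow>
    (\<lambda>T. outer_exp M (\<lambda>\<omega>. h (\<lambda>a. X T a \<omega>))) \<longlonglongrightarrow> integral\<^sup>L N (\<lambda>\<eta>. h (\<lambda>a. Xl a \<eta>))"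
  by (simp add: weak_conv_proc_def)

text \<open>The excess of the sup norm over n, clipped to [0, 1], is a Lipschitz functional. Limit
  paths are bounded almost surely, so its limit expectation vanishes as n grows; weak convergence
  and Markov's inequality then bound the sup norm by n + 1, the level at which the clipping reaches
  1.\<close>

lemma weak_conv_tight:
  assumes M: "prob_space M" and N: "prob_space N"
    and X: "weak_conv_proc k A M X N Xl" "\<And>T \<omega>. \<omega> \<in> space M \<Longrightarrow> bnd_fun k A (\<lambda>a. X T a \<omega>)"
    and Xl: "AE \<eta> in N. bnd_fun k A (\<lambda>a. Xl a \<eta>)" and \<eta>: "0 < \<eta>" and A: "A \<noteq> {}"
  shows "\<exists>K\<ge>0. evp M \<eta> (\<lambda>T \<omega>. \<forall>a\<in>A. vnorm k (X T a \<omega>) \<le> K)"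
proof -
  interpret M: prob_space M by fact
  interpret N: prob_space N by fact
  define h where "h n f = min 1 (max 0 ((SUP a\<in>A. vnorm k (f a)) - real n))" for n :: nat and f
  have bdd: "bdd_above ((\<lambda>a. vnorm k (f a)) ` A)" if "bnd_fun k A f" for f
    using that by (auto simp: bnd_fun_def bdd_above_def)
  have h01: "0 \<le> h n f" "h n f \<le> 1" for n f by (auto simp: h_def)
  have bc: "bc_functional k A (h n)" for n
  proof (rule bc_functional_lipschitz[where C=1 and L=1])
    fix f g :: "_ \<Rightarrow> vec" assume "\<And>a. a \<in> A \<Longrightarrow> f a = g a"
    then show "h n f = h n g" by (simp add: h_def)
  next
    fix f g assume f: "bnd_fun k A f" and g: "bnd_fun k A g"
    have "(SUP a\<in>A. vnorm k (f a)) \<le> (SUP a\<in>A. vnorm k (g a)) + sup_dist k A f g"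
    proof (rule cSUP_least[OF A])
      fix a assume a: "a \<in> A"
      have "vnorm k (f a) \<le> vnorm k (g a) + vnorm k (vminus (f a) (g a))"
        unfolding vminus_def by (rule vnorm_le_add_minus)
      then show "vnorm k (f a) \<le> (SUP a\<in>A. vnorm k (g a)) + sup_dist k A f g"
        using cSUP_upper[OF a bdd[OF g]] sup_dist_upper[OF f g a] by linarith
    qed
    then show "h n f \<le> h n g + 1 * sup_dist k A f g"
      using sup_dist_nonneg[OF A f g] by (auto simp: h_def)
  qed (use h01 in auto)
  have "(\<lambda>n. integral\<^sup>L N (\<lambda>\<eta>. h n (\<lambda>a. Xl a \<eta>))) \<longlonglongrightarrow> integral\<^sup>L N (\<lambda>\<eta>. 0)"
  proof (rule integral_dominated_convergence[where w="\<lambda>_. 1"])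
    show "(\<lambda>\<eta>. h n (\<lambda>a. Xl a \<eta>)) \<in> borel_measurable N" for n
      using weak_conv_integrable[OF M N X bc] by auto
    show "AE \<eta> in N. (\<lambda>n. h n (\<lambda>a. Xl a \<eta>)) \<longlonglongrightarrow> 0"
      using Xl
    proof eventually_elim
      case (elim \<eta>)
      obtain m where m: "(SUP a\<in>A. vnorm k (Xl a \<eta>)) \<le> real m" using real_arch_simple by blast
      have "h n (\<lambda>a. Xl a \<eta>) = 0" if "m \<le> n" for n
      proof -
        have "real m \<le> real n" using that by simp
        then show ?thesis using m by (simp add: h_def)
      qed
      then show ?case by (intro tendsto_eventually) (auto simp: eventually_sequentially)
    qed
  qed (use h01 in auto)
  then have "(\<lambda>n. integral\<^sup>L N (\<lambda>\<eta>. h n (\<lambda>a. Xl a \<eta>))) \<longlonglongrightarrow> 0" by simp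
  then have "\<forall>\<^sub>F n in sequentially. integral\<^sup>L N (\<lambda>\<eta>. h n (\<lambda>a. Xl a \<eta>)) < \<eta>"
    using \<eta> by (rule order_tendstoD(2))
  then obtain n where n: "integral\<^sup>L N (\<lambda>\<eta>. h n (\<lambda>a. Xl a \<eta>)) < \<eta>"
    by (auto simp: eventually_sequentially)
  have "\<forall>\<^sub>F T in sequentially. outer_exp M (\<lambda>\<omega>. h n (\<lambda>a. X T a \<omega>)) < \<eta>"
    by (rule order_tendstoD(2)[OF weak_convD[OF X(1) bc] n])
  then have "evp M \<eta> (\<lambda>T \<omega>. h n (\<lambda>a. X T a \<omega>) < 1)"
    unfolding evp_def
    by eventually_elim (rule M.outer_exp_markov[where B=1], use h01 in auto)
  then have "evp M \<eta> (\<lambda>T \<omega>. \<forall>a\<in>A. vnorm k (X T a \<omega>) \<le> real n + 1)"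
  proof (rule evp_mono[OF _ order_refl], intro always_eventually allI ballI impI)
    fix T \<omega> a assume w: "\<omega> \<in> space M" and h: "h n (\<lambda>a. X T a \<omega>) < 1" and a: "a \<in> A"
    have "vnorm k (X T a \<omega>) \<le> (SUP a\<in>A. vnorm k (X T a \<omega>))" by (rule cSUP_upper[OF a bdd[OF X(2)[OF w]]])
    then show "vnorm k (X T a \<omega>) \<le> real n + 1" using h by (simp add: h_def min_def max_def split: if_splits)
  qed
  then show ?thesis by (intro exI[of _ "real n + 1"]) auto
qed

text \<open>The continuous mapping principle at the level of test functionals. The modulus of
  continuity of \<open>G\<close> may depend on \<open>f\<close>, so locally Lipschitz maps
  qualify.\<close>

lemma bc_functional_compose:
  assumes h: "bc_functional k' A h"
    and ext: "\<And>f g. (\<And>a. a \<in> A \<Longrightarrow> f a = g a) \<Longrightarrow> (\<And>a. a \<in> A \<Longrightarrow> G f a = G g a)"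
    and bnd: "\<And>f. bnd_fun k A f \<Longrightarrow> bnd_fun k' A (G f)"
    and cont: "\<And>f e. bnd_fun k A f \<Longrightarrow> 0 < e \<Longrightarrow> \<exists>d>0. \<forall>g. bnd_fun k A g \<and> sup_dist k A f g < d \<longrightarrow>
        sup_dist k' A (G f) (G g) < e"
  shows "bc_functional k A (\<lambda>f. h (G f))"
proof -
  obtain C where C: "\<forall>f. bnd_fun k' A f \<longrightarrow> \<bar>h f\<bar> \<le> C" using bc_functional_bounded[OF h] by blast
  show ?thesis
  proof (rule bc_functionalI[where C=C])
    fix f g :: "_ \<Rightarrow> vec" assume "\<And>a. a \<in> A \<Longrightarrow> f a = g a"
    then show "h (G f) = h (G g)" by (rule bc_functional_cong[OF h ext])
  next
    fix f assume "bnd_fun k A f"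
    then show "\<bar>h (G f)\<bar> \<le> C" using C bnd by blast
  next
    fix f and e :: real assume f: "bnd_fun k A f" and e: "0 < e"
    obtain d where d: "0 < d" "\<forall>g. bnd_fun k' A g \<and> sup_dist k' A (G f) g < d \<longrightarrow> \<bar>h (G f) - h g\<bar> < e"
      using bc_functional_continuous[OF h bnd[OF f] e] by blast
    obtain d' where "0 < d'" "\<forall>g. bnd_fun k A g \<and> sup_dist k A f g < d' \<longrightarrow> sup_dist k' A (G f) (G g) < d"
      using cont[OF f d(1)] by blast
    then show "\<exists>d>0. \<forall>g. bnd_fun k A g \<and> sup_dist k A f g < d \<longrightarrow> \<bar>h (G f) - h (G g)\<bar> < e"
      using d(2) bnd by blast
  qed
qed

text \<open>Closeness of \<open>X\<close> and \<open>Y\<close> does not control h(X) - h(Y) for a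
  merely continuous h, but it controls a Lipschitz majorant of h. An envelope whose limit
  expectation exceeds that of h by less than e loses only e. The matching lower bound comes from
  -h.\<close>

lemma weak_conv_slutsky_upper:
  assumes M: "prob_space M" and N: "prob_space N" and A: "A \<noteq> {}"
    and X: "weak_conv_proc k A M X N Xl" "\<And>T \<omega>. \<omega> \<in> space M \<Longrightarrow> bnd_fun k A (\<lambda>a. X T a \<omega>)"
    and Y: "\<And>T \<omega>. \<omega> \<in> space M \<Longrightarrow> bnd_fun k A (\<lambda>a. Y T a \<omega>)"
    and Xl: "AE \<eta> in N. bnd_fun k A (\<lambda>a. Xl a \<eta>)"
    and XY: "\<And>e. 0 < e \<Longrightarrow> whp M (\<lambda>T \<omega>. \<forall>a\<in>A. vnorm k (vminus (X T a \<omega>) (Y T a \<omega>)) \<le> e)"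
    and h: "bc_functional k A h" and e: "0 < e"
  shows "\<exists>U. bc_functional k A U \<and> integral\<^sup>L N (\<lambda>\<eta>. U (\<lambda>a. Xl a \<eta>)) < integral\<^sup>L N (\<lambda>\<eta>. h (\<lambda>a. Xl a \<eta>)) + e
    \<and> (\<exists>B\<ge>0. \<forall>\<^sub>F T in sequentially. \<exists>C\<in>sets M. 2 * B * measure M C \<le> e
        \<and> (\<forall>\<omega>\<in>space M - C. h (\<lambda>a. Y T a \<omega>) \<le> U (\<lambda>a. X T a \<omega>) + e)
        \<and> (\<forall>\<omega>\<in>space M. \<bar>h (\<lambda>a. Y T a \<omega>)\<bar> \<le> B \<and> \<bar>U (\<lambda>a. X T a \<omega>)\<bar> \<le> B))"
proof -
  interpret M: prob_space M by fact
  interpret N: prob_space N by fact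
  obtain C U where C: "0 \<le> C" and U: "\<And>n. bc_functional k A (U n)"
    "\<And>n f. bnd_fun k A f \<Longrightarrow> h f \<le> U n f" "\<And>n f. bnd_fun k A f \<Longrightarrow> \<bar>U n f\<bar> \<le> C"
    "\<And>n f g. bnd_fun k A f \<Longrightarrow> bnd_fun k A g \<Longrightarrow> U n f \<le> U n g + real n * sup_dist k A f g"
    "\<And>f. bnd_fun k A f \<Longrightarrow> (\<lambda>n. U n f) \<longlonglongrightarrow> h f"
    by (rule bc_functional_envelope[OF A h]) (rule that)
  obtain C' where C'0: "0 \<le> C'" "\<forall>f. bnd_fun k A f \<longrightarrow> \<bar>h f\<bar> \<le> C'" using bc_functional_bounded[OF h] by blast
  note C' = C'0(1) C'0(2)[rule_format]
  have "(\<lambda>n. integral\<^sup>L N (\<lambda>\<eta>. U n (\<lambda>a. Xl a \<eta>))) \<longlonglongrightarrow> integral\<^sup>L N (\<lambda>\<eta>. h (\<lambda>a. Xl a \<eta>))"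
  proof (rule integral_dominated_convergence[where w="\<lambda>_. C"])
    show "(\<lambda>\<eta>. h (\<lambda>a. Xl a \<eta>)) \<in> borel_measurable N"
      using weak_conv_integrable[OF M N X h] by auto
    show "(\<lambda>\<eta>. U n (\<lambda>a. Xl a \<eta>)) \<in> borel_measurable N" for n
      using weak_conv_integrable[OF M N X U(1)] by auto
    show "AE \<eta> in N. (\<lambda>n. U n (\<lambda>a. Xl a \<eta>)) \<longlonglongrightarrow> h (\<lambda>a. Xl a \<eta>)"
      using Xl by eventually_elim (rule U(5))
    show "AE \<eta> in N. norm (U n (\<lambda>a. Xl a \<eta>)) \<le> C" for n
      using Xl by eventually_elim (use U(3) in auto)
  qed auto
  then have "\<forall>\<^sub>F n in sequentially. integral\<^sup>L N (\<lambda>\<eta>. U n (\<lambda>a. Xl a \<eta>)) < integral\<^sup>L N (\<lambda>\<eta>. h (\<lambda>a. Xl a \<eta>)) + e"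
    using e by (intro order_tendstoD(2)) auto
  then obtain n where n: "integral\<^sup>L N (\<lambda>\<eta>. U n (\<lambda>a. Xl a \<eta>)) < integral\<^sup>L N (\<lambda>\<eta>. h (\<lambda>a. Xl a \<eta>)) + e"
    by (auto simp: eventually_sequentially)
  \<comment> \<open>One bound for both functionals; the added 1 keeps e / (2B) a proper positive
    level even for zero functionals.\<close>
  let ?B = "C + C' + 1"
  \<comment> \<open>Distances up to this value change the n-Lipschitz envelope by at most e, also
    for n = 0.\<close>
  let ?e = "e / (real n + 1)"
  have "evp M (e / (2 * ?B)) (\<lambda>T \<omega>. \<forall>a\<in>A. vnorm k (vminus (X T a \<omega>) (Y T a \<omega>)) \<le> ?e)"
    using e C C' by (intro whpD[OF XY]) auto
  then have "\<forall>\<^sub>F T in sequentially. \<exists>D\<in>sets M. 2 * ?B * measure M D \<le> e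
        \<and> (\<forall>\<omega>\<in>space M - D. h (\<lambda>a. Y T a \<omega>) \<le> U n (\<lambda>a. X T a \<omega>) + e)
        \<and> (\<forall>\<omega>\<in>space M. \<bar>h (\<lambda>a. Y T a \<omega>)\<bar> \<le> ?B \<and> \<bar>U n (\<lambda>a. X T a \<omega>)\<bar> \<le> ?B)"
    unfolding evp_def
  proof eventually_elim
    case (elim T)
    then obtain D where D: "D \<in> sets M" "measure M D < e / (2 * ?B)"
      "\<forall>\<omega>\<in>space M - D. \<forall>a\<in>A. vnorm k (vminus (X T a \<omega>) (Y T a \<omega>)) \<le> ?e" by blast
    have 1: "2 * ?B * measure M D \<le> e" using D(2) C C'(1) by (simp add: field_simps)
    have 2: "h (\<lambda>a. Y T a \<omega>) \<le> U n (\<lambda>a. X T a \<omega>) + e" if w: "\<omega> \<in> space M - D" for \<omega>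
    proof -
      have bX: "bnd_fun k A (\<lambda>a. X T a \<omega>)" and bY: "bnd_fun k A (\<lambda>a. Y T a \<omega>)" using w X(2) Y by auto
      have "sup_dist k A (\<lambda>a. X T a \<omega>) (\<lambda>a. Y T a \<omega>) \<le> ?e"
        using D(3) w by (intro sup_dist_least[OF A]) auto
      then have "real n * sup_dist k A (\<lambda>a. Y T a \<omega>) (\<lambda>a. X T a \<omega>) \<le> real n * ?e"
        by (intro mult_left_mono) (simp_all add: sup_dist_commute)
      also have "\<dots> \<le> e" using e by (simp add: field_simps)
      finally show ?thesis using U(2)[OF bY, of n] U(4)[OF bY bX, of n] by linarith
    qed
    have 3: "\<bar>h (\<lambda>a. Y T a \<omega>)\<bar> \<le> ?B" if "\<omega> \<in> space M" for \<omega>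
      using C'(2)[OF Y[OF that, of T]] C(1) C'(1) by linarith
    have 4: "\<bar>U n (\<lambda>a. X T a \<omega>)\<bar> \<le> ?B" if "\<omega> \<in> space M" for \<omega>
      using U(3)[OF X(2)[OF that, of T], of n] C(1) C'(1) by linarith
    show ?case using D(1) 1 2 3 4 by blast
  qed
  then show ?thesis using U(1) n C C'(1) by (intro exI[of _ "U n"] conjI exI[of _ ?B]) auto
qed

text \<open>The expectation of h(Y) is squeezed between those of an upper envelope of h and of minus
  an upper envelope of -h, both evaluated along \<open>X\<close>, where convergence is
  known.\<close>

lemma weak_conv_slutsky:
  assumes M: "prob_space M" and N: "prob_space N" and A: "A \<noteq> {}"
    and X: "weak_conv_proc k A M X N Xl" "\<And>T \<omega>. \<omega> \<in> space M \<Longrightarrow> bnd_fun k A (\<lambda>a. X T a \<omega>)"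
    and Y: "\<And>T \<omega>. \<omega> \<in> space M \<Longrightarrow> bnd_fun k A (\<lambda>a. Y T a \<omega>)"
    and Xl: "AE \<eta> in N. bnd_fun k A (\<lambda>a. Xl a \<eta>)"
    and XY: "\<And>e. 0 < e \<Longrightarrow> whp M (\<lambda>T \<omega>. \<forall>a\<in>A. vnorm k (vminus (X T a \<omega>) (Y T a \<omega>)) \<le> e)"
  shows "weak_conv_proc k A M Y N Xl"
  unfolding weak_conv_proc_def
proof (intro allI impI)
  interpret M: prob_space M by fact
  interpret N: prob_space N by fact
  fix h assume h: "bc_functional k A h"
  let ?I = "integral\<^sup>L N (\<lambda>\<eta>. h (\<lambda>a. Xl a \<eta>))"
  show "(\<lambda>T. outer_exp M (\<lambda>\<omega>. h (\<lambda>a. Y T a \<omega>))) \<longlonglongrightarrow> ?I"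
  proof (rule tendstoI)
    fix e' :: real assume "0 < e'"
    \<comment> \<open>Each side collects three errors of size e: the gap of envelope and functional
      in the limit, the distance of \<open>X\<close> and \<open>Y\<close>, and the exceptional
      set.\<close>
    define e where "e = e' / 5"
    have e: "0 < e" using \<open>0 < e'\<close> by (simp add: e_def)
    obtain U B where U: "bc_functional k A U" "integral\<^sup>L N (\<lambda>\<eta>. U (\<lambda>a. Xl a \<eta>)) < ?I + e"
      and B: "0 \<le> B" and evU: "\<forall>\<^sub>F T in sequentially. \<exists>C\<in>sets M. 2 * B * measure M C \<le> e
        \<and> (\<forall>\<omega>\<in>space M - C. h (\<lambda>a. Y T a \<omega>) \<le> U (\<lambda>a. X T a \<omega>) + e)
        \<and> (\<forall>\<omega>\<in>space M. \<bar>h (\<lambda>a. Y T a \<omega>)\<bar> \<le> B \<and> \<bar>U (\<lambda>a. X T a \<omega>)\<bar> \<le> B)"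
      using weak_conv_slutsky_upper[OF M N A X Y Xl XY h e] by blast
    obtain V D where V: "bc_functional k A V"
        "integral\<^sup>L N (\<lambda>\<eta>. V (\<lambda>a. Xl a \<eta>)) < integral\<^sup>L N (\<lambda>\<eta>. - h (\<lambda>a. Xl a \<eta>)) + e"
      and D: "0 \<le> D" and evV: "\<forall>\<^sub>F T in sequentially. \<exists>C\<in>sets M. 2 * D * measure M C \<le> e
        \<and> (\<forall>\<omega>\<in>space M - C. - h (\<lambda>a. Y T a \<omega>) \<le> V (\<lambda>a. X T a \<omega>) + e)
        \<and> (\<forall>\<omega>\<in>space M. \<bar>- h (\<lambda>a. Y T a \<omega>)\<bar> \<le> D \<and> \<bar>V (\<lambda>a. X T a \<omega>)\<bar> \<le> D)"
      using weak_conv_slutsky_upper[OF M N A X Y Xl XY bc_functional_minus[OF h] e] by blast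
    have limU: "\<forall>\<^sub>F T in sequentially. outer_exp M (\<lambda>\<omega>. U (\<lambda>a. X T a \<omega>)) < ?I + e"
      by (rule order_tendstoD(2)[OF weak_convD[OF X(1) U(1)] U(2)])
    have "?I - e < integral\<^sup>L N (\<lambda>\<eta>. - V (\<lambda>a. Xl a \<eta>))" using V(2) by simp
    then have limV: "\<forall>\<^sub>F T in sequentially. ?I - e < outer_exp M (\<lambda>\<omega>. - V (\<lambda>a. X T a \<omega>))"
      by (rule order_tendstoD(1)[OF weak_convD[OF X(1) bc_functional_minus[OF V(1)]]])
    show "\<forall>\<^sub>F T in sequentially. dist (outer_exp M (\<lambda>\<omega>. h (\<lambda>a. Y T a \<omega>))) ?I < e'"
      using evU evV limU limV
    proof eventually_elim
      case (elim T)
      obtain C where C: "C \<in> sets M" "2 * B * measure M C \<le> e"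
        "\<forall>\<omega>\<in>space M - C. h (\<lambda>a. Y T a \<omega>) \<le> U (\<lambda>a. X T a \<omega>) + e"
        "\<forall>\<omega>\<in>space M. \<bar>h (\<lambda>a. Y T a \<omega>)\<bar> \<le> B \<and> \<bar>U (\<lambda>a. X T a \<omega>)\<bar> \<le> B" using elim(1) by blast
      obtain C' where C': "C' \<in> sets M" "2 * D * measure M C' \<le> e"
        "\<forall>\<omega>\<in>space M - C'. - h (\<lambda>a. Y T a \<omega>) \<le> V (\<lambda>a. X T a \<omega>) + e"
        "\<forall>\<omega>\<in>space M. \<bar>- h (\<lambda>a. Y T a \<omega>)\<bar> \<le> D \<and> \<bar>V (\<lambda>a. X T a \<omega>)\<bar> \<le> D" using elim(2) by blast
      have "outer_exp M (\<lambda>\<omega>. h (\<lambda>a. Y T a \<omega>))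
          \<le> outer_exp M (\<lambda>\<omega>. U (\<lambda>a. X T a \<omega>)) + e + 2 * B * measure M C"
        by (rule M.outer_exp_perturb) (use C e in auto)
      moreover have "outer_exp M (\<lambda>\<omega>. - V (\<lambda>a. X T a \<omega>))
          \<le> outer_exp M (\<lambda>\<omega>. h (\<lambda>a. Y T a \<omega>)) + e + 2 * D * measure M C'"
        by (rule M.outer_exp_perturb) (use C' e in force)+
      ultimately show ?case using elim(3,4) C(2) C'(2) e by (simp add: dist_real_def e_def abs_less_iff)
    qed
  qed
qed

section \<open>The Gaussian autoregressive likelihood\<close>

text \<open>The function vanishes at 0 and has derivative -x^2 (2+x)/(1+x)^2, at most 10x^2 in
  absolute value for |x| <= 1/2; the mean value inequality gives the cubic bound. This combination
  of logarithm and reciprocal is what a Gaussian likelihood leaves over when its variance is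
  multiplied by 1 + k.\<close>

lemma ln_remainder_bound:
  fixes k :: real assumes k: "\<bar>k\<bar> \<le> 1 / 2"
  shows "\<bar>ln (1 + k) + 1 / (1 + k) - 1 - k\<^sup>2 / 2\<bar> \<le> 10 * \<bar>k\<bar> ^ 3"
proof -
  let ?f = "\<lambda>x::real. ln (1 + x) + 1 / (1 + x) - 1 - x\<^sup>2 / 2"
  let ?f' = "\<lambda>x::real. 1 / (1 + x) - 1 / (1 + x)\<^sup>2 - x"
  let ?S = "{-\<bar>k\<bar>..\<bar>k\<bar>}"
  have pos: "0 < 1 + x" if "x \<in> ?S" for x using that k by auto
  have der: "(?f has_real_derivative ?f' x) (at x within ?S)" if x: "x \<in> ?S" for x
    using pos[OF x] by (auto intro!: derivative_eq_intros simp: power2_eq_square field_simps)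
  have bound: "norm (?f' x) \<le> 10 * k\<^sup>2" if x: "x \<in> ?S" for x
  proof -
    have "?f' x = - (x\<^sup>2 * ((2 + x) / (1 + x)\<^sup>2))"
    proof -
      define s where "s = 1 + x"
      have "0 < s" and xs: "x = s - 1" using pos[OF x] by (simp_all add: s_def)
      then show ?thesis unfolding s_def[symmetric] xs by (simp add: field_simps power2_eq_square)
    qed
    then have "norm (?f' x) = x\<^sup>2 * ((2 + x) / (1 + x)\<^sup>2)" using pos[OF x] by (simp add: abs_mult)
    also have "\<dots> \<le> k\<^sup>2 * 10"
    proof (rule mult_mono)
      show "x\<^sup>2 \<le> k\<^sup>2" using x by (simp add: abs_le_square_iff[symmetric] abs_le_iff)
      have "(1 / 2)\<^sup>2 \<le> (1 + x)\<^sup>2" using x k by (intro power_mono) auto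
      then have "2 + x \<le> 10 * (1 + x)\<^sup>2" using x k by (simp add: power2_eq_square)
      then show "(2 + x) / (1 + x)\<^sup>2 \<le> 10" using pos[OF x] by (simp add: divide_le_eq)
      show "0 \<le> (2 + x) / (1 + x)\<^sup>2" using pos[OF x] by simp
    qed simp
    finally show ?thesis by simp
  qed
  have "norm (?f k - ?f 0) \<le> 10 * k\<^sup>2 * norm (k - 0)"
    by (rule field_differentiable_bound[of ?S ?f ?f']) (use der bound in auto)
  then show ?thesis by (simp add: power3_eq_cube power2_eq_square abs_mult_self_eq)
qed

text \<open>The change of the Gaussian exponent when the residual u becomes u - d and the variance v
  becomes vr, sorted into a pure variance part, a cross part and a regression part.\<close>

lemma scaled_square_expand:
  fixes u d v r :: real assumes "0 < v" "0 < r"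
  shows "u\<^sup>2 / (2 * v) - (u - d)\<^sup>2 / (2 * (v * r))
    = (1 - 1 / r) * (u\<^sup>2 / (2 * v)) + (1 / r) * (u * d / v) - (1 / r) * (d\<^sup>2 / (2 * v))"
  using assms by (simp add: field_simps power2_eq_square)

locale gaussian_ar = prob_space M for M :: "'w measure" +
  fixes y eps :: "int \<Rightarrow> 'w \<Rightarrow> real" and p :: nat and phs :: vec
  assumes y_measurable [measurable]: "\<And>t. y t \<in> borel_measurable M"
    and y_eq: "\<And>t \<omega>. \<omega> \<in> space M \<Longrightarrow>
      y t \<omega> = phs 0 + (\<Sum>i=1..p. phs i * y (t - int i) \<omega>) + sqrt (phs (p + 1)) * eps t \<omega>"
    and eps_normal: "\<And>t. distributed M lborel (eps t) (\<lambda>x. ennreal (std_normal_density x))"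
    and eps_indep: "\<And>t. indep_set (sets (gen_sigma M {eps t})) (sets (gen_sigma M {y j | j. j < t}))"
    and var_pos: "0 < phs (p + 1)"
begin

definition tau :: real where "tau = phs (p + 1)"

definition reg :: "int \<Rightarrow> 'w \<Rightarrow> vec" where
  "reg t \<omega> = (\<lambda>i. if i = 0 then 1 else y (t - int i) \<omega>)"

definition innov :: "int \<Rightarrow> 'w \<Rightarrow> real" where "innov t \<omega> = sqrt tau * eps t \<omega>"

text \<open>The gradient of ln f at the true parameter, written in innovations. Coordinate p + 1
  belongs to the variance, not to a lag.\<close>

definition score :: "int \<Rightarrow> 'w \<Rightarrow> vec" where
  "score t \<omega> = (\<lambda>i. if i \<le> p then innov t \<omega> * reg t \<omega> i / tau
     else if i = p + 1 then ((innov t \<omega>)\<^sup>2 / tau - 1) / (2 * tau) else 0)"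

definition nscore :: "nat \<Rightarrow> 'w \<Rightarrow> vec" where
  "nscore T \<omega> = (\<lambda>i. (\<Sum>t\<in>{1..T}. score (int t) \<omega> i) / sqrt (real T))"

text \<open>The negative normalised Hessian, with its asymptotically negligible entries replaced by their limits.\<close>
definition hess :: "nat \<Rightarrow> 'w \<Rightarrow> mat" where
  "hess T \<omega> = (\<lambda>i j. if i \<le> p \<and> j \<le> p
     then (\<Sum>t\<in>{1..T}. reg (int t) \<omega> i * reg (int t) \<omega> j) / (real T * tau)
     else if i = p + 1 \<and> j = p + 1 then 1 / (2 * tau\<^sup>2) else 0)"

lemma tau_pos: "0 < tau" using var_pos by (simp add: tau_def)

lemma sum_reg: "(\<Sum>i\<le>p. c i * reg t \<omega> i) = c 0 + (\<Sum>i=1..p. c i * y (t - int i) \<omega>)"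
  by (simp add: atMost_atLeast0 sum.atLeast_Suc_atMost[of 0 p] reg_def)

lemma resid_eq:
  assumes "\<omega> \<in> space M"
  shows "y t \<omega> - ph 0 - (\<Sum>i=1..p. ph i * y (t - int i) \<omega>)
     = innov t \<omega> - (\<Sum>i\<le>p. (ph i - phs i) * reg t \<omega> i)"
  unfolding sum_reg using y_eq[OF assms, of t]
  by (simp add: innov_def tau_def sum_subtractf left_diff_distrib)

lemma dens_pos: "0 < ph (p + 1) \<Longrightarrow> 0 < dens p y t ph \<omega>"
  by (simp add: dens_def normal_density_pos)

lemma ln_dens:
  assumes "0 < ph (p + 1)"
  shows "ln (dens p y t ph \<omega>) = - ln (2 * pi) / 2 - ln (ph (p + 1)) / 2
     - (y t \<omega> - ph 0 - (\<Sum>i=1..p. ph i * y (t - int i) \<omega>))\<^sup>2 / (2 * ph (p + 1))"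
proof -
  let ?r = "y t \<omega> - ph 0 - (\<Sum>i=1..p. ph i * y (t - int i) \<omega>)"
  have "dens p y t ph \<omega> = exp (- (?r\<^sup>2 / (2 * ph (p + 1)))) / (sqrt (ph (p + 1)) * sqrt (2 * pi))"
    using assms by (simp add: dens_def std_normal_density_def power_divide)
  then have "ln (dens p y t ph \<omega>) = - (?r\<^sup>2 / (2 * ph (p + 1))) - ln (sqrt (ph (p + 1)) * sqrt (2 * pi))"
    using assms by (simp add: ln_div)
  also have "ln (sqrt (ph (p + 1)) * sqrt (2 * pi)) = ln (ph (p + 1)) / 2 + ln (2 * pi) / 2"
    using assms by (simp add: ln_mult ln_sqrt)
  finally show ?thesis by simp
qed

text \<open>The quotient is the derivative of ln f, which is elementary in every coordinate; f is
  recovered as exp (ln f) near the true value.\<close>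

lemma grad_dens_eq_score:
  assumes w: "\<omega> \<in> space M" and i: "i < p + 2"
  shows "grad (p + 2) (\<lambda>ph. dens p y t ph \<omega>) phs i / dens p y t phs \<omega> = score t \<omega> i"
proof -
  let ?d = "dens p y t phs \<omega>"
  let ?u = "innov t \<omega>"
  have res: "y t \<omega> - phs 0 - (\<Sum>i=1..p. phs i * y (t - int i) \<omega>) = ?u"
    using resid_eq[OF w, of t phs] by simp
  have pdiff: "pdiff (\<lambda>ph. dens p y t ph \<omega>) i phs = D * ?d"
    if "((\<lambda>s. ln (dens p y t (phs(i := s)) \<omega>)) has_real_derivative D) (at (phs i))" for D
  proof -
    \<comment> \<open>The identity exp (ln f) = f needs a positive variance, which for i = p + 1
      holds only near the true value; hence it is stated in a neighbourhood.\<close>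
    have ev: "\<forall>\<^sub>F s in nhds (phs i). exp (ln (dens p y t (phs(i := s)) \<omega>)) = dens p y t (phs(i := s)) \<omega>"
    proof -
      have "\<forall>\<^sub>F s in nhds (phs i). i = p + 1 \<longrightarrow> 0 < s"
        using eventually_nhds_in_open[of "{0<..}" "phs i"] var_pos
        by (cases "i = p + 1") (auto elim: eventually_mono)
      then show ?thesis
      proof eventually_elim
        case (elim s)
        then have "0 < (phs(i := s)) (p + 1)" using var_pos by (cases "i = p + 1") auto
        then show ?case using dens_pos by simp
      qed
    qed
    have "((\<lambda>s. exp (ln (dens p y t (phs(i := s)) \<omega>))) has_real_derivative
        exp (ln (dens p y t (phs(i := phs i)) \<omega>)) * D) (at (phs i))"
      by (rule DERIV_chain'[OF that DERIV_exp])
    then have "((\<lambda>s. dens p y t (phs(i := s)) \<omega>) has_real_derivative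
        exp (ln (dens p y t (phs(i := phs i)) \<omega>)) * D) (at (phs i))"
      by (subst DERIV_cong_ev[OF refl ev[THEN eventually_mono] refl, symmetric]) auto
    then show ?thesis
      unfolding pdiff_def using dens_pos[where ph=phs, OF var_pos, where t=t and \<omega>=\<omega>] by (simp add: DERIV_imp_deriv mult.commute)
  qed
  have dpos: "0 < ?d" by (rule dens_pos[where ph=phs, OF var_pos])
  have "((\<lambda>s. ln (dens p y t (phs(i := s)) \<omega>)) has_real_derivative score t \<omega> i) (at (phs i))"
  proof (cases "i = p + 1")
    case True
    have ev: "\<forall>\<^sub>F s in nhds (phs i). ln (dens p y t (phs(i := s)) \<omega>) = - ln (2 * pi) / 2 - ln s / 2 - ?u\<^sup>2 / (2 * s)"
    proof -
      have "\<forall>\<^sub>F s in nhds (phs i). 0 < s"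
        using eventually_nhds_in_open[of "{0<..}" "phs i"] var_pos True by auto
      then show ?thesis
      proof eventually_elim
        case (elim s)
        have "(\<Sum>j=1..p. (phs(i := s)) j * y (t - int j) \<omega>) = (\<Sum>j=1..p. phs j * y (t - int j) \<omega>)"
          using True by (intro sum.cong) auto
        then show ?case using ln_dens[where ph="phs(i := s)" and t=t and \<omega>=\<omega>] elim True res by simp
      qed
    qed
    have "((\<lambda>s. - ln (2 * pi) / 2 - ln s / 2 - ?u\<^sup>2 / (2 * s)) has_real_derivative score t \<omega> i) (at (phs i))"
      using True var_pos
      by (auto intro!: derivative_eq_intros simp: score_def tau_def field_simps power2_eq_square)
    then show ?thesis by (subst DERIV_cong_ev[OF refl ev refl])
  next
    case False
    then have ip: "i \<le> p" using i by simp
    have eq: "ln (dens p y t (phs(i := s)) \<omega>)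
        = - ln (2 * pi) / 2 - ln tau / 2 - (?u - (s - phs i) * reg t \<omega> i)\<^sup>2 / (2 * tau)" for s
    proof -
      have "(\<Sum>j\<le>p. ((phs(i := s)) j - phs j) * reg t \<omega> j) = (\<Sum>j\<le>p. if j = i then (s - phs i) * reg t \<omega> i else 0)"
        by (intro sum.cong) auto
      also have "\<dots> = (s - phs i) * reg t \<omega> i" using ip by simp
      finally show ?thesis
        using ln_dens[where ph="phs(i := s)" and t=t and \<omega>=\<omega>] resid_eq[OF w, of t "phs(i := s)"] False var_pos by (simp add: tau_def)
    qed
    show ?thesis unfolding eq using tau_pos ip
      by (auto intro!: derivative_eq_intros simp: score_def field_simps power2_eq_square)
  qed
  from pdiff[OF this] show ?thesis using i dpos by (simp add: grad_def)
qed

text \<open>An average of squared combinations of regressors plus a variance term. This form shows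
  nonnegativity at once and reduces tightness to second moments of regressors.\<close>

lemma qform_hess:
  "qform (p + 2) (hess T \<omega>) h
    = (\<Sum>t\<in>{1..T}. (\<Sum>i\<le>p. h i * reg (int t) \<omega> i)\<^sup>2) / (real T * tau) + (h (p + 1))\<^sup>2 / (2 * tau\<^sup>2)"
proof -
  have "qform (p + 2) (hess T \<omega>) h
     = (\<Sum>i\<le>p. \<Sum>j\<le>p. h i * hess T \<omega> i j * h j) + (h (p + 1))\<^sup>2 / (2 * tau\<^sup>2)"
    unfolding qform_def by (simp add: lessThan_Suc_atMost hess_def power2_eq_square)
  also have "(\<Sum>i\<le>p. \<Sum>j\<le>p. h i * hess T \<omega> i j * h j)
     = (\<Sum>i\<le>p. \<Sum>j\<le>p. \<Sum>t\<in>{1..T}. h i * reg (int t) \<omega> i * (h j * reg (int t) \<omega> j)) / (real T * tau)"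
    by (simp add: hess_def sum_divide_distrib sum_distrib_left sum_distrib_right mult_ac)
  also have "(\<Sum>i\<le>p. \<Sum>j\<le>p. \<Sum>t\<in>{1..T}. h i * reg (int t) \<omega> i * (h j * reg (int t) \<omega> j))
      = (\<Sum>i\<le>p. \<Sum>t\<in>{1..T}. \<Sum>j\<le>p. h i * reg (int t) \<omega> i * (h j * reg (int t) \<omega> j))"
    by (intro sum.cong refl sum.swap)
  also have "\<dots> = (\<Sum>t\<in>{1..T}. \<Sum>i\<le>p. \<Sum>j\<le>p. h i * reg (int t) \<omega> i * (h j * reg (int t) \<omega> j))"
    by (rule sum.swap)
  also have "\<dots> = (\<Sum>t\<in>{1..T}. (\<Sum>i\<le>p. h i * reg (int t) \<omega> i)\<^sup>2)"
    by (simp add: power2_eq_square sum_product)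
  finally show ?thesis .
qed

lemma qform_hess_nonneg: "0 \<le> qform (p + 2) (hess T \<omega>) h"
  unfolding qform_hess using tau_pos by (intro add_nonneg_nonneg divide_nonneg_nonneg sum_nonneg) auto

text \<open>With variance tau (1 + k) the regression coefficients enter exactly quadratically, so
  the error is driven by k. What \<open>hess\<close> drops or freezes reappears here: the cross
  entries as k times the regression score, the fluctuation of the variance entry as k^2 times the
  deviation of the mean squared innovation. The score norm, N and the Hessian form stay as factors,
  to be bounded in each application.\<close>

lemma L0_expansion:
  assumes w: "\<omega> \<in> space M" and T: "1 \<le> T"
    and k: "ph (p + 1) = tau * (1 + k)" "\<bar>k\<bar> \<le> 1 / 2"
  defines "h \<equiv> \<lambda>i. sqrt (real T) * (ph i - phs i)"
  defines "N \<equiv> vnorm (p + 2) h" and "s \<equiv> vnorm (p + 2) (nscore T \<omega>)"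
  shows "\<bar>L0 p y T ph \<omega> - L0 p y T phs \<omega>
      - (vdot (p + 2) (nscore T \<omega>) h - qform (p + 2) (hess T \<omega>) h / 2)\<bar>
    \<le> (5 * \<bar>k\<bar> / tau\<^sup>2 + 4 * s / (tau * sqrt (real T))) * N\<^sup>2 + 2 * \<bar>k\<bar> * s * N
      + \<bar>k\<bar> * qform (p + 2) (hess T \<omega>) h"
proof -
  let ?n = "real T" and ?q = "sqrt (real T)" and ?I = "{1..T}"
  let ?u = "\<lambda>t. innov (int t) \<omega>"
  let ?d = "\<lambda>t. \<Sum>i\<le>p. (ph i - phs i) * reg (int t) \<omega> i"
  have n: "0 < ?n" "0 < ?q" "?q * ?q = ?n" using T by auto
  have rho: "0 < 1 + k" "1 / 2 \<le> 1 + k" using k(2) by auto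
  have php: "0 < ph (p + 1)" using k rho tau_pos by simp
  \<comment> \<open>The relative deviation of the mean squared innovation from \<open>tau\<close>.
    Up to scale it is the variance coordinate of the score, hence at most of order s / sqrt
    T.\<close>
  define V where "V = (\<Sum>t\<in>?I. (?u t)\<^sup>2 / tau - 1) / ?n"
  define m where "m = (\<Sum>t\<in>?I. ?u t * ?d t) / tau"
  define q where "q = (\<Sum>t\<in>?I. (?d t)\<^sup>2) / tau"
  have sumu: "(\<Sum>t\<in>?I. (?u t)\<^sup>2) = tau * ?n * (1 + V)"
    using n tau_pos by (simp add: V_def sum_subtractf sum_divide_distrib[symmetric] field_simps)
  have summand: "ln (dens p y (int t) ph \<omega>) - ln (dens p y (int t) phs \<omega>)
      = - ln (1 + k) / 2 + (1 - 1 / (1 + k)) * ((?u t)\<^sup>2 / (2 * tau)) + (1 / (1 + k)) * (?u t * ?d t / tau)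
        - (1 / (1 + k)) * ((?d t)\<^sup>2 / (2 * tau))" for t
  proof -
    have l: "ln (ph (p + 1)) = ln tau + ln (1 + k)" using k(1) rho tau_pos by (simp add: ln_mult)
    have 1: "ln (dens p y (int t) ph \<omega>) = - ln (2 * pi) / 2 - (ln tau + ln (1 + k)) / 2 - (?u t - ?d t)\<^sup>2 / (2 * (tau * (1 + k)))"
      using ln_dens[where ph=ph, OF php, where t="int t" and \<omega>=\<omega>] resid_eq[OF w, of "int t" ph] l k(1) by simp
    have 2: "ln (dens p y (int t) phs \<omega>) = - ln (2 * pi) / 2 - ln tau / 2 - (?u t)\<^sup>2 / (2 * tau)"
      using ln_dens[where ph=phs, OF var_pos, where t="int t" and \<omega>=\<omega>] resid_eq[OF w, of "int t" phs] by (simp add: tau_def)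
    show ?thesis unfolding 1 2 using scaled_square_expand[OF tau_pos rho(1), of "?u t" "?d t"] by (simp add: add_divide_distrib)
  qed
  have "L0 p y T ph \<omega> - L0 p y T phs \<omega>
      = (\<Sum>t\<in>?I. - ln (1 + k) / 2 + (1 - 1 / (1 + k)) * ((?u t)\<^sup>2 / (2 * tau)) + (1 / (1 + k)) * (?u t * ?d t / tau)
        - (1 / (1 + k)) * ((?d t)\<^sup>2 / (2 * tau)))"
    unfolding L0_def sum_subtractf[symmetric] summand ..
  also have "\<dots> = - (?n / 2) * ln (1 + k) + (1 - 1 / (1 + k)) * ((\<Sum>t\<in>?I. (?u t)\<^sup>2) / (2 * tau))
      + (1 / (1 + k)) * m - (1 / (1 + k)) * (q / 2)"
    by (simp only: sum_subtractf sum.distrib sum_distrib_left[symmetric] sum_divide_distrib[symmetric] m_def q_def)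
       (simp add: field_simps)
  also have "(\<Sum>t\<in>?I. (?u t)\<^sup>2) / (2 * tau) = ?n * (1 + V) / 2"
    unfolding sumu using tau_pos by simp
  finally have L: "L0 p y T ph \<omega> - L0 p y T phs \<omega> = - (?n / 2) * ln (1 + k)
      + (1 - 1 / (1 + k)) * (?n * (1 + V) / 2) + (1 / (1 + k)) * m - (1 / (1 + k)) * (q / 2)" .
  have hp: "h (p + 1) = ?q * (k * tau)" unfolding h_def k(1) by (simp add: tau_def algebra_simps)
  have nsp: "nscore T \<omega> (p + 1) = ?q * V / (2 * tau)"
  proof -
    have "nscore T \<omega> (p + 1) = (\<Sum>t\<in>?I. (?u t)\<^sup>2 / tau - 1) / (2 * tau) / ?q"
      by (simp add: nscore_def score_def sum_divide_distrib)
    also have "(\<Sum>t\<in>?I. (?u t)\<^sup>2 / tau - 1) = V * ?n" using n by (simp add: V_def)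
    also have "V * ?n / (2 * tau) / ?q = V * (?n / ?q) / (2 * tau)" by simp
    also have "?n / ?q = ?q" by (rule real_div_sqrt) simp
    finally show ?thesis by (simp add: mult.commute)
  qed
  have mS: "(\<Sum>i\<le>p. nscore T \<omega> i * h i) = m"
  proof -
    have "(\<Sum>i\<le>p. nscore T \<omega> i * h i) = (\<Sum>i\<le>p. \<Sum>t\<in>?I. ?u t * ((ph i - phs i) * reg (int t) \<omega> i) / tau)"
    proof (intro sum.cong refl)
      fix i assume i: "i \<in> {..p}"
      have "nscore T \<omega> i * h i = (\<Sum>t\<in>?I. score (int t) \<omega> i) * (ph i - phs i)"
        using n by (simp add: nscore_def h_def)
      then show "nscore T \<omega> i * h i = (\<Sum>t\<in>?I. ?u t * ((ph i - phs i) * reg (int t) \<omega> i) / tau)"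
        using i unfolding sum_distrib_right by (simp add: score_def mult_ac)
    qed
    also have "\<dots> = (\<Sum>t\<in>?I. \<Sum>i\<le>p. ?u t * ((ph i - phs i) * reg (int t) \<omega> i) / tau)" by (rule sum.swap)
    also have "\<dots> = m" by (simp add: m_def sum_distrib_left sum_divide_distrib)
    finally show ?thesis .
  qed
  have vS: "vdot (p + 2) (nscore T \<omega>) h = m + ?n * V * k / 2"
  proof -
    have "vdot (p + 2) (nscore T \<omega>) h = (\<Sum>i\<le>p. nscore T \<omega> i * h i) + nscore T \<omega> (p + 1) * h (p + 1)"
      by (simp add: vdot_def lessThan_Suc_atMost)
    also have "nscore T \<omega> (p + 1) * h (p + 1) = (?q * ?q) * V * k / 2"
      unfolding nsp hp using tau_pos by simp
    finally show ?thesis unfolding mS n(3) .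
  qed
  have qH: "qform (p + 2) (hess T \<omega>) h = q + ?n * k\<^sup>2 / 2"
  proof -
    have hq: "(\<Sum>i\<le>p. h i * reg (int t) \<omega> i) = ?q * ?d t" for t
      by (simp add: h_def sum_distrib_left mult.assoc)
    have q2: "?q\<^sup>2 = ?n" by simp
    have "(\<Sum>t\<in>?I. (\<Sum>i\<le>p. h i * reg (int t) \<omega> i)\<^sup>2) = ?n * (\<Sum>t\<in>?I. (?d t)\<^sup>2)"
      unfolding hq power_mult_distrib q2 by (rule sum_distrib_left[symmetric])
    moreover have "(h (p + 1))\<^sup>2 / (2 * tau\<^sup>2) = ?n * k\<^sup>2 / 2"
      unfolding hp using tau_pos n by (simp add: power_mult_distrib)
    ultimately show ?thesis unfolding qform_hess q_def using n tau_pos by simp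
  qed
  \<comment> \<open>An exact identity with three sources of error: the cubic remainder of the
    logarithm, the deviation V at order k^2, and the rescaling of the regression part by
    1/(1+k).\<close>
  have R: "L0 p y T ph \<omega> - L0 p y T phs \<omega> - (vdot (p + 2) (nscore T \<omega>) h - qform (p + 2) (hess T \<omega>) h / 2)
     = - (?n / 2) * (ln (1 + k) + 1 / (1 + k) - 1 - k\<^sup>2 / 2) - (?n / 2) * V * (1 / (1 + k) - 1 + k)
       + (1 / (1 + k) - 1) * (m - q / 2)"
    unfolding L vS qH by (simp add: algebra_simps add_divide_distrib diff_divide_distrib)
  have sn: "0 \<le> s" "0 \<le> N" by (simp_all add: s_def N_def)
  have q0: "0 \<le> q" using tau_pos by (simp add: q_def sum_nonneg)
  have nk: "?n * k\<^sup>2 \<le> N\<^sup>2 / tau\<^sup>2"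
  proof -
    have "?n * k\<^sup>2 * tau\<^sup>2 = (h (p + 1))\<^sup>2" unfolding hp using n by (simp add: power_mult_distrib)
    also have "\<dots> \<le> N\<^sup>2"
      using power_mono[OF component_le_vnorm[of "p + 1" "p + 2" h], of 2] by (simp add: N_def)
    finally show ?thesis using tau_pos by (simp add: pos_le_divide_eq)
  qed
  have Vb: "\<bar>V\<bar> \<le> 2 * tau * s / ?q"
  proof -
    have "?q * \<bar>V\<bar> / (2 * tau) = \<bar>nscore T \<omega> (p + 1)\<bar>" unfolding nsp using n tau_pos by (simp add: abs_mult)
    also have "\<dots> \<le> s" unfolding s_def by (rule component_le_vnorm) simp
    finally show ?thesis using n tau_pos by (simp add: field_simps)
  qed
  have mb: "\<bar>m\<bar> \<le> s * N"
  proof -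
    let ?h = "\<lambda>i. if i \<le> p then h i else 0"
    have "m = vdot (p + 2) (nscore T \<omega>) ?h" unfolding mS[symmetric]
      by (simp add: vdot_def lessThan_Suc_atMost)
    also have "\<bar>\<dots>\<bar> \<le> s * vnorm (p + 2) ?h" unfolding s_def by (rule vdot_le)
    also have "vnorm (p + 2) ?h \<le> N" unfolding N_def vnorm_def
      by (intro real_sqrt_le_mono sum_mono) auto
    finally show ?thesis using sn by (simp add: mult_left_mono)
  qed
  have r1: "\<bar>1 / (1 + k) - 1\<bar> \<le> 2 * \<bar>k\<bar>"
  proof -
    have "1 / (1 + k) - 1 = - k / (1 + k)" using rho by (simp add: field_simps)
    then have "\<bar>1 / (1 + k) - 1\<bar> = \<bar>k\<bar> / (1 + k)" using rho by simp
    also have "\<dots> \<le> \<bar>k\<bar> / (1 / 2)" using rho by (intro divide_left_mono) auto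
    finally show ?thesis by simp
  qed
  have r2: "\<bar>1 / (1 + k) - 1 + k\<bar> \<le> 2 * k\<^sup>2"
  proof -
    have "1 / (1 + k) - 1 + k = k\<^sup>2 / (1 + k)" using rho by (simp add: field_simps power2_eq_square)
    then have "\<bar>1 / (1 + k) - 1 + k\<bar> = k\<^sup>2 / (1 + k)" using rho by simp
    also have "\<dots> \<le> k\<^sup>2 / (1 / 2)" using rho by (intro divide_left_mono) auto
    finally show ?thesis by simp
  qed
  have t1: "\<bar>- (?n / 2) * (ln (1 + k) + 1 / (1 + k) - 1 - k\<^sup>2 / 2)\<bar> \<le> 5 * \<bar>k\<bar> / tau\<^sup>2 * N\<^sup>2"
  proof -
    have "\<bar>- (?n / 2) * (ln (1 + k) + 1 / (1 + k) - 1 - k\<^sup>2 / 2)\<bar> \<le> ?n / 2 * (10 * \<bar>k\<bar> ^ 3)"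
      using mult_left_mono[OF ln_remainder_bound[OF k(2)], of "?n / 2"] n by (simp add: abs_mult)
    also have "\<dots> = 5 * \<bar>k\<bar> * (?n * k\<^sup>2)" by (simp add: power3_eq_cube power2_eq_square)
    also have "\<dots> \<le> 5 * \<bar>k\<bar> * (N\<^sup>2 / tau\<^sup>2)" by (intro mult_left_mono nk) simp
    finally show ?thesis by simp
  qed
  have t2: "\<bar>(?n / 2) * V * (1 / (1 + k) - 1 + k)\<bar> \<le> 4 * s / (tau * ?q) * N\<^sup>2"
  proof -
    have "\<bar>(?n / 2) * V * (1 / (1 + k) - 1 + k)\<bar> \<le> (?n / 2) * \<bar>V\<bar> * (2 * k\<^sup>2)"
      using n r2 by (simp add: abs_mult mult_left_mono)
    also have "\<dots> = \<bar>V\<bar> * (?n * k\<^sup>2)" by simp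
    also have "\<dots> \<le> (2 * tau * s / ?q) * (N\<^sup>2 / tau\<^sup>2)"
      using Vb nk n sn tau_pos by (intro mult_mono) auto
    also have "\<dots> = 2 * s / (tau * ?q) * N\<^sup>2" using tau_pos by (simp add: power2_eq_square mult_ac)
    also have "\<dots> \<le> 4 * s / (tau * ?q) * N\<^sup>2"
      using sn tau_pos n by (intro mult_right_mono divide_right_mono) auto
    finally show ?thesis .
  qed
  have qle: "q \<le> qform (p + 2) (hess T \<omega>) h" unfolding qH using n by simp
  have t3: "\<bar>(1 / (1 + k) - 1) * (m - q / 2)\<bar> \<le> 2 * \<bar>k\<bar> * s * N + \<bar>k\<bar> * qform (p + 2) (hess T \<omega>) h"
  proof -
    have "\<bar>(1 / (1 + k) - 1) * (m - q / 2)\<bar> \<le> 2 * \<bar>k\<bar> * (\<bar>m\<bar> + q / 2)"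
      unfolding abs_mult using r1 q0 by (intro mult_mono) auto
    also have "\<dots> \<le> 2 * \<bar>k\<bar> * (s * N + qform (p + 2) (hess T \<omega>) h / 2)"
      using mb qle by (intro mult_left_mono add_mono divide_right_mono) auto
    finally show ?thesis by (simp add: algebra_simps)
  qed
  have "\<bar>L0 p y T ph \<omega> - L0 p y T phs \<omega> - (vdot (p + 2) (nscore T \<omega>) h - qform (p + 2) (hess T \<omega>) h / 2)\<bar>
    \<le> 5 * \<bar>k\<bar> / tau\<^sup>2 * N\<^sup>2 + 4 * s / (tau * ?q) * N\<^sup>2 + (2 * \<bar>k\<bar> * s * N + \<bar>k\<bar> * qform (p + 2) (hess T \<omega>) h)"
    unfolding R using t1 t2 t3 by linarith
  then show ?thesis by (simp add: distrib_right)
qed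

section \<open>Second moments of the regressors and tightness of the Hessian\<close>

lemma eps_second_moment: "(\<integral>\<^sup>+\<omega>. ennreal ((eps t \<omega>)\<^sup>2) \<partial>M) = 1"
proof -
  have "(\<integral>\<^sup>+x. ennreal (std_normal_density x) * ennreal (x\<^sup>2) \<partial>lborel) = (\<integral>\<^sup>+\<omega>. ennreal ((eps t \<omega>)\<^sup>2) \<partial>M)"
    by (rule distributed_nn_integral[OF eps_normal]) measurable
  moreover have "(\<integral>\<^sup>+x. ennreal (std_normal_density x) * ennreal (x\<^sup>2) \<partial>lborel)
      = (\<integral>\<^sup>+x. ennreal (std_normal_density x * x ^ (2 * 1)) \<partial>lborel)"
    by (intro nn_integral_cong) (simp add: ennreal_mult)
  moreover have "\<dots> = ennreal (fact (2 * 1) / (2 ^ 1 * fact 1))"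
    using std_normal_moment_even[of 1] by (intro nn_integral_eq_integral[THEN trans])
      (auto simp: has_bochner_integral_iff)
  ultimately show ?thesis by (simp add: fact_numeral)
qed

text \<open>The lag generates a sub-sigma-algebra of the past, and independence passes to smaller
  families of events.\<close>

lemma indep_eps_lag:
  assumes "1 \<le> i" shows "indep_var borel (eps t) borel (y (t - int i))"
proof -
  have eps_meas: "eps t \<in> borel_measurable M" using eps_normal[of t] by (simp add: distributed_def)
  have sets_gen: "sets (gen_sigma M Ys) = sigma_sets (space M) {X -` C \<inter> space M | X C. X \<in> Ys \<and> C \<in> sets borel}"
    for Ys :: "('w \<Rightarrow> real) set"
    unfolding gen_sigma_def by (rule sets_measure_of) auto
  have sub1: "sigma_sets (space M) {eps t -` C \<inter> space M | C. C \<in> sets borel} \<subseteq> sets (gen_sigma M {eps t})"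
    unfolding sets_gen by (rule sigma_sets_mono') auto
  have sub2: "sigma_sets (space M) {y (t - int i) -` C \<inter> space M | C. C \<in> sets borel} \<subseteq> sets (gen_sigma M {y j | j. j < t})"
    unfolding sets_gen by (rule sigma_sets_mono') (use assms in force)
  note ind = eps_indep[of t, unfolded indep_sets2_eq]
  show ?thesis
    unfolding indep_var_eq indep_sets2_eq
  proof (intro conjI ballI)
    show "eps t \<in> borel_measurable M" by (rule eps_meas)
    show "y (t - int i) \<in> borel_measurable M" by (rule y_measurable)
    show "sigma_sets (space M) {eps t -` C \<inter> space M | C. C \<in> sets borel} \<subseteq> events"
      by (rule order_trans[OF sub1]) (use ind in blast)
    show "sigma_sets (space M) {y (t - int i) -` C \<inter> space M | C. C \<in> sets borel} \<subseteq> events"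
      by (rule order_trans[OF sub2]) (use ind in blast)
    fix a b assume "a \<in> sigma_sets (space M) {eps t -` C \<inter> space M | C. C \<in> sets borel}"
      "b \<in> sigma_sets (space M) {y (t - int i) -` C \<inter> space M | C. C \<in> sets borel}"
    then have "a \<in> sets (gen_sigma M {eps t})" "b \<in> sets (gen_sigma M {y j | j. j < t})"
      using subsetD[OF sub1] subsetD[OF sub2] by simp_all
    then show "prob (a \<inter> b) = prob a * prob b" using ind by blast
  qed
qed

text \<open>Stated for extended nonnegative integrals, so that it applies before either second
  moment is known to be finite.\<close>

lemma indep_nn_integral_mult:
  assumes "indep_var borel X borel Y"
  shows "(\<integral>\<^sup>+\<omega>. ennreal ((X \<omega>)\<^sup>2) * ennreal ((Y \<omega>)\<^sup>2) \<partial>M)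
    = (\<integral>\<^sup>+\<omega>. ennreal ((X \<omega>)\<^sup>2) \<partial>M) * (\<integral>\<^sup>+\<omega>. ennreal ((Y \<omega>)\<^sup>2) \<partial>M)"
proof -
  let ?f = "\<lambda>x::real. ennreal (x\<^sup>2)"
  have "indep_var borel (?f \<circ> X) borel (?f \<circ> Y)"
    by (rule indep_var_compose[OF assms]) measurable
  moreover have "case_bool borel borel = (\<lambda>_. borel :: ennreal measure)"
    by (rule ext) (simp split: bool.split)
  ultimately have "indep_vars (\<lambda>_. borel) (case_bool (?f \<circ> X) (?f \<circ> Y)) UNIV"
    unfolding indep_var_def by simp
  from indep_vars_nn_integral[OF _ this] show ?thesis by (simp add: UNIV_bool mult.commute comp_def)
qed

text \<open>The squared score is the squared regressor times eps^2 / tau, and eps has unit second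
  moment and is independent of the lag. The moment of a lag is therefore \<open>tau\<close> times
  that of the score, and finiteness transfers as well. The summand 1 covers the intercept, whose
  regressor is constant.\<close>

lemma reg_second_moment:
  assumes i: "i \<le> p" and int: "integrable M (\<lambda>\<omega>. score t \<omega> i * score t \<omega> i)"
  shows "integrable M (\<lambda>\<omega>. (reg t \<omega> i)\<^sup>2)"
    and "(\<integral>\<omega>. (reg t \<omega> i)\<^sup>2 \<partial>M) \<le> 1 + tau * (\<integral>\<omega>. score t \<omega> i * score t \<omega> i \<partial>M)"
proof -
  let ?B = "1 + tau * (\<integral>\<omega>. score t \<omega> i * score t \<omega> i \<partial>M)"
  have [measurable]: "(\<lambda>\<omega>. reg t \<omega> i) \<in> borel_measurable M" unfolding reg_def by (cases "i = 0") simp_all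
  have I0: "0 \<le> (\<integral>\<omega>. score t \<omega> i * score t \<omega> i \<partial>M)" by simp
  have "(\<integral>\<^sup>+\<omega>. ennreal ((reg t \<omega> i)\<^sup>2) \<partial>M) \<le> ennreal ?B"
  proof (cases "i = 0")
    case True
    then have "(\<integral>\<^sup>+\<omega>. ennreal ((reg t \<omega> i)\<^sup>2) \<partial>M) = ennreal 1" by (simp add: reg_def emeasure_space_1)
    also have "\<dots> \<le> ennreal ?B" using tau_pos I0 by (intro ennreal_leI) simp
    finally show ?thesis .
  next
    case False
    then have reg: "reg t \<omega> i = y (t - int i) \<omega>" for \<omega> by (simp add: reg_def)
    have sc: "score t \<omega> i * score t \<omega> i = (eps t \<omega>)\<^sup>2 * (reg t \<omega> i)\<^sup>2 / tau" for \<omega>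
    proof -
      have "score t \<omega> i * score t \<omega> i = (innov t \<omega>)\<^sup>2 * (reg t \<omega> i)\<^sup>2 / tau\<^sup>2"
        using i by (simp add: score_def power2_eq_square)
      also have "(innov t \<omega>)\<^sup>2 = tau * (eps t \<omega>)\<^sup>2" using tau_pos by (simp add: innov_def power_mult_distrib)
      finally show ?thesis using tau_pos by (simp add: power2_eq_square)
    qed
    have "(\<integral>\<^sup>+\<omega>. ennreal ((reg t \<omega> i)\<^sup>2) \<partial>M)
        = (\<integral>\<^sup>+\<omega>. ennreal ((eps t \<omega>)\<^sup>2) * ennreal ((y (t - int i) \<omega>)\<^sup>2) \<partial>M)"
      using indep_nn_integral_mult[OF indep_eps_lag[of i t]] False by (simp add: eps_second_moment reg)
    also have "\<dots> = (\<integral>\<^sup>+\<omega>. ennreal (tau * (score t \<omega> i * score t \<omega> i)) \<partial>M)"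
      using tau_pos by (intro nn_integral_cong) (simp add: sc reg ennreal_mult)
    also have "\<dots> = ennreal (\<integral>\<omega>. tau * (score t \<omega> i * score t \<omega> i) \<partial>M)"
      using int tau_pos by (intro nn_integral_eq_integral) auto
    also have "\<dots> \<le> ennreal ?B" by (intro ennreal_leI) simp
    finally show ?thesis .
  qed
  then have fin: "(\<integral>\<^sup>+\<omega>. ennreal ((reg t \<omega> i)\<^sup>2) \<partial>M) \<le> ennreal ?B" .
  show int2: "integrable M (\<lambda>\<omega>. (reg t \<omega> i)\<^sup>2)"
    by (rule integrableI_bounded) (use fin in \<open>auto intro: le_less_trans\<close>)
  have "ennreal (\<integral>\<omega>. (reg t \<omega> i)\<^sup>2 \<partial>M) \<le> ennreal ?B"
    using fin nn_integral_eq_integral[OF int2] by simp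
  then show "(\<integral>\<omega>. (reg t \<omega> i)\<^sup>2 \<partial>M) \<le> ?B"
    using tau_pos I0 by (subst (asm) ennreal_le_iff) auto
qed

text \<open>Cauchy-Schwarz replaces the square of a sum of p + 1 terms by a sum of squares. Its
  average over t has an expectation bounded uniformly in T, so Markov's inequality applies; the
  variance part is a constant.\<close>

lemma qform_hess_tight:
  assumes int: "\<And>t i. 1 \<le> t \<Longrightarrow> i \<le> p \<Longrightarrow> integrable M (\<lambda>\<omega>. score (int t) \<omega> i * score (int t) \<omega> i)"
    and bound: "\<And>t i. 1 \<le> t \<Longrightarrow> i \<le> p \<Longrightarrow> (\<integral>\<omega>. score (int t) \<omega> i * score (int t) \<omega> i \<partial>M) \<le> b"
    and \<eta>: "0 < \<eta>"
  shows "\<exists>K\<ge>0. evp M \<eta> (\<lambda>T \<omega>. qform (p + 2) (hess T \<omega>) h \<le> K)"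
proof -
  define b' where "b' = 1 + tau * b"
  have b': "0 \<le> b'"
  proof -
    have "0 \<le> (\<integral>\<omega>. score (int 1) \<omega> 0 * score (int 1) \<omega> 0 \<partial>M)" by simp
    also have "\<dots> \<le> b" by (rule bound) auto
    finally show ?thesis using tau_pos by (simp add: b'_def)
  qed
  have reg2: "integrable M (\<lambda>\<omega>. (reg (int t) \<omega> i)\<^sup>2)" "(\<integral>\<omega>. (reg (int t) \<omega> i)\<^sup>2 \<partial>M) \<le> b'"
    if "1 \<le> t" "i \<le> p" for t i
  proof -
    show "integrable M (\<lambda>\<omega>. (reg (int t) \<omega> i)\<^sup>2)" by (rule reg_second_moment(1)[OF that(2) int[OF that]])
    have "tau * (\<integral>\<omega>. score (int t) \<omega> i * score (int t) \<omega> i \<partial>M) \<le> tau * b"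
      using tau_pos by (intro mult_left_mono bound that) simp
    then show "(\<integral>\<omega>. (reg (int t) \<omega> i)\<^sup>2 \<partial>M) \<le> b'"
      using reg_second_moment(2)[OF that(2) int[OF that]] by (simp add: b'_def)
  qed
  define G where "G T \<omega> = (\<Sum>t\<in>{1..T}. \<Sum>i\<le>p. (h i)\<^sup>2 * (reg (int t) \<omega> i)\<^sup>2) * (real (p + 1) / (real T * tau))" for T \<omega>
  define g where "g = (\<Sum>i\<le>p. (h i)\<^sup>2 * b') * (real (p + 1) / tau)"
  have g0: "0 \<le> g" using b' tau_pos by (simp add: g_def sum_nonneg)
  have intG: "integrable M (G T)" for T
    unfolding G_def by (intro integrable_mult_left Bochner_Integration.integrable_sum integrable_mult_right reg2) auto
  have EG: "(\<integral>\<omega>. G T \<omega> \<partial>M) \<le> g" if T: "1 \<le> T" for T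
  proof -
    have "(\<integral>\<omega>. (\<Sum>t\<in>{1..T}. \<Sum>i\<le>p. (h i)\<^sup>2 * (reg (int t) \<omega> i)\<^sup>2) \<partial>M)
       = (\<Sum>t\<in>{1..T}. \<integral>\<omega>. (\<Sum>i\<le>p. (h i)\<^sup>2 * (reg (int t) \<omega> i)\<^sup>2) \<partial>M)"
      by (intro Bochner_Integration.integral_sum Bochner_Integration.integrable_sum integrable_mult_right reg2) auto
    also have "\<dots> = (\<Sum>t\<in>{1..T}. \<Sum>i\<le>p. \<integral>\<omega>. (h i)\<^sup>2 * (reg (int t) \<omega> i)\<^sup>2 \<partial>M)"
      by (intro sum.cong refl Bochner_Integration.integral_sum integrable_mult_right reg2) auto
    finally have "(\<integral>\<omega>. G T \<omega> \<partial>M)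
       = (\<Sum>t\<in>{1..T}. \<Sum>i\<le>p. (h i)\<^sup>2 * (\<integral>\<omega>. (reg (int t) \<omega> i)\<^sup>2 \<partial>M)) * (real (p + 1) / (real T * tau))"
      unfolding G_def by simp
    also have "\<dots> \<le> (\<Sum>t\<in>{1..T}. \<Sum>i\<le>p. (h i)\<^sup>2 * b') * (real (p + 1) / (real T * tau))"
      using tau_pos by (intro mult_right_mono sum_mono mult_left_mono reg2) auto
    also have "\<dots> = g" using T tau_pos by (simp add: g_def)
    finally show ?thesis .
  qed
  have le: "qform (p + 2) (hess T \<omega>) h \<le> G T \<omega> + (h (p + 1))\<^sup>2 / (2 * tau\<^sup>2)" for T \<omega>
  proof -
    have "(\<Sum>i\<le>p. h i * reg (int t) \<omega> i)\<^sup>2 \<le> real (p + 1) * (\<Sum>i\<le>p. (h i)\<^sup>2 * (reg (int t) \<omega> i)\<^sup>2)" for t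
      using sum_squared_le_sum_of_squares[of "\<lambda>i. h i * reg (int t) \<omega> i" "{..p}"]
      by (simp add: power_mult_distrib mult.commute)
    then have "(\<Sum>t\<in>{1..T}. (\<Sum>i\<le>p. h i * reg (int t) \<omega> i)\<^sup>2) / (real T * tau)
        \<le> (\<Sum>t\<in>{1..T}. real (p + 1) * (\<Sum>i\<le>p. (h i)\<^sup>2 * (reg (int t) \<omega> i)\<^sup>2)) / (real T * tau)"
      using tau_pos by (intro divide_right_mono sum_mono) auto
    also have "\<dots> = G T \<omega>" by (simp add: G_def sum_distrib_left[symmetric])
    finally show ?thesis unfolding qform_hess by simp
  qed
  \<comment> \<open>Any K with g / K < \<eta> serves; the added 1 keeps K positive when g =
    0.\<close>
  define K where "K = (g + 1) * (2 / \<eta>)"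
  have K: "0 < K" using g0 \<eta> by (simp add: K_def)
  have G0: "0 \<le> G T \<omega>" for T \<omega> using tau_pos by (simp add: G_def sum_nonneg)
  have "evp M \<eta> (\<lambda>T \<omega>. G T \<omega> \<le> K)"
    unfolding evp_def
  proof (rule eventually_sequentiallyI[of 1])
    fix T :: nat assume T: "1 \<le> T"
    have [measurable]: "G T \<in> borel_measurable M" using intG by auto
    have "measure M {\<omega> \<in> space M. K \<le> G T \<omega>} \<le> (\<integral>\<omega>. G T \<omega> \<partial>M) / K"
      by (rule integral_Markov_inequality_measure[OF intG, of "{}"]) (auto simp: G0 K)
    also have "\<dots> \<le> g / K" using EG[OF T] K by (intro divide_right_mono) auto
    also have "\<dots> < \<eta>"
    proof -
      have "g < 2 * (g + 1)" using g0 by simp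
      also have "\<dots> = \<eta> * K" using \<eta> by (simp add: K_def)
      finally show ?thesis using K by (simp add: pos_divide_less_eq)
    qed
    finally show "\<exists>C\<in>events. prob C < \<eta> \<and> (\<forall>\<omega>\<in>space M - C. G T \<omega> \<le> K)"
      by (intro bexI[of _ "{\<omega> \<in> space M. K \<le> G T \<omega>}"]) auto
  qed
  then have "evp M \<eta> (\<lambda>T \<omega>. qform (p + 2) (hess T \<omega>) h \<le> K + (h (p + 1))\<^sup>2 / (2 * tau\<^sup>2))"
  proof (rule evp_mono[OF _ order_refl], intro always_eventually allI ballI impI)
    fix T \<omega> assume "G T \<omega> \<le> K"
    then show "qform (p + 2) (hess T \<omega>) h \<le> K + (h (p + 1))\<^sup>2 / (2 * tau\<^sup>2)"
      using le[of T \<omega>] by linarith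
  qed
  then show ?thesis using K by (intro exI[of _ "K + (h (p + 1))\<^sup>2 / (2 * tau\<^sup>2)"]) auto
qed

end

section \<open>Quadratic approximation of the suprema\<close>

lemma SUP_minus_const:
  fixes f :: "'x \<Rightarrow> real"
  assumes X: "X \<noteq> {}" and bdd: "bdd_above (f ` X)"
  shows "(SUP x\<in>X. f x - c) = (SUP x\<in>X. f x) - c"
proof (rule antisym)
  show "(SUP x\<in>X. f x - c) \<le> (SUP x\<in>X. f x) - c"
    using cSUP_upper[OF _ bdd] by (intro cSUP_least[OF X]) simp
  obtain b where b: "\<And>x. x \<in> X \<Longrightarrow> f x \<le> b" using bdd by (auto simp: bdd_above_def)
  have bdd': "bdd_above ((\<lambda>x. f x - c) ` X)" by (rule bdd_aboveI2[of _ _ "b - c"]) (use b in simp)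
  have "f x \<le> (SUP x\<in>X. f x - c) + c" if "x \<in> X" for x
    using cSUP_upper[OF that bdd'] by simp
  then have "(SUP x\<in>X. f x) \<le> (SUP x\<in>X. f x - c) + c" by (rule cSUP_least[OF X])
  then show "(SUP x\<in>X. f x) - c \<le> (SUP x\<in>X. f x - c)" by simp
qed

lemma eventually_sqrt_large:
  assumes "0 < rho" shows "\<forall>\<^sub>F T in sequentially. R / sqrt (real T) < rho"
proof -
  have "(\<lambda>T. R / sqrt (real T)) \<longlonglongrightarrow> 0"
    by (intro tendsto_divide_0[OF tendsto_const] filterlim_at_top_imp_at_infinity
        filterlim_compose[OF sqrt_at_top filterlim_real_sequentially])
  then show ?thesis using assms by (rule order_tendstoD(2))
qed

text \<open>Order of choices: tightness fixes K and hence R; eps is then made small relative to R;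
  the expansion supplies the radius \<delta>, identification the distance d, and only then does T
  grow. Four good events receive \<eta>/4 each. The value \<open>lt\<close> at the truth is common
  to all a.\<close>

lemma whp_sup_criterion:
  fixes ell :: "nat \<Rightarrow> 'a \<Rightarrow> 'w \<Rightarrow> 'x \<Rightarrow> real" and dst :: "'x \<Rightarrow> real"
  assumes M: "finite_measure M"
    and c: "0 < c" "\<And>a x. a \<in> A \<Longrightarrow> x \<in> Rn r \<Longrightarrow> c * (vnorm r x)\<^sup>2 \<le> qform r (I a) x"
    and L: "L \<subseteq> Rn r" "zvec \<in> L" "\<And>x b. x \<in> L \<Longrightarrow> 0 < b \<Longrightarrow> (\<lambda>i. b * x i) \<in> L"
    and tight: "\<And>\<eta>. 0 < \<eta> \<Longrightarrow> \<exists>K\<ge>0. evp M \<eta> (\<lambda>T \<omega>. \<forall>a\<in>A. vnorm r (S T a \<omega>) \<le> K)"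
    and rho: "0 < rho" "\<And>a. a \<in> A \<Longrightarrow> theta a ` X a \<inter> cube r rho = L \<inter> cube r rho"
    and theta: "\<And>a x. a \<in> A \<Longrightarrow> x \<in> X a \<Longrightarrow> theta a x \<in> Rn r"
    and far: "\<And>e. 0 < e \<Longrightarrow> \<exists>d>0. \<forall>a\<in>A. \<forall>x\<in>X a. e \<le> dst x \<longrightarrow> d \<le> vnorm r (theta a x)"
    and expan: "\<And>e \<eta>. 0 < e \<Longrightarrow> 0 < \<eta> \<Longrightarrow> \<exists>\<delta>>0. evp M \<eta> (\<lambda>T \<omega>. \<forall>a\<in>A. \<forall>x\<in>X a. dst x \<le> \<delta> \<longrightarrow>
        \<bar>ell T a \<omega> x - lt T \<omega> - quad r (I a) (S T a \<omega>) (\<lambda>i. sqrt (real T) * theta a x i)\<bar>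
          \<le> e * (1 + vnorm r (\<lambda>i. sqrt (real T) * theta a x i))\<^sup>2)"
    and bdd: "\<And>T a \<omega>. a \<in> A \<Longrightarrow> \<omega> \<in> space M \<Longrightarrow> bdd_above (ell T a \<omega> ` X a)"
    and xt: "\<And>a. a \<in> A \<Longrightarrow> xt \<in> X a" "\<And>T a \<omega>. a \<in> A \<Longrightarrow> \<omega> \<in> space M \<Longrightarrow> ell T a \<omega> xt = lt T \<omega>"
    and xh: "\<And>T a \<omega>. a \<in> A \<Longrightarrow> \<omega> \<in> space M \<Longrightarrow> xh T a \<omega> \<in> X a"
      "\<And>e. 0 < e \<Longrightarrow> whp M (\<lambda>T \<omega>. \<forall>a\<in>A. dst (xh T a \<omega>) \<le> e)"
      "\<And>e. 0 < e \<Longrightarrow> whp M (\<lambda>T \<omega>. \<forall>a\<in>A. (SUP x\<in>X a. ell T a \<omega> x) - e \<le> ell T a \<omega> (xh T a \<omega>))"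
    and e: "0 < e"
  shows "whp M (\<lambda>T \<omega>. \<forall>a\<in>A. \<bar>(SUP x\<in>X a. ell T a \<omega> x) - lt T \<omega> - (SUP l\<in>L. quad r (I a) (S T a \<omega>) l)\<bar> \<le> e)"
  unfolding whp_def
proof (intro allI impI)
  fix \<eta> :: real assume \<eta>: "0 < \<eta>"
  then have \<eta>4: "0 < \<eta> / 4" by simp
  obtain K where K: "0 \<le> K" "evp M (\<eta> / 4) (\<lambda>T \<omega>. \<forall>a\<in>A. vnorm r (S T a \<omega>) \<le> K)"
    using tight[OF \<eta>4] by blast
  define R where "R = 4 * K / c + 2"
  define eps where "eps = min (c / 8) (e / ((1 + R)\<^sup>2 + 1))"
  have pos: "0 < (1 + R)\<^sup>2 + 1" by (intro add_nonneg_pos) auto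
  have eps: "0 < eps" "eps \<le> c / 8" "eps * ((1 + R)\<^sup>2 + 1) \<le> e"
  proof -
    show "0 < eps" using c(1) e pos by (simp add: eps_def)
    show "eps \<le> c / 8" unfolding eps_def by (rule min.cobounded1)
    have "eps * ((1 + R)\<^sup>2 + 1) \<le> e / ((1 + R)\<^sup>2 + 1) * ((1 + R)\<^sup>2 + 1)"
      unfolding eps_def using pos by (intro mult_right_mono min.cobounded2) simp
    then show "eps * ((1 + R)\<^sup>2 + 1) \<le> e" using pos by simp
  qed
  obtain \<delta> where \<delta>: "0 < \<delta>" "evp M (\<eta> / 4) (\<lambda>T \<omega>. \<forall>a\<in>A. \<forall>x\<in>X a. dst x \<le> \<delta> \<longrightarrow>
        \<bar>ell T a \<omega> x - lt T \<omega> - quad r (I a) (S T a \<omega>) (\<lambda>i. sqrt (real T) * theta a x i)\<bar>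
          \<le> eps * (1 + vnorm r (\<lambda>i. sqrt (real T) * theta a x i))\<^sup>2)"
    using expan[OF eps(1) \<eta>4] by blast
  obtain d where d: "0 < d" "\<forall>a\<in>A. \<forall>x\<in>X a. \<delta> \<le> dst x \<longrightarrow> d \<le> vnorm r (theta a x)"
    using far[OF \<delta>(1)] by blast
  have "evp M (\<eta> / 4 + (\<eta> / 4 + (\<eta> / 4 + \<eta> / 4)))
     (\<lambda>T \<omega>. (\<forall>a\<in>A. vnorm r (S T a \<omega>) \<le> K) \<and> (\<forall>a\<in>A. \<forall>x\<in>X a. dst x \<le> \<delta> \<longrightarrow>
        \<bar>ell T a \<omega> x - lt T \<omega> - quad r (I a) (S T a \<omega>) (\<lambda>i. sqrt (real T) * theta a x i)\<bar>
          \<le> eps * (1 + vnorm r (\<lambda>i. sqrt (real T) * theta a x i))\<^sup>2) \<and>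
        (\<forall>a\<in>A. dst (xh T a \<omega>) \<le> \<delta>) \<and>
        (\<forall>a\<in>A. (SUP x\<in>X a. ell T a \<omega> x) - eps \<le> ell T a \<omega> (xh T a \<omega>)))" (is "evp M ?s ?P")
    by (intro evp_conj[OF M] K(2) \<delta>(2) whpD[OF xh(2)] whpD[OF xh(3)] \<eta>4 \<delta>(1) eps(1))
  moreover have "?s \<le> \<eta>" by simp
  moreover have "\<forall>\<^sub>F T in sequentially. \<forall>\<omega>\<in>space M. ?P T \<omega> \<longrightarrow>
      (\<forall>a\<in>A. \<bar>(SUP x\<in>X a. ell T a \<omega> x) - lt T \<omega> - (SUP l\<in>L. quad r (I a) (S T a \<omega>) l)\<bar> \<le> e)"
    using eventually_sqrt_large[OF rho(1), of R] eventually_sqrt_large[OF d(1), of R] eventually_gt_at_top[of 0]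
  proof eventually_elim
    case (elim T)
    show ?case
    proof (intro ballI impI)
      fix \<omega> a assume w: "\<omega> \<in> space M" and P: "?P T \<omega>" and a: "a \<in> A"
      let ?ell = "\<lambda>x. ell T a \<omega> x - lt T \<omega>"
      have ne: "X a \<noteq> {}" using xt(1)[OF a] by blast
      have sup: "(SUP x\<in>X a. ?ell x) = (SUP x\<in>X a. ell T a \<omega> x) - lt T \<omega>"
        by (rule SUP_minus_const[OF ne bdd[OF a w]])
      obtain b where b: "\<And>x. x \<in> X a \<Longrightarrow> ell T a \<omega> x \<le> b" using bdd[OF a w, of T] by (auto simp: bdd_above_def)
      have bdd': "bdd_above (?ell ` X a)" by (rule bdd_aboveI2[of _ _ "b - lt T \<omega>"]) (use b in simp)
      have "\<bar>(SUP x\<in>X a. ?ell x) - (SUP l\<in>L. quad r (I a) (S T a \<omega>) l)\<bar> \<le> eps * ((1 + R)\<^sup>2 + 1)"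
      proof (rule sup_criterion_approx[where c=c and K=K and tau="sqrt (real T)" and rho=rho and d=d
            and delta=\<delta> and dst=dst and theta="theta a" and xh="xh T a \<omega>" and xt=xt])
        show "vnorm r (S T a \<omega>) \<le> K" using P a by blast
        show "theta a ` X a \<inter> cube r rho = L \<inter> cube r rho" by (rule rho(2)[OF a])
        show "\<bar>?ell x - quad r (I a) (S T a \<omega>) (\<lambda>i. sqrt (real T) * theta a x i)\<bar>
          \<le> eps * (1 + vnorm r (\<lambda>i. sqrt (real T) * theta a x i))\<^sup>2" if "x \<in> X a" "dst x \<le> \<delta>" for x
          using P a that by blast
        show "dst (xh T a \<omega>) \<le> \<delta>" using P a by blast
        have "(SUP x\<in>X a. ell T a \<omega> x) - eps \<le> ell T a \<omega> (xh T a \<omega>)" using P a by blast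
        then show "(SUP x\<in>X a. ?ell x) - eps \<le> ?ell (xh T a \<omega>)" unfolding sup by linarith
        show "xh T a \<omega> \<in> X a" by (rule xh(1)[OF a w])
        show "xt \<in> X a" "?ell xt = 0" using xt a w by simp_all
        show "d \<le> vnorm r (theta a x)" if "x \<in> X a" "\<delta> \<le> dst x" for x using d(2) a that by blast
      qed (use c a L K(1) R_def eps theta elim bdd' in auto)
      then show "\<bar>(SUP x\<in>X a. ell T a \<omega> x) - lt T \<omega> - (SUP l\<in>L. quad r (I a) (S T a \<omega>) l)\<bar> \<le> e"
        unfolding sup using eps(3) by linarith
    qed
  qed
  ultimately show "evp M \<eta> (\<lambda>T \<omega>. \<forall>a\<in>A. \<bar>(SUP x\<in>X a. ell T a \<omega> x) - lt T \<omega>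
      - (SUP l\<in>L. quad r (I a) (S T a \<omega>) l)\<bar> \<le> e)"
    by (rule evp_mono)
qed

text \<open>Both suprema lie in [0, K^2/(2c)] and are Lipschitz with constant 2K/c on the ball of
  radius K; the doubled difference inherits bounds of the same form.\<close>

lemma lr_limit_bounds:
  assumes pd: "posdef r A" and c: "0 < c" "\<And>x. x \<in> Rn r \<Longrightarrow> c * (vnorm r x)\<^sup>2 \<le> qform r A x"
    and m: "m \<le> r" and Lv: "Lv \<subseteq> Rn (r - m)" "zvec \<in> Lv"
    and S: "S \<in> Rn r" "vnorm r S \<le> K" and S': "S' \<in> Rn r" "vnorm r S' \<le> K"
  shows "\<bar>lr_limit r m A Lv S\<bar> \<le> 2 * K\<^sup>2 / c"
    and "\<bar>lr_limit r m A Lv S - lr_limit r m A Lv S'\<bar> \<le> 8 * K / c * vnorm r (\<lambda>i. S i - S' i)"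
proof -
  let ?L = "{vjoin m u v | u v. u \<in> Rn m \<and> v \<in> Lv}"
  have ne: "Lv \<noteq> {}" using Lv by blast
  have L: "?L \<subseteq> Rn r" using Lv(1) m by (auto simp: vjoin_def Rn_def)
  have zL: "zvec \<in> ?L"
  proof -
    have "zvec = vjoin m zvec zvec" by (auto simp: vjoin_def zvec_def)
    then show ?thesis using Lv(2) zvec_Rn by blast
  qed
  have R: "Rn m \<subseteq> Rn r" by (rule Rn_mono[OF m])
  have b1: "0 \<le> (SUP l\<in>?L. quad r A S l)" "(SUP l\<in>?L. quad r A S l) \<le> K\<^sup>2 / (2 * c)"
    by (rule sup_quad_bounds[OF c L zL S(2)], assumption)+
  have b2: "0 \<le> (SUP l\<in>Rn m. quad r A S l)" "(SUP l\<in>Rn m. quad r A S l) \<le> K\<^sup>2 / (2 * c)"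
    by (rule sup_quad_bounds[OF c R zvec_Rn S(2)], assumption)+
  have l1: "\<bar>(SUP l\<in>?L. quad r A S l) - (SUP l\<in>?L. quad r A S' l)\<bar> \<le> 2 * K / c * vnorm r (\<lambda>i. S i - S' i)"
    by (rule sup_quad_lipschitz[OF c L zL S(2) S'(2)])
  have l2: "\<bar>(SUP l\<in>Rn m. quad r A S l) - (SUP l\<in>Rn m. quad r A S' l)\<bar> \<le> 2 * K / c * vnorm r (\<lambda>i. S i - S' i)"
    by (rule sup_quad_lipschitz[OF c R zvec_Rn S(2) S'(2)])
  let ?X = "\<lambda>S. SUP l\<in>?L. quad r A S l" and ?Y = "\<lambda>S. SUP l\<in>Rn m. quad r A S l"
  have lr: "lr_limit r m A Lv S = 2 * (?X S - ?Y S)" "lr_limit r m A Lv S' = 2 * (?X S' - ?Y S')"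
    by (rule lr_limit_eq[OF pd m _ Lv(1) ne], rule S S')+
  have "\<bar>?X S - ?Y S\<bar> \<le> K\<^sup>2 / (2 * c)" using b1 b2 unfolding abs_le_iff by simp
  then have "2 * \<bar>?X S - ?Y S\<bar> \<le> 2 * (K\<^sup>2 / (2 * c))" by (rule mult_left_mono) simp
  moreover have "2 * (K\<^sup>2 / (2 * c)) \<le> 2 * K\<^sup>2 / c" using c(1) by (simp add: field_simps)
  ultimately show "\<bar>lr_limit r m A Lv S\<bar> \<le> 2 * K\<^sup>2 / c" unfolding lr abs_mult by simp
  have "\<bar>lr_limit r m A Lv S - lr_limit r m A Lv S'\<bar> = 2 * \<bar>(?X S - ?X S') - (?Y S - ?Y S')\<bar>"
  proof -
    have "2 * (x - y) - 2 * (x' - y') = 2 * ((x - x') - (y - y'))" for x y x' y' :: real by simp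
    then show ?thesis unfolding lr by (simp only: abs_mult abs_numeral)
  qed
  also have "\<dots> \<le> 2 * (2 * K / c * vnorm r (\<lambda>i. S i - S' i) + 2 * K / c * vnorm r (\<lambda>i. S i - S' i))"
    by (intro mult_left_mono order_trans[OF abs_triangle_ineq4] add_mono l1 l2) simp
  finally show "\<bar>lr_limit r m A Lv S - lr_limit r m A Lv S'\<bar> \<le> 8 * K / c * vnorm r (\<lambda>i. S i - S' i)" by simp
qed

lemma vnorm1: "vnorm 1 (vec1 x) = \<bar>x\<bar>" "vnorm 1 (vminus (vec1 x) (vec1 z)) = \<bar>x - z\<bar>"
  by (simp_all add: vnorm_def vec1_def vminus_def)

lemma vec1_Rn: "vec1 x \<in> Rn 1" by (simp add: vec1_def Rn_def)

lemma bnd_fun_lr_limit: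
  assumes pd: "\<And>a. a \<in> A \<Longrightarrow> posdef r (I a)"
    and c: "0 < c" "\<And>a x. a \<in> A \<Longrightarrow> x \<in> Rn r \<Longrightarrow> c * (vnorm r x)\<^sup>2 \<le> qform r (I a) x"
    and m: "m \<le> r" and Lv: "Lv \<subseteq> Rn (r - m)" "zvec \<in> Lv" and f: "bnd_fun r A f"
  shows "bnd_fun 1 A (\<lambda>a. vec1 (lr_limit r m (I a) Lv (f a)))"
proof -
  obtain K where K: "0 \<le> K" "\<forall>a\<in>A. vnorm r (f a) \<le> K" using bnd_fun_bound[OF f] by blast
  have "\<bar>lr_limit r m (I a) Lv (f a)\<bar> \<le> 2 * K\<^sup>2 / c" if a: "a \<in> A" for a
    by (rule lr_limit_bounds(1)[OF pd[OF a] c(1) c(2)[OF a] m Lv, of "f a" K "f a"])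
       (use f a K in \<open>auto simp: bnd_fun_def\<close>)
  then show ?thesis unfolding bnd_fun_def vnorm1 using vec1_Rn by blast
qed

text \<open>Continuous mapping for the limit functional. It is Lipschitz on bounded sets only, with
  a constant uniform in a because the coercivity constant c is common to all
  \<open>I a\<close>.\<close>

lemma bc_functional_lr_limit:
  assumes A: "A \<noteq> {}" and pd: "\<And>a. a \<in> A \<Longrightarrow> posdef r (I a)"
    and c: "0 < c" "\<And>a x. a \<in> A \<Longrightarrow> x \<in> Rn r \<Longrightarrow> c * (vnorm r x)\<^sup>2 \<le> qform r (I a) x"
    and m: "m \<le> r" and Lv: "Lv \<subseteq> Rn (r - m)" "zvec \<in> Lv"
    and h: "bc_functional 1 A h"
  shows "bc_functional r A (\<lambda>f. h (\<lambda>a. vec1 (lr_limit r m (I a) Lv (f a))))"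
proof (rule bc_functional_compose[OF h])
  let ?G = "\<lambda>f a. vec1 (lr_limit r m (I a) Lv (f a))"
  show "?G f a = ?G g a" if "\<And>a. a \<in> A \<Longrightarrow> f a = g a" "a \<in> A" for f g a using that(1)[OF that(2)] by simp
  show "bnd_fun 1 A (?G f)" if "bnd_fun r A f" for f by (rule bnd_fun_lr_limit[OF pd c m Lv that])
  fix f and e :: real assume f: "bnd_fun r A f" and e: "0 < e"
  obtain K where K: "0 \<le> K" "\<forall>a\<in>A. vnorm r (f a) \<le> K" using bnd_fun_bound[OF f] by blast
  define q where "q = 8 * (K + 1) / c"
  have q: "0 < q" using K(1) c(1) by (simp add: q_def)
  show "\<exists>d>0. \<forall>g. bnd_fun r A g \<and> sup_dist r A f g < d \<longrightarrow> sup_dist 1 A (?G f) (?G g) < e"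
  \<comment> \<open>The bound 1 keeps g within norm K + 1, where q is a Lipschitz constant; e / (2q)
    yields at most e / 2, so the supremum over A stays strictly below e.\<close>
  proof (intro exI[of _ "min 1 (e / (2 * q))"] conjI allI impI)
    show "0 < min 1 (e / (2 * q))" using e q by simp
    fix g assume g: "bnd_fun r A g \<and> sup_dist r A f g < min 1 (e / (2 * q))"
    have "sup_dist 1 A (?G f) (?G g) \<le> e / 2"
    proof (rule sup_dist_least[OF A])
      fix a assume a: "a \<in> A"
      have d: "vnorm r (\<lambda>i. f a i - g a i) < min 1 (e / (2 * q))"
        using sup_dist_upper[OF f conjunct1[OF g] a] g unfolding vminus_def by linarith
      have gK: "vnorm r (g a) \<le> K + 1"
        using vnorm_le_add_minus[of r "g a" "f a"] K(2) a d by (auto simp: vnorm_minus_commute[of r "g a"])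
      have fK: "vnorm r (f a) \<le> K + 1" using K(2) a by auto
      have R: "f a \<in> Rn r" "g a \<in> Rn r" using f g a by (auto simp: bnd_fun_def)
      have "\<bar>lr_limit r m (I a) Lv (f a) - lr_limit r m (I a) Lv (g a)\<bar> \<le> q * vnorm r (\<lambda>i. f a i - g a i)"
        unfolding q_def by (rule lr_limit_bounds(2)[OF pd[OF a] c(1) c(2)[OF a] m Lv R(1) fK R(2) gK])
      also have "\<dots> \<le> q * (e / (2 * q))" using d q by (intro mult_left_mono) auto
      also have "\<dots> = e / 2" using q by simp
      finally show "vnorm 1 (vminus (?G f a) (?G g a)) \<le> e / 2" unfolding vnorm1 .
    qed
    then show "sup_dist 1 A (?G f) (?G g) < e" using e by linarith
  qed
qed

section \<open>A law of large numbers from the null submodel\<close>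

text \<open>Two quadratic expansions of the same likelihood ratio along a local path of null parameters are
  compared. Since the Hessian form \<open>Q\<close> is nonnegative, the Gaussian limit of \<open>S \<cdot> (h - t)\<close> would be bounded
  below, which forces \<open>h - t \<rightarrow> 0\<close>; no ergodic theorem is needed.\<close>

lemma gaussian_lower_tail_pos:
  assumes N: "prob_space N" and gp: "gaussian_process r A N S" and a: "a \<in> A"
    and cov: "\<And>i j. i < r \<Longrightarrow> j < r \<Longrightarrow> integrable N (\<lambda>\<eta>. S a \<eta> i * S a \<eta> j)
      \<and> integral\<^sup>L N (\<lambda>\<eta>. S a \<eta> i * S a \<eta> j) = I i j"
    and pos: "0 < qform r I w"
  shows "\<not> (AE \<eta> in N. b \<le> vdot r w (S a \<eta>))"
proof
  interpret N: prob_space N by fact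
  let ?X = "\<lambda>\<eta>. vdot r w (S a \<eta>)"
  assume AE: "AE \<eta> in N. b \<le> ?X \<eta>"
  have "centered_normal N (\<lambda>\<eta>. \<Sum>(a', i)\<in>{a} \<times> {..<r}. w i * S a' \<eta> i)"
    using gp[unfolded gaussian_process_def, rule_format, of "{a} \<times> {..<r}" "\<lambda>_. w"] a by auto
  then have cn: "centered_normal N ?X"
    by (simp add: vdot_def sum.cartesian_product[symmetric])
  have "integral\<^sup>L N (\<lambda>\<eta>. (?X \<eta>)\<^sup>2) = qform r I w"
  proof -
    have "(?X \<eta>)\<^sup>2 = (\<Sum>i<r. \<Sum>j<r. w i * w j * (S a \<eta> i * S a \<eta> j))" for \<eta>
      by (simp add: vdot_def power2_eq_square sum_product mult_ac)
    then have "integral\<^sup>L N (\<lambda>\<eta>. (?X \<eta>)\<^sup>2) = integral\<^sup>L N (\<lambda>\<eta>. \<Sum>i<r. \<Sum>j<r. w i * w j * (S a \<eta> i * S a \<eta> j))"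
      by simp
    also have "\<dots> = (\<Sum>i<r. integral\<^sup>L N (\<lambda>\<eta>. \<Sum>j<r. w i * w j * (S a \<eta> i * S a \<eta> j)))"
      using cov by (intro Bochner_Integration.integral_sum Bochner_Integration.integrable_sum integrable_mult_right) auto
    also have "\<dots> = (\<Sum>i<r. \<Sum>j<r. integral\<^sup>L N (\<lambda>\<eta>. w i * w j * (S a \<eta> i * S a \<eta> j)))"
      using cov by (intro sum.cong refl Bochner_Integration.integral_sum integrable_mult_right) auto
    also have "\<dots> = (\<Sum>i<r. \<Sum>j<r. w i * w j * I i j)"
      using cov by (intro sum.cong refl) auto
    finally show ?thesis by (simp add: qform_def mult_ac)
  qed
  \<comment> \<open>The second moment w'Iw is positive, which excludes the degenerate alternative of
    \<open>centered_normal\<close>. Below, only positivity of the resulting normal density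
    enters.\<close>
  then have "\<not> (AE \<eta> in N. ?X \<eta> = 0)"
  proof (intro notI)
    assume "integral\<^sup>L N (\<lambda>\<eta>. (?X \<eta>)\<^sup>2) = qform r I w" "AE \<eta> in N. ?X \<eta> = 0"
    moreover have "integral\<^sup>L N (\<lambda>\<eta>. (?X \<eta>)\<^sup>2) = integral\<^sup>L N (\<lambda>_. 0)" if "AE \<eta> in N. ?X \<eta> = 0"
      using that cn by (intro integral_cong_AE) (auto simp: centered_normal_def)
    ultimately show False using pos by simp
  qed
  then obtain \<sigma> where \<sigma>: "\<sigma> > 0" "distributed N lborel ?X (\<lambda>x. ennreal (normal_density 0 \<sigma> x))"
    using cn by (auto simp: centered_normal_def)
  have "(\<integral>\<^sup>+x. ennreal (normal_density 0 \<sigma> x) * indicator {..<b} x \<partial>lborel)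
      = (\<integral>\<^sup>+\<eta>. indicator {..<b} (?X \<eta>) \<partial>N)"
    by (rule distributed_nn_integral[OF \<sigma>(2)]) measurable
  also have "\<dots> = (\<integral>\<^sup>+\<eta>. 0 \<partial>N)" using AE by (intro nn_integral_cong_AE) auto
  finally have "(\<integral>\<^sup>+x. ennreal (normal_density 0 \<sigma> x) * indicator {..<b} x \<partial>lborel) = 0" by simp
  then have "AE x in lborel. ennreal (normal_density 0 \<sigma> x) * indicator {..<b} x = 0"
    by (subst (asm) nn_integral_0_iff_AE) auto
  then have "AE x in lborel. x \<notin> {..<b}"
  proof eventually_elim
    case (elim x)
    then show ?case using normal_density_pos[OF \<sigma>(1), of 0 x] by (auto simp: indicator_def split: if_splits)
  qed
  \<comment> \<open>Since the density is positive everywhere, the half-line below b would have to be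
    Lebesgue null.\<close>
  then have "emeasure lborel {..<b} = 0" by (subst (asm) AE_iff_measurable[of "{..<b}"]) auto
  moreover have "emeasure lborel {b - 1<..<b} \<le> emeasure lborel {..<b}" by (intro emeasure_mono) auto
  ultimately show False by simp
qed

text \<open>A Lipschitz test functional that is positive exactly on the event that w.f(a) lies below
  b.\<close>

lemma bc_functional_lower_tail:
  assumes a: "a \<in> A" shows "bc_functional r A (\<lambda>f. min 1 (max 0 (b - vdot r w (f a))))"
proof (rule bc_functional_lipschitz[where C=1 and L="vnorm r w"])
  fix f g :: "'a \<Rightarrow> vec" assume fg: "\<And>a. a \<in> A \<Longrightarrow> f a = g a"
  show "min 1 (max 0 (b - vdot r w (f a))) = min 1 (max 0 (b - vdot r w (g a)))" using fg[OF a] by simp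
next
  fix f g assume f: "bnd_fun r A f" and g: "bnd_fun r A g"
  have "vdot r w (g a) - vdot r w (f a) = - vdot r w (\<lambda>i. f a i - g a i)"
    by (simp add: vdot_def sum_negf[symmetric] sum_subtractf[symmetric] algebra_simps)
  then have "\<bar>vdot r w (g a) - vdot r w (f a)\<bar> \<le> vnorm r w * vnorm r (\<lambda>i. f a i - g a i)"
    using vdot_le[of r w "\<lambda>i. f a i - g a i"] by simp
  also have "\<dots> \<le> vnorm r w * sup_dist r A f g"
    using sup_dist_upper[OF f g a] by (intro mult_left_mono) (auto simp: vminus_def)
  finally show "min 1 (max 0 (b - vdot r w (f a))) \<le> min 1 (max 0 (b - vdot r w (g a))) + vnorm r w * sup_dist r A f g"
    by linarith
qed auto

text \<open>For x >= 1 the right side is at most (B + K) x, which falls below (c/4) x^2 past the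
  stated value.\<close>

lemma quadratic_le_imp_bounded:
  fixes x c B K :: real
  assumes "0 < c" "0 \<le> B" "0 \<le> K" "c / 4 * x\<^sup>2 \<le> B + K * x"
  shows "x \<le> 4 * (B + K) / c + 1"
proof (rule ccontr)
  assume "\<not> ?thesis"
  then have x: "4 * (B + K) / c + 1 < x" by simp
  have n: "0 \<le> 4 * (B + K) / c" using assms by simp
  have "4 * (B + K) / c < x" "1 \<le> x" using x n by linarith+
  then have "B + K < c / 4 * x" using assms(1) by (simp add: pos_divide_less_eq mult.commute)
  then have "(B + K) * x < c / 4 * x * x" using \<open>1 \<le> x\<close> by simp
  moreover have "B \<le> B * x" using assms(2) \<open>1 \<le> x\<close> mult_left_mono[of 1 x B] by simp
  ultimately show False using assms(4) by (simp add: power2_eq_square distrib_right)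
qed

text \<open>Enumerating the infinitely many times at which \<open>P\<close> holds reduces the claim
  to sequential compactness of \<open>C\<close>.\<close>

lemma frequently_convergent_subsequence:
  fixes w :: "nat \<Rightarrow> vec"
  assumes freq: "\<exists>\<^sub>F T in sequentially. P T" and w: "\<And>T. P T \<Longrightarrow> w T \<in> C" and C: "compact C"
  shows "\<exists>l\<in>C. \<exists>g :: nat \<Rightarrow> nat. strict_mono g \<and> (\<lambda>n. w (g n)) \<longlonglongrightarrow> l \<and> (\<forall>n. P (g n))"
proof -
  have inf: "infinite {T. P T}" using freq by (simp add: frequently_sequentially infinite_nat_iff_unbounded_le)
  define g where "g = enumerate {T. P T}"
  have g: "strict_mono g" "\<And>n. P (g n)"
    using strict_mono_enumerate[OF inf] enumerate_in_set[OF inf] by (auto simp: g_def)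
  obtain l g' where l: "l \<in> C" "strict_mono g'" "((\<lambda>n. w (g n)) \<circ> g') \<longlonglongrightarrow> l"
    using seq_compactE[OF compact_imp_seq_compact[OF C], of "\<lambda>n. w (g n)"] w g(2) by metis
  have "strict_mono (g \<circ> g')" using l(2) g(1) by (rule strict_mono_o[rotated])
  moreover have "(\<lambda>n. w ((g \<circ> g') n)) \<longlonglongrightarrow> l" using l(3) by (simp add: comp_def)
  moreover have "\<forall>n. P ((g \<circ> g') n)" using g(2) by simp
  ultimately show ?thesis using l(1) by blast
qed

text \<open>Here h is a local null direction, t its scaled image in the coordinates of the mixture,
  and Q the Hessian form at h; \<open>expan\<close> is the difference of the two expansions. The
  sequence t is first bounded, then shown to approach h, after which the relation can be solved for
  Q.\<close>

lemma hessian_form_limit: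
  assumes M: "prob_space M" and N: "prob_space N" and a: "a \<in> A"
    and S: "weak_conv_proc r A M S N Sl" "\<And>T \<omega>. \<omega> \<in> space M \<Longrightarrow> bnd_fun r A (\<lambda>a. S T a \<omega>)"
    and Sl: "AE \<eta> in N. bnd_fun r A (\<lambda>a. Sl a \<eta>)" and gp: "gaussian_process r A N Sl"
    and cov: "\<And>i j. i < r \<Longrightarrow> j < r \<Longrightarrow> integrable N (\<lambda>\<eta>. Sl a \<eta> i * Sl a \<eta> j)
      \<and> integral\<^sup>L N (\<lambda>\<eta>. Sl a \<eta> i * Sl a \<eta> j) = I i j"
    and sym: "symmetric_mat r I"
    and c: "0 < c" "\<And>x. x \<in> Rn r \<Longrightarrow> c * (vnorm r x)\<^sup>2 \<le> qform r I x"
    and t: "\<And>T. t T \<in> Rn r" and h: "h \<in> Rn r"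
    and Q: "\<And>T \<omega>. 0 \<le> Q T \<omega>" "\<And>\<eta>. 0 < \<eta> \<Longrightarrow> \<exists>K\<ge>0. evp M \<eta> (\<lambda>T \<omega>. Q T \<omega> \<le> K)"
    and expan: "\<And>e. 0 < e \<Longrightarrow> whp M (\<lambda>T \<omega>. \<bar>vdot r (S T a \<omega>) (\<lambda>i. h i - t T i) + qform r I (t T) / 2 - Q T \<omega> / 2\<bar>
        \<le> e * (1 + vnorm r (t T))\<^sup>2)"
    and e: "0 < e"
  shows "whp M (\<lambda>T \<omega>. \<bar>Q T \<omega> - qform r I h\<bar> \<le> e)"
proof -
  interpret M: prob_space M by fact
  interpret N: prob_space N by fact
  have Mf: "finite_measure M" by (rule M.finite_measure_axioms)
  have A: "A \<noteq> {}" using a by blast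
  define w where "w T = (\<lambda>i. h i - t T i)" for T
  have wR: "w T \<in> Rn r" for T unfolding w_def by (intro Rn_minus h t)
  have tight: "\<exists>K\<ge>0. evp M \<eta> (\<lambda>T \<omega>. vnorm r (S T a \<omega>) \<le> K)" if \<eta>: "0 < \<eta>" for \<eta>
  proof -
    obtain K where K: "0 \<le> K" "evp M \<eta> (\<lambda>T \<omega>. \<forall>a\<in>A. vnorm r (S T a \<omega>) \<le> K)"
      using weak_conv_tight[OF M N S Sl \<eta> A] by blast
    have "evp M \<eta> (\<lambda>T \<omega>. vnorm r (S T a \<omega>) \<le> K)" by (rule evp_mono'[OF K(2)]) (use a in blast)
    then show ?thesis using K(1) by blast
  qed
  define CI where "CI = (real r)\<^sup>2 * (\<Sum>i<r. \<Sum>j<r. \<bar>I i j\<bar>)"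
  have CI: "\<bar>qform r I x\<bar> \<le> CI * (vnorm r x)\<^sup>2" for x
    unfolding CI_def by (rule qform_abs_le[OF abs_entry_le_sum])
  have CI0: "0 \<le> CI" by (simp add: CI_def sum_nonneg)
  \<comment> \<open>The form t'It grows quadratically in t, S.(h - t) only linearly, and Q does not
    involve t. One path on which S, Q and the error are controlled therefore bounds t; the tolerance
    c/8 leaves c/4 of the coercivity.\<close>
  have "\<exists>K1\<ge>0. \<forall>\<^sub>F T in sequentially. vnorm r (t T) \<le> K1"
  proof -
    obtain K where K: "0 \<le> K" "evp M (1 / 4) (\<lambda>T \<omega>. vnorm r (S T a \<omega>) \<le> K)" using tight[of "1 / 4"] by auto
    obtain KQ where KQ: "0 \<le> KQ" "evp M (1 / 4) (\<lambda>T \<omega>. Q T \<omega> \<le> KQ)" using Q(2)[of "1 / 4"] by auto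
    define B where "B = c / 4 + KQ / 2 + K * vnorm r h"
    have B: "0 \<le> B" using c(1) KQ(1) K(1) by (simp add: B_def)
    have "evp M (1 / 4 + (1 / 4 + 1 / 4)) (\<lambda>T \<omega>. vnorm r (S T a \<omega>) \<le> K \<and> Q T \<omega> \<le> KQ \<and>
       \<bar>vdot r (S T a \<omega>) (\<lambda>i. h i - t T i) + qform r I (t T) / 2 - Q T \<omega> / 2\<bar> \<le> (c / 8) * (1 + vnorm r (t T))\<^sup>2)"
      using c(1) by (intro evp_conj[OF Mf] K(2) KQ(2) whpD[OF expan]) auto
    then have "\<forall>\<^sub>F T in sequentially. \<exists>\<omega>\<in>space M. vnorm r (S T a \<omega>) \<le> K \<and> Q T \<omega> \<le> KQ \<and>
       \<bar>vdot r (S T a \<omega>) (\<lambda>i. h i - t T i) + qform r I (t T) / 2 - Q T \<omega> / 2\<bar> \<le> (c / 8) * (1 + vnorm r (t T))\<^sup>2"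
      by (rule evp_frequently_ex[OF M]) simp
    then have "\<forall>\<^sub>F T in sequentially. vnorm r (t T) \<le> 4 * (B + K) / c + 1"
    proof eventually_elim
      case (elim T)
      then obtain \<omega> where w: "vnorm r (S T a \<omega>) \<le> K" "Q T \<omega> \<le> KQ"
        "\<bar>vdot r (S T a \<omega>) (\<lambda>i. h i - t T i) + qform r I (t T) / 2 - Q T \<omega> / 2\<bar> \<le> (c / 8) * (1 + vnorm r (t T))\<^sup>2"
        by blast
      let ?x = "vnorm r (t T)"
      have "\<bar>vdot r (S T a \<omega>) (\<lambda>i. h i - t T i)\<bar> \<le> vnorm r (S T a \<omega>) * vnorm r (\<lambda>i. h i - t T i)" by (rule vdot_le)
      also have "\<dots> \<le> K * (vnorm r h + ?x)" using w(1) K(1) vnorm_minus_le[of r h "t T"] by (intro mult_mono) auto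
      finally have 1: "\<bar>vdot r (S T a \<omega>) (\<lambda>i. h i - t T i)\<bar> \<le> K * vnorm r h + K * ?x" by (simp add: distrib_left)
      have "(1 + ?x)\<^sup>2 \<le> 2 + 2 * ?x\<^sup>2" using sum_squares_ge_zero[of "1 - ?x" 0]
        by (simp add: power2_eq_square algebra_simps)
      then have "(c / 8) * (1 + ?x)\<^sup>2 \<le> (c / 8) * (2 + 2 * ?x\<^sup>2)" using c(1) by (intro mult_left_mono) auto
      also have "\<dots> = c / 4 + c / 4 * ?x\<^sup>2" by (simp add: algebra_simps)
      finally have 2: "(c / 8) * (1 + ?x)\<^sup>2 \<le> c / 4 + c / 4 * ?x\<^sup>2" .
      have "c * ?x\<^sup>2 / 2 \<le> qform r I (t T) / 2" using c(2)[OF t] by simp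
      moreover have "c * ?x\<^sup>2 / 2 = c / 4 * ?x\<^sup>2 + c / 4 * ?x\<^sup>2" by simp
      ultimately have "c / 4 * ?x\<^sup>2 \<le> B + K * ?x" unfolding B_def using 1 2 w(2,3) by linarith
      then show ?case by (rule quadratic_le_imp_bounded[OF c(1) B K(1)])
    qed
    moreover have "0 \<le> 4 * (B + K) / c + 1" using B K(1) c(1) by simp
    ultimately show ?thesis by blast
  qed
  then obtain K1 where K1: "0 \<le> K1" "\<forall>\<^sub>F T in sequentially. vnorm r (t T) \<le> K1" by blast
  \<comment> \<open>If h - t stayed away from 0 along some times, a subsequence would have a limit l
    with l'Il > 0. On good paths S.(h - t) is bounded below, hence so is S.l, although the weak
    limit of S.l is a nondegenerate Gaussian.\<close>
  have w0: "\<forall>\<^sub>F T in sequentially. vnorm r (w T) < d" if d: "0 < d" for d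
  proof (rule ccontr)
    assume "\<not> ?thesis"
    then have "\<exists>\<^sub>F T in sequentially. \<not> vnorm r (w T) < d" by (simp add: not_eventually)
    then have freq: "\<exists>\<^sub>F T in sequentially. \<not> vnorm r (w T) < d \<and> vnorm r (t T) \<le> K1"
      by (rule frequently_eventually_frequently[OF _ K1(2)])
    have wC: "w T \<in> {x \<in> Rn r. vnorm r x \<le> vnorm r h + K1}" if "\<not> vnorm r (w T) < d \<and> vnorm r (t T) \<le> K1" for T
      using wR vnorm_minus_le[of r h "t T"] that by (auto simp: w_def)
    obtain l g where l: "l \<in> {x \<in> Rn r. vnorm r x \<le> vnorm r h + K1}" and g: "strict_mono (g :: nat \<Rightarrow> nat)"
      and lim: "(\<lambda>n. w (g n)) \<longlonglongrightarrow> l" and P: "\<forall>n. \<not> vnorm r (w (g n)) < d \<and> vnorm r (t (g n)) \<le> K1"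
      using frequently_convergent_subsequence[where w=w, OF freq _ compact_ball_Rn, of r "vnorm r h + K1"] wC by blast
    have coord: "(\<lambda>n. w (g n) i) \<longlonglongrightarrow> l i" for i
      using continuous_on_tendsto_compose[OF continuous_on_coord[of UNIV i] lim] by simp
    have "(\<lambda>n. vnorm r (\<lambda>i. w (g n) i - l i)) \<longlonglongrightarrow> vnorm r (\<lambda>i. l i - l i)"
      unfolding vnorm_def by (intro tendsto_intros coord)
    then have dl: "(\<lambda>n. vnorm r (\<lambda>i. w (g n) i - l i)) \<longlonglongrightarrow> 0" by (simp add: vnorm_def)
    have "(\<lambda>n. vnorm r (w (g n))) \<longlonglongrightarrow> vnorm r l"
      unfolding vnorm_def by (intro tendsto_intros coord)
    then have "d \<le> vnorm r l" using P by (intro LIMSEQ_le_const) (auto simp: not_less)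
    then have "0 < c * (vnorm r l)\<^sup>2" using c(1) d by simp
    then have lpos: "0 < qform r I l" using c(2)[of l] l by auto
    \<comment> \<open>The first two terms bound -S.(h - t), using Q >= 0 and |t| <= K1; the 1
      absorbs the replacement of h - t by its limit l.\<close>
    define b where "b = CI * K1\<^sup>2 / 2 + (1 + K1)\<^sup>2 + 1"
    let ?h = "\<lambda>f. min 1 (max 0 (- b - vdot r l (f a)))"
    have bc: "bc_functional r A ?h" by (rule bc_functional_lower_tail[OF a])
    define J where "J = integral\<^sup>L N (\<lambda>\<eta>. ?h (\<lambda>a. Sl a \<eta>))"
    have "J \<noteq> 0"
    proof
      assume "J = 0"
      then have "AE \<eta> in N. ?h (\<lambda>a. Sl a \<eta>) = 0"
        unfolding J_def using weak_conv_integrable[OF M N S bc]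
        by (subst (asm) integral_nonneg_eq_0_iff_AE) auto
      then have "AE \<eta> in N. - b \<le> vdot r l (Sl a \<eta>)"
        by eventually_elim (auto simp: min_def max_def split: if_splits)
      then show False using gaussian_lower_tail_pos[OF N gp a cov lpos] by blast
    qed
    moreover have "0 \<le> J" unfolding J_def by (intro integral_nonneg_AE) auto
    ultimately have J: "0 < J" by simp
    have ev1: "\<forall>\<^sub>F T in sequentially. J / 2 < outer_exp M (\<lambda>\<omega>. ?h (\<lambda>a. S T a \<omega>))"
      using J by (intro order_tendstoD(1)[OF weak_convD[OF S(1) bc]]) (simp add: J_def)
    obtain K where K: "0 \<le> K" "evp M (J / 8) (\<lambda>T \<omega>. vnorm r (S T a \<omega>) \<le> K)" using tight[of "J / 8"] J by auto
    \<comment> \<open>Off the exceptional set the test functional is 0, and the perturbation bound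
      charges twice the measure of that set. This is less than J/2, whereas the outer expectation
      eventually exceeds J/2.\<close>
    have "evp M (J / 8 + J / 8) (\<lambda>T \<omega>. vnorm r (S T a \<omega>) \<le> K \<and>
       \<bar>vdot r (S T a \<omega>) (\<lambda>i. h i - t T i) + qform r I (t T) / 2 - Q T \<omega> / 2\<bar> \<le> 1 * (1 + vnorm r (t T))\<^sup>2)"
      using J by (intro evp_conj[OF Mf] K(2) whpD[OF expan]) auto
    then have ev2: "\<forall>\<^sub>F T in sequentially. \<exists>C\<in>sets M. measure M C < J / 4 \<and> (\<forall>\<omega>\<in>space M - C.
       vnorm r (S T a \<omega>) \<le> K \<and> \<bar>vdot r (S T a \<omega>) (\<lambda>i. h i - t T i) + qform r I (t T) / 2 - Q T \<omega> / 2\<bar> \<le> (1 + vnorm r (t T))\<^sup>2)"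
      unfolding evp_def by simp
    have "\<forall>\<^sub>F n in sequentially. vnorm r (\<lambda>i. w (g n) i - l i) < 1 / (K + 1)"
      using K(1) by (intro order_tendstoD(2)[OF dl]) auto
    with eventually_subseq[OF g ev1] eventually_subseq[OF g ev2]
    have "\<forall>\<^sub>F n in sequentially. False"
    proof eventually_elim
      case (elim n)
      obtain C where C: "C \<in> sets M" "measure M C < J / 4" "\<forall>\<omega>\<in>space M - C.
          vnorm r (S (g n) a \<omega>) \<le> K \<and> \<bar>vdot r (S (g n) a \<omega>) (\<lambda>i. h i - t (g n) i) + qform r I (t (g n)) / 2
             - Q (g n) \<omega> / 2\<bar> \<le> (1 + vnorm r (t (g n)))\<^sup>2" using elim(2) by blast
      have z: "?h (\<lambda>a. S (g n) a \<omega>) \<le> 0 + 0" if w: "\<omega> \<in> space M - C" for \<omega>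
      proof -
        let ?S = "S (g n) a \<omega>" and ?t = "t (g n)"
        have tK: "vnorm r ?t \<le> K1" using P by blast
        have "(vnorm r ?t)\<^sup>2 \<le> K1\<^sup>2" "(1 + vnorm r ?t)\<^sup>2 \<le> (1 + K1)\<^sup>2" using tK by (auto intro: power_mono)
        then have "qform r I ?t \<le> CI * K1\<^sup>2"
          using CI[of ?t] mult_left_mono[of "(vnorm r ?t)\<^sup>2" "K1\<^sup>2" CI] CI0 by linarith
        moreover have "\<bar>vdot r ?S (w (g n)) + qform r I ?t / 2 - Q (g n) \<omega> / 2\<bar> \<le> (1 + vnorm r ?t)\<^sup>2"
          using C(3) w unfolding w_def by blast
        ultimately have 1: "- (CI * K1\<^sup>2 / 2 + (1 + K1)\<^sup>2) \<le> vdot r ?S (w (g n))"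
          using Q(1)[of "g n" \<omega>] \<open>(1 + vnorm r ?t)\<^sup>2 \<le> (1 + K1)\<^sup>2\<close> by linarith
        have "vdot r ?S (w (g n)) = vdot r ?S (\<lambda>i. 1 * l i + 1 * (w (g n) i - l i))" by simp
        also have "\<dots> = vdot r l ?S + vdot r ?S (\<lambda>i. w (g n) i - l i)"
          unfolding vdot_add by (simp add: vdot_commute)
        finally have 2: "vdot r l ?S = vdot r ?S (w (g n)) - vdot r ?S (\<lambda>i. w (g n) i - l i)" by simp
        have "\<bar>vdot r ?S (\<lambda>i. w (g n) i - l i)\<bar> \<le> vnorm r ?S * vnorm r (\<lambda>i. w (g n) i - l i)" by (rule vdot_le)
        also have "\<dots> \<le> K * (1 / (K + 1))" using C(3) w elim(3) K(1) by (intro mult_mono) auto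
        also have "\<dots> \<le> 1" using K(1) by simp
        finally show ?thesis using 1 2 by (simp add: b_def)
      qed
      have "outer_exp M (\<lambda>\<omega>. ?h (\<lambda>a. S (g n) a \<omega>)) \<le> outer_exp M (\<lambda>\<omega>. 0) + 0 + 2 * 1 * measure M C"
        by (rule M.outer_exp_perturb[OF _ _ C(1) z]) auto
      then show False using elim(1) C(2) by (simp add: M.outer_exp_const)
    qed
    then show False by simp
  qed
  show ?thesis
    unfolding whp_def
  proof (intro allI impI)
    fix \<eta> :: real assume \<eta>: "0 < \<eta>"
    obtain K where K: "0 \<le> K" "evp M (\<eta> / 2) (\<lambda>T \<omega>. vnorm r (S T a \<omega>) \<le> K)" using tight[of "\<eta> / 2"] \<eta> by auto
    \<comment> \<open>Collects the coefficients with which |h - t| enters the bound on |Q - h'Ih|;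
      the added 1 makes it positive.\<close>
    define D where "D = 2 * K + CI + 2 * vnorm r (mvmul r I h) + 1"
    have D: "0 < D" using K(1) CI0 by (simp add: D_def add_nonneg_pos)
    define e' where "e' = e / (4 * (1 + K1)\<^sup>2)"
    have e': "0 < e'" using e K1(1) by (simp add: e'_def)
    \<comment> \<open>With |h - t| <= 1 the quadratic term in h - t is dominated by the linear
      one.\<close>
    define d where "d = min 1 (e / (2 * D))"
    have d: "0 < d" using e D by (simp add: d_def)
    have "evp M (\<eta> / 2 + \<eta> / 2) (\<lambda>T \<omega>. vnorm r (S T a \<omega>) \<le> K \<and>
       \<bar>vdot r (S T a \<omega>) (\<lambda>i. h i - t T i) + qform r I (t T) / 2 - Q T \<omega> / 2\<bar> \<le> e' * (1 + vnorm r (t T))\<^sup>2)"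
      using \<eta> e' by (intro evp_conj[OF Mf] K(2) whpD[OF expan]) auto
    moreover have "\<eta> / 2 + \<eta> / 2 \<le> \<eta>" by simp
    moreover have "\<forall>\<^sub>F T in sequentially. \<forall>\<omega>\<in>space M. vnorm r (S T a \<omega>) \<le> K \<and>
       \<bar>vdot r (S T a \<omega>) (\<lambda>i. h i - t T i) + qform r I (t T) / 2 - Q T \<omega> / 2\<bar> \<le> e' * (1 + vnorm r (t T))\<^sup>2
       \<longrightarrow> \<bar>Q T \<omega> - qform r I h\<bar> \<le> e"
      using w0[OF d] K1(2)
    proof eventually_elim
      case (elim T)
      show ?case
      proof (intro ballI impI, elim conjE)
        fix \<omega> assume SK: "vnorm r (S T a \<omega>) \<le> K"
          and ex: "\<bar>vdot r (S T a \<omega>) (\<lambda>i. h i - t T i) + qform r I (t T) / 2 - Q T \<omega> / 2\<bar> \<le> e' * (1 + vnorm r (t T))\<^sup>2"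
        let ?x = "vnorm r (w T)"
        have "e' * (1 + vnorm r (t T))\<^sup>2 \<le> e' * (1 + K1)\<^sup>2" using elim(2) e' by (intro mult_left_mono power_mono) auto
        also have "\<dots> = e / 4" using K1(1) by (simp add: e'_def)
        finally have 1: "e' * (1 + vnorm r (t T))\<^sup>2 \<le> e / 4" .
        have 2: "\<bar>vdot r (S T a \<omega>) (w T)\<bar> \<le> K * ?x"
          using vdot_le[of r "S T a \<omega>" "w T"] mult_right_mono[OF SK, of ?x] by simp
        have "t T = (\<lambda>i. 1 * h i + (-1) * w T i)" by (simp add: w_def)
        then have "qform r I (t T) = qform r I h - 2 * vdot r (w T) (mvmul r I h) + qform r I (w T)"
          using qform_add[OF sym, of 1 h "-1" "w T"] by simp
        moreover have "\<bar>vdot r (w T) (mvmul r I h)\<bar> \<le> ?x * vnorm r (mvmul r I h)" by (rule vdot_le)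
        moreover have "\<bar>qform r I (w T)\<bar> \<le> CI * ?x"
        proof -
          have "?x\<^sup>2 \<le> ?x" using elim(1) by (simp add: d_def power2_eq_square mult_left_le)
          then show ?thesis using CI[of "w T"] mult_left_mono[of "?x\<^sup>2" ?x CI] CI0 by linarith
        qed
        ultimately have "\<bar>qform r I (t T) - qform r I h\<bar> \<le> 2 * (?x * vnorm r (mvmul r I h)) + CI * ?x" by linarith
        then have "\<bar>Q T \<omega> - qform r I h\<bar> \<le> 2 * (K * ?x) + (2 * (?x * vnorm r (mvmul r I h)) + CI * ?x) + e / 2"
          using ex 1 2 unfolding w_def[symmetric] by linarith
        also have "\<dots> \<le> D * ?x + e / 2" by (simp add: D_def algebra_simps)
        also have "D * ?x \<le> D * (e / (2 * D))" using elim(1) D by (intro mult_left_mono) (auto simp: d_def)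
        also have "\<dots> = e / 2" using D by simp
        finally show "\<bar>Q T \<omega> - qform r I h\<bar> \<le> e" by simp
      qed
    qed
    ultimately show "evp M \<eta> (\<lambda>T \<omega>. \<bar>Q T \<omega> - qform r I h\<bar> \<le> e)" by (rule evp_mono)
  qed
qed

text \<open>Cutting \<open>A\<close> to its leading m-block makes it a \<open>symmetric_mat\<close>,
  so the identity also serves leading blocks of larger matrices.\<close>

lemma qform_polarization:
  assumes ij: "i < m" "j < m" and sym: "\<And>i j. i < m \<Longrightarrow> j < m \<Longrightarrow> A i j = A j i"
  shows "A i j = (qform m A (\<lambda>k. unitv i k + unitv j k) - qform m A (unitv i) - qform m A (unitv j)) / 2"
proof -
  let ?A = "\<lambda>i j. if i < m \<and> j < m then A i j else 0"
  have q: "qform m A x = qform m ?A x" for x by (simp add: qform_def)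
  have s: "symmetric_mat m ?A" using sym by (auto simp: symmetric_mat_def is_mat_def)
  have "vdot m (unitv i) (mvmul m ?A (unitv j)) = mvmul m ?A (unitv j) i" by (rule vdot_unitv[OF ij(1)])
  also have "\<dots> = A i j"
    using ij by (simp add: mvmul_def unitv_def if_distrib[of "\<lambda>x. _ * x"] cong: if_cong)
  finally show ?thesis
    unfolding q using qform_add[OF s, of 1 "unitv j" 1 "unitv i"] by (simp add: add.commute)
qed

lemma half_difference_bound:
  fixes a b c a' b' c' e :: real
  assumes "\<bar>a - a'\<bar> \<le> e / 2" "\<bar>b - b'\<bar> \<le> e / 2" "\<bar>c - c'\<bar> \<le> e / 2" "0 < e"
  shows "\<bar>(a - b - c) / 2 - (a' - b' - c') / 2\<bar> \<le> e"
proof -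
  have "\<bar>(a - b - c) / 2 - (a' - b' - c') / 2\<bar> = \<bar>(a - a') - (b - b') - (c - c')\<bar> / 2"
    by (simp add: diff_divide_distrib[symmetric] algebra_simps)
  also have "\<dots> \<le> (e / 2 + e / 2 + e / 2) / 2"
    by (intro divide_right_mono order_trans[OF abs_triangle_ineq4] add_mono assms(1-3)) simp
  finally show ?thesis using assms(4) by simp
qed

text \<open>The forms converge for each fixed h, whereas the null likelihood is to be expanded
  uniformly in the parameter. Polarization reduces every entry to three forms; finitely many entries
  then control all h at once.\<close>

lemma whp_entries_limit:
  assumes M: "finite_measure M"
    and symH: "\<And>T \<omega> i j. i < m \<Longrightarrow> j < m \<Longrightarrow> H T \<omega> i j = H T \<omega> j i"
    and symI: "\<And>i j. i < m \<Longrightarrow> j < m \<Longrightarrow> I i j = I j i"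
    and lim: "\<And>h e. h \<in> Rn m \<Longrightarrow> 0 < e \<Longrightarrow> whp M (\<lambda>T \<omega>. \<bar>qform m (H T \<omega>) h - qform m I h\<bar> \<le> e)"
    and e: "0 < e"
  shows "whp M (\<lambda>T \<omega>. \<forall>i<m. \<forall>j<m. \<bar>H T \<omega> i j - I i j\<bar> \<le> e)"
proof -
  have "whp M (\<lambda>T \<omega>. \<bar>H T \<omega> i j - I i j\<bar> \<le> e)" if ij: "i < m" "j < m" for i j
  proof -
    let ?s = "\<lambda>k. unitv i k + unitv j k"
    have "?s \<in> Rn m" using ij by (auto simp: Rn_def unitv_def)
    then have "whp M (\<lambda>T \<omega>. \<bar>qform m (H T \<omega>) ?s - qform m I ?s\<bar> \<le> e / 2 \<and>
       \<bar>qform m (H T \<omega>) (unitv i) - qform m I (unitv i)\<bar> \<le> e / 2 \<and>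
       \<bar>qform m (H T \<omega>) (unitv j) - qform m I (unitv j)\<bar> \<le> e / 2)"
      using e ij by (intro whp_conj[OF M] lim unitv_Rn) auto
    then show ?thesis
    proof (rule whp_mono')
      fix T \<omega> assume "\<bar>qform m (H T \<omega>) ?s - qform m I ?s\<bar> \<le> e / 2 \<and>
       \<bar>qform m (H T \<omega>) (unitv i) - qform m I (unitv i)\<bar> \<le> e / 2 \<and>
       \<bar>qform m (H T \<omega>) (unitv j) - qform m I (unitv j)\<bar> \<le> e / 2"
      then have "\<bar>(qform m (H T \<omega>) ?s - qform m (H T \<omega>) (unitv i) - qform m (H T \<omega>) (unitv j)) / 2
         - (qform m I ?s - qform m I (unitv i) - qform m I (unitv j)) / 2\<bar> \<le> e"
        using e by (intro half_difference_bound) blast+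
      moreover have "H T \<omega> i j = (qform m (H T \<omega>) ?s - qform m (H T \<omega>) (unitv i) - qform m (H T \<omega>) (unitv j)) / 2"
        by (rule qform_polarization[OF ij symH])
      moreover have "I i j = (qform m I ?s - qform m I (unitv i) - qform m I (unitv j)) / 2"
        by (rule qform_polarization[OF ij symI])
      ultimately show "\<bar>H T \<omega> i j - I i j\<bar> \<le> e" by (simp only:)
    qed
  qed
  then have "whp M (\<lambda>T \<omega>. \<forall>ij\<in>{..<m} \<times> {..<m}. \<bar>H T \<omega> (fst ij) (snd ij) - I (fst ij) (snd ij)\<bar> \<le> e)"
    by (intro whp_ball_finite[OF M]) auto
  then show ?thesis by (rule whp_mono') auto
qed

section \<open>Local expansions of the null likelihood\<close>

lemma tendsto_vec:
  fixes f :: "'b \<Rightarrow> vec" assumes "\<And>i. ((\<lambda>x. f x i) \<longlongrightarrow> l i) F"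
  shows "(f \<longlongrightarrow> l) F"
proof -
  have "limitin (product_topology (\<lambda>i::nat. euclidean) UNIV) f l F"
    unfolding limitin_componentwise using assms by (simp add: limitin_canonical_iff)
  then show ?thesis by (simp add: euclidean_product_topology limitin_canonical_iff)
qed

lemma tendsto_coord:
  fixes f :: "'b \<Rightarrow> vec" assumes "(f \<longlongrightarrow> l) F" shows "((\<lambda>x. f x i) \<longlongrightarrow> l i) F"
  using continuous_on_tendsto_compose[OF continuous_on_coord[of UNIV i] assms] by simp

text \<open>Otherwise points outside \<open>S\<close> lie within 1/(m+1) of x in the first n
  coordinates. All further coordinates vanish, so these points converge to x in the product
  topology, against openness.\<close>

lemma rint_contains_cube:
  assumes x: "x \<in> rint n S"
  shows "\<exists>\<rho>>0. \<forall>z\<in>Rn n. (\<forall>i<n. \<bar>z i - x i\<bar> < \<rho>) \<longrightarrow> z \<in> S"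
proof (rule ccontr)
  assume neg: "\<not> ?thesis"
  obtain U where U: "openin (top_of_set (Rn n)) U" "x \<in> U" "U \<subseteq> S"
    using x unfolding rint_def interior_of_def by blast
  obtain V where V: "open V" "U = Rn n \<inter> V" using U(1) by (auto simp: openin_open)
  have "\<exists>z. z \<in> Rn n \<and> (\<forall>i<n. \<bar>z i - x i\<bar> < 1 / real (Suc m)) \<and> z \<notin> S" for m
    using neg by (auto dest!: spec[of _ "1 / real (Suc m)"])
  then obtain z where z: "\<And>m. z m \<in> Rn n" "\<And>m i. i < n \<Longrightarrow> \<bar>z m i - x i\<bar> < 1 / real (Suc m)" "\<And>m. z m \<notin> S"
    by metis
  have xR: "x \<in> Rn n" using U(2) V(2) by blast
  have "z \<longlonglongrightarrow> x"
  proof (rule tendsto_vec)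
    fix i
    show "(\<lambda>m. z m i) \<longlonglongrightarrow> x i"
    proof (cases "i < n")
      case True
      have "(\<lambda>m. z m i - x i) \<longlonglongrightarrow> 0"
        by (rule Lim_null_comparison[OF _ LIMSEQ_inverse_real_of_nat])
           (use z(2)[OF True] in \<open>auto intro!: always_eventually less_imp_le simp: inverse_eq_divide\<close>)
      then show ?thesis by (simp add: LIM_zero_iff)
    next
      case False
      then have "z m i = x i" for m using z(1)[of m] xR by (simp add: Rn_def)
      then show ?thesis by simp
    qed
  qed
  moreover have "x \<in> V" using U(2) V(2) by blast
  ultimately have "\<forall>\<^sub>F m in sequentially. z m \<in> V" using topological_tendstoD V(1) by blast
  then obtain m where "z m \<in> V" by (auto simp: eventually_sequentially)
  then have "z m \<in> S" using z(1) V(2) U(3) by blast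
  then show False using z(3) by blast
qed

text \<open>The inverse is the matrix of the inverse permutation, that is, the transpose
  \<open>C\<close>.\<close>

lemma perm_matrix_minv_mult:
  assumes "perm_matrix n P" "x \<in> Rn n"
  shows "mvmul n (minv n P) (mvmul n P x) = x" "mvmul n P (mvmul n (minv n P) x) = x"
proof -
  obtain \<sigma> where s: "\<sigma> permutes {..<n}" and P: "\<And>i j. P i j = (if i < n \<and> j < n \<and> j = \<sigma> i then 1 else 0)"
    using assms(1) by (auto simp: perm_matrix_def)
  have lt: "\<sigma> i < n \<longleftrightarrow> i < n" for i using permutes_in_image[OF s, of i] by simp
  have inj: "\<sigma> i = \<sigma> j \<longleftrightarrow> i = j" for i j using permutes_inj[OF s] by (auto dest: injD)
  define C :: mat where "C i j = (if i < n \<and> j < n \<and> i = \<sigma> j then 1 else 0)" for i j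
  have PC: "mmul n P C = idm n"
  proof (intro ext)
    fix i k
    show "mmul n P C i k = idm n i k"
    proof (cases "i < n \<and> k < n")
      case True
      then have "mmul n P C i k = (\<Sum>l<n. P i l * C l k)" by (simp add: mmul_def)
      also have "\<dots> = (\<Sum>l<n. if l = \<sigma> i then (if i = k then 1 else 0) else 0)"
        using True by (intro sum.cong refl) (auto simp: P C_def inj)
      also have "\<dots> = (if i = k then 1 else 0)" using True lt[of i] by simp
      finally show ?thesis using True by (simp add: idm_def)
    qed (auto simp: mmul_def idm_def)
  qed
  have CP: "mmul n C P = idm n"
  proof (intro ext)
    fix i k
    show "mmul n C P i k = idm n i k"
    proof (cases "i < n \<and> k < n")
      case True
      then obtain j where j: "j < n" "\<sigma> j = i"
        using permutes_surj[OF s] lt by (metis surjD)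
      have "mmul n C P i k = (\<Sum>l<n. C i l * P l k)" using True by (simp add: mmul_def)
      also have "\<dots> = (\<Sum>l<n. if l = j then (if i = k then 1 else 0) else 0)"
        using True j by (intro sum.cong refl) (auto simp: P C_def inj)
      also have "\<dots> = (if i = k then 1 else 0)" using j by simp
      finally show ?thesis using True by (simp add: idm_def)
    qed (auto simp: mmul_def idm_def)
  qed
  have "minv n P = C" by (rule minv_unique[OF _ PC CP]) (auto simp: is_mat_def C_def)
  then show "mvmul n (minv n P) (mvmul n P x) = x" "mvmul n P (mvmul n (minv n P) x) = x"
    using assms(2) by (simp_all add: mvmul_mmul[symmetric] PC CP mvmul_idm)
qed

lemma vjoin_vtake_vdrop: "x \<in> Rn (m + k) \<Longrightarrow> vjoin m (vtake m x) (vtake k (vdrop m x)) = x"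
  by (auto simp: vjoin_def vtake_def vdrop_def Rn_def fun_eq_iff)

lemma vdot_Rn_left: "m \<le> n \<Longrightarrow> x \<in> Rn m \<Longrightarrow> vdot n v x = vdot m v x"
  by (simp add: vdot_def sum_split_lessThan[of m n] Rn_def)

lemma vnorm_Rn: "m \<le> n \<Longrightarrow> x \<in> Rn m \<Longrightarrow> vnorm n x = vnorm m x"
  by (simp add: vnorm_def sum_split_lessThan[of m n] Rn_def)

lemma qform_Rn:
  assumes "m \<le> n" "x \<in> Rn m" shows "qform n A x = qform m A x"
  using assms by (simp add: qform_def sum_split_lessThan[of m n] Rn_def)

lemma qform_diff: "qform n (\<lambda>i j. A i j - B i j) x = qform n A x - qform n B x"
  by (simp add: qform_def sum_subtractf algebra_simps)

text \<open>For a fixed path the density is continuous and positive on a compact set. The bounds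
  make log-likelihoods bounded in the parameter, so that their real suprema are genuine.\<close>

lemma dens_bounds:
  assumes K: "compact K" "K \<subseteq> {ph. 0 < ph (p + 1)}"
  shows "\<exists>l u. 0 < l \<and> (\<forall>ph\<in>K. l \<le> dens p y t ph \<omega> \<and> dens p y t ph \<omega> \<le> u)"
proof (cases "K = {}")
  case True
  then show ?thesis by (intro exI[of _ 1]) auto
next
  case False
  have cont: "continuous_on K (\<lambda>ph. dens p y t ph \<omega>)"
    unfolding dens_def std_normal_density_def using K(2)
    by (intro continuous_intros continuous_on_coord) auto
  obtain a where a: "a \<in> K" "\<And>b. b \<in> K \<Longrightarrow> dens p y t a \<omega> \<le> dens p y t b \<omega>"
    using continuous_attains_inf[OF K(1) False cont] by blast
  obtain c where c: "c \<in> K" "\<And>b. b \<in> K \<Longrightarrow> dens p y t b \<omega> \<le> dens p y t c \<omega>"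
    using continuous_attains_sup[OF K(1) False cont] by blast
  have "0 < a (p + 1)" using a(1) K(2) by blast
  then have "0 < dens p y t a \<omega>" by (simp add: dens_def normal_density_pos)
  then show ?thesis using a c by blast
qed

text \<open>A convex combination stays between l and u. With two equal components it also covers the
  null likelihood.\<close>

lemma ln_convex_combination_bound:
  fixes w d e l u :: real
  assumes "0 < w" "w < 1" "0 < l" "l \<le> d" "d \<le> u" "l \<le> e" "e \<le> u"
  shows "\<bar>ln (w * d + (1 - w) * e)\<bar> \<le> \<bar>ln l\<bar> + \<bar>ln u\<bar>"
proof -
  have "w * l + (1 - w) * l \<le> w * d + (1 - w) * e" using assms by (intro add_mono mult_left_mono) auto
  then have 1: "l \<le> w * d + (1 - w) * e" by (simp add: algebra_simps)
  have "w * d + (1 - w) * e \<le> w * u + (1 - w) * u" using assms by (intro add_mono mult_left_mono) auto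
  then have 2: "w * d + (1 - w) * e \<le> u" by (simp add: algebra_simps)
  have "ln l \<le> ln (w * d + (1 - w) * e)" "ln (w * d + (1 - w) * e) \<le> ln u"
    using 1 2 assms(3) by (auto intro: ln_mono)
  then show ?thesis by linarith
qed

context gaussian_ar begin

text \<open>On a path at distance of order 1/sqrt T the relative change k of the variance has the
  same order, so every remainder term is a tight quantity divided by sqrt T; \<open>D\<close>
  collects the numerators.\<close>

lemma path_expansion:
  assumes S: "\<And>\<eta>. 0 < \<eta> \<Longrightarrow> \<exists>K\<ge>0. evp M \<eta> (\<lambda>T \<omega>. vnorm (p + 2) (nscore T \<omega>) \<le> K)"
    and Q: "\<And>\<eta>. 0 < \<eta> \<Longrightarrow> \<exists>K\<ge>0. evp M \<eta> (\<lambda>T \<omega>. qform (p + 2) (hess T \<omega>) h \<le> K)"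
    and e: "0 < e"
  shows "whp M (\<lambda>T \<omega>. \<bar>L0 p y T (\<lambda>i. phs i + h i / sqrt (real T)) \<omega> - L0 p y T phs \<omega>
      - (vdot (p + 2) (nscore T \<omega>) h - qform (p + 2) (hess T \<omega>) h / 2)\<bar> \<le> e)"
  unfolding whp_def
proof (intro allI impI)
  fix \<eta> :: real assume \<eta>: "0 < \<eta>"
  obtain K where K: "0 \<le> K" "evp M (\<eta> / 2) (\<lambda>T \<omega>. vnorm (p + 2) (nscore T \<omega>) \<le> K)" using S[of "\<eta> / 2"] \<eta> by auto
  obtain KQ where KQ: "0 \<le> KQ" "evp M (\<eta> / 2) (\<lambda>T \<omega>. qform (p + 2) (hess T \<omega>) h \<le> KQ)" using Q[of "\<eta> / 2"] \<eta> by auto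
  let ?N = "vnorm (p + 2) h"
  define k0 where "k0 = \<bar>h (p + 1)\<bar> / tau"
  have k0: "0 \<le> k0" using tau_pos by (simp add: k0_def)
  define D where "D = (5 * k0 / tau\<^sup>2 + 4 * K / tau) * ?N\<^sup>2 + 2 * k0 * K * ?N + k0 * KQ"
  have half: "(0::real) < 1 / 2" by simp
  have "evp M (\<eta> / 2 + \<eta> / 2) (\<lambda>T \<omega>. vnorm (p + 2) (nscore T \<omega>) \<le> K \<and> qform (p + 2) (hess T \<omega>) h \<le> KQ)"
    by (intro evp_conj K(2) KQ(2) finite_measure_axioms)
  moreover have "\<eta> / 2 + \<eta> / 2 \<le> \<eta>" by simp
  moreover have "\<forall>\<^sub>F T in sequentially. \<forall>\<omega>\<in>space M. vnorm (p + 2) (nscore T \<omega>) \<le> K \<and> qform (p + 2) (hess T \<omega>) h \<le> KQ \<longrightarrow>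
     \<bar>L0 p y T (\<lambda>i. phs i + h i / sqrt (real T)) \<omega> - L0 p y T phs \<omega>
      - (vdot (p + 2) (nscore T \<omega>) h - qform (p + 2) (hess T \<omega>) h / 2)\<bar> \<le> e"
    using eventually_sqrt_large[OF e, of D] eventually_sqrt_large[OF half, of k0] eventually_ge_at_top[of 1]
  proof eventually_elim
    case (elim T)
    show ?case
    proof (intro ballI impI, elim conjE)
      fix \<omega> assume w: "\<omega> \<in> space M" and s: "vnorm (p + 2) (nscore T \<omega>) \<le> K"
        and q: "qform (p + 2) (hess T \<omega>) h \<le> KQ"
      let ?r = "sqrt (real T)"
      let ?ph = "\<lambda>i. phs i + h i / ?r"
      let ?k = "h (p + 1) / (tau * ?r)"
      have r: "0 < ?r" using elim(3) by simp
      have k: "\<bar>?k\<bar> = k0 / ?r" using tau_pos r by (simp add: k0_def abs_divide abs_mult)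
      have "?ph (p + 1) = tau * (1 + ?k)" using tau_pos r by (simp add: tau_def[symmetric] field_simps) (simp add: tau_def)
      moreover have "\<bar>?k\<bar> \<le> 1 / 2" unfolding k using elim(2) by simp
      moreover have hh: "(\<lambda>i. ?r * (?ph i - phs i)) = h" using r by simp
      ultimately have "\<bar>L0 p y T ?ph \<omega> - L0 p y T phs \<omega>
        - (vdot (p + 2) (nscore T \<omega>) h - qform (p + 2) (hess T \<omega>) h / 2)\<bar>
        \<le> (5 * \<bar>?k\<bar> / tau\<^sup>2 + 4 * vnorm (p + 2) (nscore T \<omega>) / (tau * ?r)) * ?N\<^sup>2
          + 2 * \<bar>?k\<bar> * vnorm (p + 2) (nscore T \<omega>) * ?N + \<bar>?k\<bar> * qform (p + 2) (hess T \<omega>) h"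
        using L0_expansion[where ph="?ph" and k="?k", OF w elim(3)] unfolding hh by blast
      also have "\<dots> \<le> (5 * (k0 / ?r) / tau\<^sup>2 + 4 * K / (tau * ?r)) * ?N\<^sup>2 + 2 * (k0 / ?r) * K * ?N + (k0 / ?r) * KQ"
        unfolding k using s q k0 r tau_pos K(1)
        by (intro add_mono mult_right_mono mult_left_mono divide_right_mono) auto
      also have "\<dots> = D / ?r" by (simp add: D_def add_divide_distrib distrib_right)
      also have "\<dots> \<le> e" using elim(1) by simp
      finally show "\<bar>L0 p y T ?ph \<omega> - L0 p y T phs \<omega>
        - (vdot (p + 2) (nscore T \<omega>) h - qform (p + 2) (hess T \<omega>) h / 2)\<bar> \<le> e" .
    qed
  qed
  ultimately show "evp M \<eta> (\<lambda>T \<omega>. \<bar>L0 p y T (\<lambda>i. phs i + h i / sqrt (real T)) \<omega> - L0 p y T phs \<omega>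
      - (vdot (p + 2) (nscore T \<omega>) h - qform (p + 2) (hess T \<omega>) h / 2)\<bar> \<le> e)"
    by (rule evp_mono)
qed

text \<open>On a fixed neighbourhood k is small but does not tend to 0, so the error is measured
  against (1 + N)^2, with N the norm of the scaled parameter difference. Entrywise closeness of
  \<open>hess\<close> to \<open>J\<close> permits the replacement for all parameters at
  once.\<close>

lemma null_expansion:
  assumes S: "\<And>\<eta>. 0 < \<eta> \<Longrightarrow> \<exists>K\<ge>0. evp M \<eta> (\<lambda>T \<omega>. vnorm (p + 2) (nscore T \<omega>) \<le> K)"
    and H: "\<And>e. 0 < e \<Longrightarrow> whp M (\<lambda>T \<omega>. \<forall>i<p + 2. \<forall>j<p + 2. \<bar>hess T \<omega> i j - J i j\<bar> \<le> e)"
    and e: "0 < e" and \<eta>: "0 < \<eta>"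
  shows "\<exists>\<delta>>0. evp M \<eta> (\<lambda>T \<omega>. \<forall>ph. vnorm (p + 2) (vminus ph phs) \<le> \<delta> \<longrightarrow>
      \<bar>L0 p y T ph \<omega> - L0 p y T phs \<omega> - (vdot (p + 2) (nscore T \<omega>) (\<lambda>i. sqrt (real T) * (ph i - phs i))
        - qform (p + 2) J (\<lambda>i. sqrt (real T) * (ph i - phs i)) / 2)\<bar>
      \<le> e * (1 + vnorm (p + 2) (\<lambda>i. sqrt (real T) * (ph i - phs i)))\<^sup>2)"
proof -
  let ?m = "p + 2"
  have \<eta>2: "0 < \<eta> / 2" using \<eta> by simp
  obtain K where K: "0 \<le> K" "evp M (\<eta> / 2) (\<lambda>T \<omega>. vnorm ?m (nscore T \<omega>) \<le> K)" using S[OF \<eta>2] by blast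
  define C where "C = (\<Sum>i<?m. \<Sum>j<?m. \<bar>J i j\<bar>) + 1"
  have C: "\<bar>J i j\<bar> + 1 \<le> C" if "i < ?m" "j < ?m" for i j
    unfolding C_def using abs_entry_le_sum[OF that, of J] by simp
  have C1: "0 \<le> C" using C[of 0 0] by simp
  let ?m2 = "(real ?m)\<^sup>2"
  have m2: "0 < ?m2" by simp
  \<comment> \<open>At most 1, so that the entries of \<open>hess\<close> are bounded by C; small
    enough relative to e that replacing \<open>hess\<close> by \<open>J\<close> in the form costs at
    most (e/2) N^2.\<close>
  define e1 where "e1 = min 1 (e / (2 * ?m2))"
  have e1: "0 < e1" "e1 \<le> 1" "?m2 * e1 \<le> e / 2"
  proof -
    show "0 < e1" using e m2 by (simp add: e1_def)
    show "e1 \<le> 1" unfolding e1_def by (rule min.cobounded1)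
    have "?m2 * e1 \<le> ?m2 * (e / (2 * ?m2))" unfolding e1_def by (intro mult_left_mono min.cobounded2) simp
    also have "\<dots> = e / 2" using m2 by (simp del: of_nat_add)
    finally show "?m2 * e1 \<le> e / 2" .
  qed
  define D where "D = 5 / tau\<^sup>2 + 2 * K + ?m2 * C + 1"
  have D: "0 < D" using K(1) C1 by (simp add: D_def add_nonneg_pos)
  \<comment> \<open>Forces |k| <= 1/2, the range of the expansion, and |k| D <= e/4; the terms
    proportional to k have total coefficient D - 1.\<close>
  define \<delta> where "\<delta> = tau * min (1 / 2) (e / (4 * D))"
  have \<delta>: "0 < \<delta>" using tau_pos e D by (simp add: \<delta>_def)
  have e4: "0 < e / 4" using e by simp
  have "evp M (\<eta> / 2 + \<eta> / 2) (\<lambda>T \<omega>. vnorm ?m (nscore T \<omega>) \<le> K \<and> (\<forall>i<?m. \<forall>j<?m. \<bar>hess T \<omega> i j - J i j\<bar> \<le> e1))"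
    by (intro evp_conj K(2) whpD[OF H] finite_measure_axioms e1 \<eta>2)
  moreover have "\<eta> / 2 + \<eta> / 2 \<le> \<eta>" by simp
  moreover have "\<forall>\<^sub>F T in sequentially. \<forall>\<omega>\<in>space M. vnorm ?m (nscore T \<omega>) \<le> K \<and> (\<forall>i<?m. \<forall>j<?m. \<bar>hess T \<omega> i j - J i j\<bar> \<le> e1) \<longrightarrow>
     (\<forall>ph. vnorm ?m (vminus ph phs) \<le> \<delta> \<longrightarrow>
      \<bar>L0 p y T ph \<omega> - L0 p y T phs \<omega> - (vdot ?m (nscore T \<omega>) (\<lambda>i. sqrt (real T) * (ph i - phs i))
        - qform ?m J (\<lambda>i. sqrt (real T) * (ph i - phs i)) / 2)\<bar>
      \<le> e * (1 + vnorm ?m (\<lambda>i. sqrt (real T) * (ph i - phs i)))\<^sup>2)"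
    using eventually_sqrt_large[OF e4, of "4 * K / tau"] eventually_ge_at_top[of 1]
  proof eventually_elim
    case (elim T)
    show ?case
    proof (intro ballI impI allI, elim conjE)
      fix \<omega> ph assume w: "\<omega> \<in> space M" and ph: "vnorm ?m (vminus ph phs) \<le> \<delta>"
        and s: "vnorm ?m (nscore T \<omega>) \<le> K" and hs: "\<forall>i<?m. \<forall>j<?m. \<bar>hess T \<omega> i j - J i j\<bar> \<le> e1"
      let ?r = "sqrt (real T)"
      let ?h = "\<lambda>i. ?r * (ph i - phs i)"
      let ?N = "vnorm ?m ?h"
      let ?k = "(ph (p + 1) - tau) / tau"
      have r: "0 < ?r" using elim(2) by simp
      have "\<bar>ph (p + 1) - tau\<bar> \<le> \<delta>"
        using component_le_vnorm[of "p + 1" ?m "vminus ph phs"] ph by (simp add: vminus_def tau_def)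
      then have "\<bar>?k\<bar> \<le> \<delta> / tau" using tau_pos by (simp add: abs_divide divide_right_mono)
      also have "\<dots> = min (1 / 2) (e / (4 * D))" using tau_pos by (simp add: \<delta>_def)
      finally have k: "\<bar>?k\<bar> \<le> 1 / 2" "\<bar>?k\<bar> \<le> e / (4 * D)" by linarith+
      have kph: "ph (p + 1) = tau * (1 + ?k)" using tau_pos by (simp add: field_simps)
      let ?q = "qform ?m (hess T \<omega>) ?h"
      let ?s = "vnorm ?m (nscore T \<omega>)"
      have "\<bar>hess T \<omega> i j\<bar> \<le> C" if "i < ?m" "j < ?m" for i j
      proof -
        have "\<bar>hess T \<omega> i j - J i j\<bar> \<le> e1" using hs that by blast
        then show ?thesis using C[OF that] e1(2) by linarith
      qed
      then have q: "\<bar>?q\<bar> \<le> ?m2 * C * ?N\<^sup>2" by (rule qform_abs_le)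
      have "qform ?m (\<lambda>i j. hess T \<omega> i j - J i j) ?h = ?q - qform ?m J ?h"
        by (rule qform_diff)
      moreover have "\<bar>qform ?m (\<lambda>i j. hess T \<omega> i j - J i j) ?h\<bar> \<le> ?m2 * e1 * ?N\<^sup>2"
        by (rule qform_abs_le) (use hs in blast)
      moreover have "?m2 * e1 * ?N\<^sup>2 \<le> e / 2 * ?N\<^sup>2" by (intro mult_right_mono e1) simp
      ultimately have qd: "\<bar>?q - qform ?m J ?h\<bar> \<le> e / 2 * ?N\<^sup>2" by linarith
      have "\<bar>L0 p y T ph \<omega> - L0 p y T phs \<omega> - (vdot ?m (nscore T \<omega>) ?h - ?q / 2)\<bar>
        \<le> (5 * \<bar>?k\<bar> / tau\<^sup>2 + 4 * ?s / (tau * ?r)) * ?N\<^sup>2 + 2 * \<bar>?k\<bar> * ?s * ?N + \<bar>?k\<bar> * ?q"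
        by (rule L0_expansion[where ph=ph, OF w elim(2) kph k(1)])
      also have "\<dots> \<le> (5 * \<bar>?k\<bar> / tau\<^sup>2 + e / 4) * (1 + ?N)\<^sup>2 + 2 * \<bar>?k\<bar> * K * (1 + ?N)\<^sup>2 + \<bar>?k\<bar> * (?m2 * C * (1 + ?N)\<^sup>2)"
      proof (intro add_mono)
        have N: "0 \<le> ?N" by simp
        have N2: "?N\<^sup>2 \<le> (1 + ?N)\<^sup>2" by (intro power_mono) auto
        have N1: "?N \<le> (1 + ?N)\<^sup>2" using N by (simp add: power2_eq_square algebra_simps add_nonneg_nonneg)
        have "4 * ?s / (tau * ?r) \<le> 4 * K / tau / ?r"
          using s tau_pos r by (simp add: divide_right_mono)
        then have "4 * ?s / (tau * ?r) \<le> e / 4" using elim(1) by linarith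
        then show "(5 * \<bar>?k\<bar> / tau\<^sup>2 + 4 * ?s / (tau * ?r)) * ?N\<^sup>2 \<le> (5 * \<bar>?k\<bar> / tau\<^sup>2 + e / 4) * (1 + ?N)\<^sup>2"
          using N2 e by (intro mult_mono add_left_mono) auto
        show "2 * \<bar>?k\<bar> * ?s * ?N \<le> 2 * \<bar>?k\<bar> * K * (1 + ?N)\<^sup>2"
          using s N1 K(1) by (intro mult_mono mult_left_mono) auto
        have "?q \<le> ?m2 * C * ?N\<^sup>2" using q by linarith
        also have "\<dots> \<le> ?m2 * C * (1 + ?N)\<^sup>2" using N2 C1 by (intro mult_left_mono) auto
        finally show "\<bar>?k\<bar> * ?q \<le> \<bar>?k\<bar> * (?m2 * C * (1 + ?N)\<^sup>2)" by (intro mult_left_mono) auto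
      qed
      also have "\<dots> = (\<bar>?k\<bar> * (D - 1) + e / 4) * (1 + ?N)\<^sup>2" by (simp add: D_def algebra_simps)
      also have "\<dots> \<le> (e / 4 + e / 4) * (1 + ?N)\<^sup>2"
      proof (intro mult_right_mono add_right_mono)
        have "\<bar>?k\<bar> * (D - 1) \<le> \<bar>?k\<bar> * D" by (intro mult_left_mono) auto
        also have "\<dots> \<le> e / (4 * D) * D" using k(2) D by (intro mult_right_mono) auto
        finally show "\<bar>?k\<bar> * (D - 1) \<le> e / 4" using D by simp
      qed simp
      finally have 1: "\<bar>L0 p y T ph \<omega> - L0 p y T phs \<omega> - (vdot ?m (nscore T \<omega>) ?h - ?q / 2)\<bar> \<le> e / 2 * (1 + ?N)\<^sup>2"
        by simp
      have "e / 2 * ?N\<^sup>2 \<le> e / 2 * (1 + ?N)\<^sup>2" using e by (intro mult_left_mono power_mono) auto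
      then have "\<bar>?q - qform ?m J ?h\<bar> \<le> e / 2 * (1 + ?N)\<^sup>2" using qd by linarith
      moreover have "e * (1 + ?N)\<^sup>2 = e / 2 * (1 + ?N)\<^sup>2 + e / 2 * (1 + ?N)\<^sup>2" by simp
      ultimately show "\<bar>L0 p y T ph \<omega> - L0 p y T phs \<omega> - (vdot ?m (nscore T \<omega>) ?h - qform ?m J ?h / 2)\<bar> \<le> e * (1 + ?N)\<^sup>2"
        using 1 by linarith
    qed
  qed
  ultimately have "evp M \<eta> (\<lambda>T \<omega>. \<forall>ph. vnorm ?m (vminus ph phs) \<le> \<delta> \<longrightarrow>
      \<bar>L0 p y T ph \<omega> - L0 p y T phs \<omega> - (vdot ?m (nscore T \<omega>) (\<lambda>i. sqrt (real T) * (ph i - phs i))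
        - qform ?m J (\<lambda>i. sqrt (real T) * (ph i - phs i)) / 2)\<bar>
      \<le> e * (1 + vnorm ?m (\<lambda>i. sqrt (real T) * (ph i - phs i)))\<^sup>2)"
    by (rule evp_mono)
  then show ?thesis using \<delta> by blast
qed

end

section \<open>Suprema of weakly convergent processes\<close>

text \<open>Taking suprema is 1-Lipschitz for the uniform distance, so composing with a bounded
  continuous h stays admissible. Coordinate 0 carries the real value.\<close>

lemma bc_functional_sup:
  fixes h :: "real \<Rightarrow> real"
  assumes A: "A \<noteq> {}" and h: "bounded (range h)" "continuous_on UNIV h"
  shows "bc_functional 1 A (\<lambda>f. h (SUP a\<in>A. f a 0))"
proof -
  obtain C where C: "\<And>x. \<bar>h x\<bar> \<le> C" using h(1) by (auto simp: bounded_iff)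
  have le: "\<bar>f a 0 - g a 0\<bar> \<le> sup_dist 1 A f g" if "bnd_fun 1 A f" "bnd_fun 1 A g" "a \<in> A" for f g a
    using component_le_vnorm[of 0 1 "vminus (f a) (g a)"] sup_dist_upper[OF that] by (simp add: vminus_def)
  have bdd: "bdd_above ((\<lambda>a. f a 0) ` A)" if f: "bnd_fun 1 A f" for f
  proof -
    obtain K where K: "\<forall>a\<in>A. vnorm 1 (f a) \<le> K" using bnd_fun_bound[OF f] by blast
    show ?thesis
    proof (rule bdd_aboveI2)
      fix a assume "a \<in> A"
      then show "f a 0 \<le> K" using K component_le_vnorm[of 0 1 "f a"] by fastforce
    qed
  qed
  have sup_le: "(SUP a\<in>A. f a 0) \<le> (SUP a\<in>A. g a 0) + sup_dist 1 A f g" if f: "bnd_fun 1 A f" and g: "bnd_fun 1 A g" for f g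
  proof (rule cSUP_least[OF A])
    fix a assume a: "a \<in> A"
    show "f a 0 \<le> (SUP a\<in>A. g a 0) + sup_dist 1 A f g"
      using le[OF f g a] cSUP_upper[OF a bdd[OF g]] by linarith
  qed
  show ?thesis
  proof (rule bc_functionalI[where C=C])
    fix f g :: "'a \<Rightarrow> vec" assume "\<And>a. a \<in> A \<Longrightarrow> f a = g a"
    then have "(SUP a\<in>A. f a 0) = (SUP a\<in>A. g a 0)" by (intro SUP_cong) auto
    then show "h (SUP a\<in>A. f a 0) = h (SUP a\<in>A. g a 0)" by (rule arg_cong)
  next
    fix f and e :: real assume f: "bnd_fun 1 A f" and e: "0 < e"
    have "continuous (at (SUP a\<in>A. f a 0)) h" using h(2) by (simp add: continuous_on_eq_continuous_at)
    then obtain d where d: "0 < d" "\<And>x. dist x (SUP a\<in>A. f a 0) < d \<Longrightarrow> dist (h x) (h (SUP a\<in>A. f a 0)) < e"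
      using e unfolding continuous_at_eps_delta by blast
    show "\<exists>d>0. \<forall>g. bnd_fun 1 A g \<and> sup_dist 1 A f g < d \<longrightarrow> \<bar>h (SUP a\<in>A. f a 0) - h (SUP a\<in>A. g a 0)\<bar> < e"
    proof (intro exI[of _ d] conjI d(1) allI impI)
      fix g assume g: "bnd_fun 1 A g \<and> sup_dist 1 A f g < d"
      have "dist (SUP a\<in>A. g a 0) (SUP a\<in>A. f a 0) < d"
        using sup_le[OF f conjunct1[OF g]] sup_le[OF conjunct1[OF g] f] g sup_dist_commute[of 1 A f g]
        by (simp add: dist_real_def abs_less_iff)
      from d(2)[OF this] show "\<bar>h (SUP a\<in>A. f a 0) - h (SUP a\<in>A. g a 0)\<bar> < e"
        by (simp add: dist_real_def abs_minus_commute)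
    qed
  qed (rule C)
qed

lemma weak_conv_imp_conv_distr_sup:
  assumes A: "A \<noteq> {}" and w: "weak_conv_proc 1 A M (\<lambda>T a \<omega>. vec1 (X T a \<omega>)) N (\<lambda>a \<eta>. vec1 (Y a \<eta>))"
  shows "conv_distr M (\<lambda>T \<omega>. SUP a\<in>A. X T a \<omega>) N (\<lambda>\<eta>. SUP a\<in>A. Y a \<eta>)"
  unfolding conv_distr_def
proof (intro allI impI)
  fix h :: "real \<Rightarrow> real" assume "bounded (range h) \<and> continuous_on UNIV h"
  then have "bc_functional 1 A (\<lambda>f. h (SUP a\<in>A. f a 0))" using bc_functional_sup[OF A] by blast
  from weak_convD[OF w this]
  show "(\<lambda>T. outer_exp M (\<lambda>\<omega>. h (SUP a\<in>A. X T a \<omega>))) \<longlonglongrightarrow> integral\<^sup>L N (\<lambda>\<eta>. h (SUP a\<in>A. Y a \<eta>))"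
    by (simp add: vec1_def)
qed

text \<open>Without indices any two arguments agree on the index set, so a test functional is
  constant.\<close>

lemma weak_conv_empty_index:
  fixes X :: "nat \<Rightarrow> 'a \<Rightarrow> 'w \<Rightarrow> vec"
  assumes "prob_space M" "prob_space N" shows "weak_conv_proc k {} M X N Xl"
  unfolding weak_conv_proc_def
proof (intro allI impI)
  interpret M: prob_space M by fact
  interpret N: prob_space N by fact
  fix h :: "('a \<Rightarrow> vec) \<Rightarrow> real" assume "bc_functional k {} h"
  then have c: "h f = h (\<lambda>_. zvec)" for f by (rule bc_functional_cong) simp
  have "outer_exp M (\<lambda>\<omega>. h (\<lambda>a. X T a \<omega>)) = h (\<lambda>_. zvec)" for T
    unfolding c[of "\<lambda>a. X T a _"] by (rule M.outer_exp_const)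
  moreover have "integral\<^sup>L N (\<lambda>\<eta>. h (\<lambda>a. Xl a \<eta>)) = h (\<lambda>_. zvec)"
    unfolding c[of "\<lambda>a. Xl a _"] by (simp add: N.prob_space)
  ultimately show "(\<lambda>T. outer_exp M (\<lambda>\<omega>. h (\<lambda>a. X T a \<omega>))) \<longlonglongrightarrow> integral\<^sup>L N (\<lambda>\<eta>. h (\<lambda>a. Xl a \<eta>))"
    by simp
qed

lemma conv_distr_const:
  assumes "prob_space M" "prob_space N" shows "conv_distr M (\<lambda>T \<omega>. c) N (\<lambda>\<eta>. c)"
proof -
  interpret M: prob_space M by fact
  interpret N: prob_space N by fact
  show ?thesis by (simp add: conv_distr_def M.outer_exp_const N.prob_space)
qed

lemma continuous_imp_bnd_fun:
  assumes "compact A" "continuous_on A f" "\<And>a. a \<in> A \<Longrightarrow> f a \<in> Rn k"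
  shows "bnd_fun k A f"
proof -
  have "continuous_on A (\<lambda>a. vnorm k (f a))"
    by (rule continuous_on_compose2[OF continuous_on_vnorm[of UNIV] assms(2)]) simp
  then have "bounded ((\<lambda>a. vnorm k (f a)) ` A)"
    by (intro compact_imp_bounded compact_continuous_image assms(1))
  then obtain C where "\<forall>a\<in>A. \<bar>vnorm k (f a)\<bar> \<le> C" by (auto simp: bounded_iff)
  then show ?thesis using assms(3) by (auto simp: bnd_fun_def)
qed

section \<open>The limit law of the likelihood ratio process\<close>

theorem theorem1:
  fixes M :: "'w measure" and N :: "'v measure"
    and y eps :: "int \<Rightarrow> 'w \<Rightarrow> real"
    and p q1 q2 r na k :: nat
    and P :: mat
    and Phit A B Phi Lam Lamv :: "vec set"
    and phits betas phis :: vec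
    and wt :: "int \<Rightarrow> vec \<Rightarrow> vec \<Rightarrow> vec \<Rightarrow> vec \<Rightarrow> 'w \<Rightarrow> real"
    and nullhat :: "nat \<Rightarrow> 'w \<Rightarrow> vec"
    and bhat phhat vphhat :: "nat \<Rightarrow> vec \<Rightarrow> 'w \<Rightarrow> vec"
    and pimap piinv :: "vec \<Rightarrow> vec \<times> vec \<Rightarrow> vec \<times> vec"
    and theta :: "vec \<Rightarrow> vec \<Rightarrow> vec \<Rightarrow> vec \<Rightarrow> vec"
    and s :: "nat \<Rightarrow> vec \<Rightarrow> 'w \<Rightarrow> vec"
    and Slim :: "vec \<Rightarrow> 'v \<Rightarrow> vec"
    and Info :: "vec \<Rightarrow> mat"
  defines "Pi_set \<equiv> (\<lambda>a. pimap a ` (Phi \<times> Phi))"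
    and "Lpi \<equiv> (\<lambda>T a b u v \<omega>. Lmix p q1 P y wt T a b (fst (piinv a (u, v))) (snd (piinv a (u, v))) \<omega>)"
    and "ST \<equiv> Ssum s"
    and "qth \<equiv> q1 + q2"
    and "qv \<equiv> r - (q1 + q2)"
  assumes
    \<comment> \<open>setting\<close>
    setting: "p \<ge> 1" "q2 \<ge> 1" "q1 + q2 = p + 2" "perm_matrix (p + 2) P"
    \<comment> \<open>Assumption 1(i): stationary linear Gaussian AR(p)\<close>
    and A1i: "prob_space M" "\<And>t. y t \<in> borel_measurable M"
      "\<And>t \<omega>. \<omega> \<in> space M \<Longrightarrow>
          y t \<omega> = phits 0 + (\<Sum>i=1..p. phits i * y (t - int i) \<omega>) + sqrt (phits (p + 1)) * eps t \<omega>"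
      "prob_space.indep_vars M (\<lambda>_. borel) eps UNIV"
      "\<And>t. distributed M lborel (eps t) (\<lambda>x. ennreal (std_normal_density x))"
      "\<And>t. prob_space.indep_set M (sets (gen_sigma M {eps t})) (sets (gen_sigma M {y j | j. j < t}))"
      "strictly_stationary M y"
      "compact Phit" "Phit \<subseteq> Rn (p + 2) \<inter> {ph. ar_stable p ph \<and> 0 < ph (p + 1)}"
      "phits \<in> rint (p + 2) Phit"
    \<comment> \<open>Assumption 1(ii)\<close>
    and A1ii: "compact A" "A \<subseteq> Rn na" "compact B" "B \<subseteq> Rn q1" "compact Phi" "Phi \<subseteq> Rn q2"
      "\<And>b ph. b \<in> Rn q1 \<Longrightarrow> ph \<in> Rn q2 \<Longrightarrow> (b \<in> B \<and> ph \<in> Phi \<longleftrightarrow> Pinv_join p q1 P b ph \<in> Phit)"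
      "betas \<in> Rn q1" "phis \<in> Rn q2" "vjoin q1 betas phis = mvmul (p + 2) P phits"
    \<comment> \<open>Assumption 1(iii)\<close>
    and A1iii: "\<And>t a b ph vph. a \<in> A \<Longrightarrow> b \<in> B \<Longrightarrow> ph \<in> Phi \<Longrightarrow> vph \<in> Phi \<Longrightarrow>
          wt t a b ph vph \<in> borel_measurable (gen_sigma M {y (t - int i) | i. 1 \<le> i \<and> i \<le> p})
          \<and> (\<forall>\<omega>\<in>space M. 0 < wt t a b ph vph \<omega> \<and> wt t a b ph vph \<omega> < 1)"
    \<comment> \<open>null estimator\<close>
    and Null: "\<And>T \<omega>. \<omega> \<in> space M \<Longrightarrow> nullhat T \<omega> \<in> Phit"
      "o_p M (\<lambda>T \<omega>. \<bar>L0 p y T (nullhat T \<omega>) \<omega> - supL0 p y Phit T \<omega>\<bar>)"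
      "o_p M (\<lambda>T \<omega>. vnorm (p + 2) (vminus (nullhat T \<omega>) phits))"
    \<comment> \<open>Assumption 2\<close>
    and A2: "\<And>T a \<omega>. a \<in> A \<Longrightarrow> \<omega> \<in> space M \<Longrightarrow>
          bhat T a \<omega> \<in> B \<and> phhat T a \<omega> \<in> Phi \<and> vphhat T a \<omega> \<in> Phi"
      "o_p_unif M A (\<lambda>T a \<omega>. \<bar>Lmix p q1 P y wt T a (bhat T a \<omega>) (phhat T a \<omega>) (vphhat T a \<omega>) \<omega>
                             - supLmix p q1 P y wt B Phi T a \<omega>\<bar>)"
      "o_p_unif M A (\<lambda>T a \<omega>. tnorm q1 q2 (vminus (bhat T a \<omega>) betas)
                             (vminus (phhat T a \<omega>) phis) (vminus (vphhat T a \<omega>) phis))"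
    \<comment> \<open>Assumption 3\<close>
    and A3: "\<And>a. a \<in> A \<Longrightarrow> homeomorphism (Phi \<times> Phi) (Pi_set a) (pimap a) (piinv a)"
      "\<And>a. a \<in> A \<Longrightarrow> Pi_set a \<subseteq> Rn q2 \<times> Rn q2"
      "\<And>a. a \<in> A \<Longrightarrow> pimap a ` {(ph, ph) | ph. ph \<in> Phi} = Phi \<times> {zvec}"
      "\<And>a. a \<in> A \<Longrightarrow> pimap a (phis, phis) = (phis, zvec)"
      "o_p_unif M A (\<lambda>T a \<omega>. tnorm q1 q2 (vminus (bhat T a \<omega>) betas)
            (vminus (fst (pimap a (phhat T a \<omega>, vphhat T a \<omega>))) phis)
            (snd (pimap a (phhat T a \<omega>, vphhat T a \<omega>))))"
    \<comment> \<open>Assumption 4\<close>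
    and A4: "k \<ge> 2"
      "\<And>t a \<omega>. a \<in> A \<Longrightarrow> \<omega> \<in> space M \<Longrightarrow>
          Ck_on (q1 + 2 * q2) k (rint (q1 + 2 * q2) (pack3 q1 q2 ` (B \<times> Phi \<times> Phi)))
            (\<lambda>x. wt t a (fst (unpack3 q1 q2 x)) (fst (snd (unpack3 q1 q2 x))) (snd (snd (unpack3 q1 q2 x))) \<omega>)"
      "\<And>a i. a \<in> A \<Longrightarrow> i < q2 \<Longrightarrow>
          Ck_on (2 * q2) k (rint (2 * q2) (pack2 q2 ` Pi_set a)) (\<lambda>x. fst (piinv a (unpack2 q2 x)) i)
        \<and> Ck_on (2 * q2) k (rint (2 * q2) (pack2 q2 ` Pi_set a)) (\<lambda>x. snd (piinv a (unpack2 q2 x)) i)"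
    \<comment> \<open>Assumption 5(i)\<close>
    and A5i: "\<And>a b u v. a \<in> A \<Longrightarrow> b \<in> B \<Longrightarrow> (u, v) \<in> Pi_set a \<Longrightarrow> theta a b u v \<in> Rn r"
      "\<And>a. a \<in> A \<Longrightarrow> theta a betas phis zvec = zvec"
      "\<And>e. e > 0 \<Longrightarrow> \<exists>d>0. \<forall>a\<in>A. \<forall>b u v. b \<in> B \<and> (u, v) \<in> Pi_set a \<and>
             tnorm q1 q2 (vminus b betas) (vminus u phis) v \<ge> e \<longrightarrow> vnorm r (theta a b u v) \<ge> d"
    \<comment> \<open>Assumption 5(ii)\<close>
    and A5ii: "\<And>t a \<omega>. s t a \<omega> \<in> Rn r"
      "\<And>T a i. a \<in> A \<Longrightarrow> (\<lambda>\<omega>. ST T a \<omega> i) \<in> borel_measurable (gen_sigma M {y t | t. t \<le> int T})"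
      "\<And>T \<omega>. \<omega> \<in> space M \<Longrightarrow> continuous_on A (\<lambda>a. ST T a \<omega>)"
      "weak_conv_proc r A M (\<lambda>T a \<omega>. vscale (1 / sqrt (real T)) (ST T a \<omega>)) N Slim"
      "prob_space N" "\<And>a \<eta>. Slim a \<eta> \<in> Rn r" "gaussian_process r A N Slim"
      "AE \<eta> in N. continuous_on A (\<lambda>a. Slim a \<eta>)"
      "\<And>a i j. a \<in> A \<Longrightarrow> i < r \<Longrightarrow> j < r \<Longrightarrow>
          integrable N (\<lambda>\<eta>. Slim a \<eta> i * Slim a \<eta> j) \<and> integral\<^sup>L N (\<lambda>\<eta>. Slim a \<eta> i * Slim a \<eta> j) = Info a i j"
      "\<And>t a i j. t \<ge> 1 \<Longrightarrow> a \<in> A \<Longrightarrow> i < r \<Longrightarrow> j < r \<Longrightarrow>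
          integrable M (\<lambda>\<omega>. s t a \<omega> i * s t a \<omega> j) \<and> integral\<^sup>L M (\<lambda>\<omega>. s t a \<omega> i * s t a \<omega> j) = Info a i j"
    \<comment> \<open>Assumption 5(iii)\<close>
    and A5iii: "\<And>a. a \<in> A \<Longrightarrow> symmetric_mat r (Info a)"
      "\<And>i j. continuous_on A (\<lambda>a. Info a i j)"
      "\<exists>c>0. \<forall>a\<in>A. c \<le> lambda_min r (Info a)"
      "\<exists>C. \<forall>a\<in>A. lambda_max r (Info a) \<le> C"
    \<comment> \<open>Assumption 5(iv), with R_T the remainder of the quadratic expansion\<close>
    and A5iv: "\<And>\<gamma> e. (\<forall>T. 0 < \<gamma> T) \<Longrightarrow> \<gamma> \<longlonglongrightarrow> 0 \<Longrightarrow> e > 0 \<Longrightarrow>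
          (\<lambda>T. outer_prob M {\<omega>\<in>space M. \<exists>a\<in>A. \<exists>b u v. b \<in> B \<and> (u, v) \<in> Pi_set a \<and>
                 tnorm q1 q2 (vminus b betas) (vminus u phis) v \<le> \<gamma> T \<and>
             (let th = vscale (sqrt (real T)) (theta a b u v);
                  R = Lpi T a b u v \<omega> - Lpi T a betas phis zvec \<omega>
                      - (vdot r (vscale (1 / sqrt (real T)) (ST T a \<omega>)) th - qform r (Info a) th / 2)
              in e < \<bar>R\<bar> / (1 + vnorm r th)\<^sup>2)}) \<longlonglongrightarrow> 0"
    \<comment> \<open>Assumption 6\<close>
    and A6: "is_cone r Lam" "loc_unif_eq r (\<lambda>a. (\<lambda>(b, u, v). theta a b u v) ` (B \<times> Pi_set a)) A Lam"
    \<comment> \<open>Assumption 7\<close>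
    and A7: "q1 + q2 \<le> r" "is_cone qv Lamv" "Lam = {vjoin qth u v | u v. u \<in> Rn qth \<and> v \<in> Lamv}"
    \<comment> \<open>Assumption 8\<close>
    and A8: "\<And>T a \<omega> i. a \<in> A \<Longrightarrow> \<omega> \<in> space M \<Longrightarrow> i < qth \<Longrightarrow>
          ST T a \<omega> i = (\<Sum>t\<in>{1..T}. grad (p + 2) (\<lambda>ph. dens p y (int t) ph \<omega>) phits i
                                     / dens p y (int t) phits \<omega>)"
  shows
    "weak_conv_proc 1 A M (\<lambda>T a \<omega>. vec1 (LR p q1 P y wt B Phi Phit T a \<omega>))
        N (\<lambda>a \<eta>. vec1 (lr_limit r qth (Info a) Lamv (Slim a \<eta>)))
     \<and> conv_distr M (\<lambda>T \<omega>. LRsup p q1 P y wt A B Phi Phit T \<omega>)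
        N (\<lambda>\<eta>. SUP a\<in>A. lr_limit r qth (Info a) Lamv (Slim a \<eta>))"
proof (cases "A = {}")
  \<comment> \<open>For empty \<open>A\<close> the supremum over \<open>A\<close> is the same fixed
    real in the sample and in the limit.\<close>
  case True
  show ?thesis
    using weak_conv_empty_index[OF A1i(1) A5ii(5)] conv_distr_const[OF A1i(1) A5ii(5)]
    by (simp add: True LRsup_def)
next
  case A: False
  let ?m = "p + 2"
  have qth: "qth = ?m" using setting(3) by (simp add: qth_def)
  have mr: "?m \<le> r" using A7(1) setting(3) by simp
  have qv: "qv = r - ?m" using setting(3) by (simp add: qv_def)
  interpret M: prob_space M by (rule A1i(1))
  interpret N: prob_space N by (rule A5ii(5))
  have Mf: "finite_measure M" by (rule M.finite_measure_axioms)
  have phits: "phits \<in> Phit" using A1i(10) interior_of_subset unfolding rint_def by fast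
  then have phitsR: "phits \<in> Rn ?m" and phits_pos: "0 < phits (p + 1)" using A1i(9) by auto
  interpret AR: gaussian_ar M y eps p phits
    by unfold_locales (rule A1i(2), rule A1i(3), assumption, rule A1i(5), rule A1i(6), rule phits_pos)
  have Pz: "Pinv_join p q1 P (vtake q1 (mvmul ?m P x)) (vtake q2 (vdrop q1 (mvmul ?m P x))) = x" if "x \<in> Rn ?m" for x
  proof -
    have "mvmul ?m P x \<in> Rn (q1 + q2)" unfolding setting(3) by simp
    from vjoin_vtake_vdrop[OF this] show ?thesis
      using perm_matrix_minv_mult(1)[OF setting(4) that] by (simp add: Pinv_join_def)
  qed
  have split_R: "vtake q1 x \<in> Rn q1" "vtake q2 (vdrop q1 x) \<in> Rn q2" for x by (simp_all add: vtake_def Rn_def)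
  have P0: "Pinv_join p q1 P betas phis = phits"
    unfolding Pinv_join_def A1ii(10) by (rule perm_matrix_minv_mult(1)[OF setting(4) phitsR])
  have B0: "betas \<in> B" "phis \<in> Phi" using A1ii(7)[OF A1ii(8,9)] P0 phits by auto
  have Pin: "Pinv_join p q1 P b ph \<in> Phit" if "b \<in> B" "ph \<in> Phi" for b ph
    using A1ii(7)[of b ph] that A1ii(4,6) by blast

  \<comment> \<open>Uniform coercivity and the null model inside the mixture\<close>
  obtain a0 where a0: "a0 \<in> A" using A by blast
  obtain c where c: "0 < c" "\<And>a x. a \<in> A \<Longrightarrow> x \<in> Rn r \<Longrightarrow> c * (vnorm r x)\<^sup>2 \<le> qform r (Info a) x"
  proof -
    obtain c where c: "0 < c" "\<forall>a\<in>A. c \<le> lambda_min r (Info a)" using A5iii(3) by blast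
    have "c * (vnorm r x)\<^sup>2 \<le> qform r (Info a) x" if "a \<in> A" "x \<in> Rn r" for a x
      using lambda_min_le_rayleigh[OF A5iii(1)[OF that(1)] that(2)] c(2) that(1)
        mult_right_mono[of c "lambda_min r (Info a)" "(vnorm r x)\<^sup>2"] by fastforce
    then show ?thesis using that c(1) by blast
  qed
  have pd: "posdef r (Info a)" if a: "a \<in> A" for a
    unfolding posdef_def
  proof (intro conjI ballI impI)
    show "symmetric_mat r (Info a)" by (rule A5iii(1)[OF a])
    fix x assume x: "x \<in> Rn r" "x \<noteq> zvec"
    then have "vnorm r x \<noteq> 0" using vnorm_eq_0 by blast
    then have "0 < c * (vnorm r x)\<^sup>2" using c(1) by simp
    then show "0 < qform r (Info a) x" using c(2)[OF a x(1)] by linarith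
  qed

  have Pi0: "(phis, zvec) \<in> Pi_set a" "piinv a (phis, zvec) = (phis, phis)" if a: "a \<in> A" for a
  proof -
    have eq: "pimap a (phis, phis) = (phis, zvec)" by (rule A3(4)[OF a])
    show "(phis, zvec) \<in> Pi_set a" unfolding Pi_set_def using B0(2) eq by force
    have "piinv a (pimap a (phis, phis)) = (phis, phis)"
      using homeomorphism_apply1[OF A3(1)[OF a], of "(phis, phis)"] B0(2) by simp
    then show "piinv a (phis, zvec) = (phis, phis)" by (simp add: eq)
  qed
  \<comment> \<open>With equal regimes the weight cancels, so the null model is the diagonal of the
    mixture. Through this identity the mixture expansion carries information on the null
    likelihood.\<close>
  have Lmix_diag: "Lmix p q1 P y wt T a b f f \<omega> = L0 p y T (Pinv_join p q1 P b f) \<omega>" for T a b f \<omega>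
    by (simp add: Lmix_def L0_def algebra_simps)
  have Lpi_pimap: "Lpi T a b (fst (pimap a (f, g))) (snd (pimap a (f, g))) \<omega> = Lmix p q1 P y wt T a b f g \<omega>"
    if "a \<in> A" "f \<in> Phi" "g \<in> Phi" for T a b f g \<omega>
    using homeomorphism_apply1[OF A3(1)[OF that(1)], of "(f, g)"] that by (simp add: Lpi_def)
  have Lpi0: "Lpi T a betas phis zvec \<omega> = L0 p y T phits \<omega>" if "a \<in> A" for T a \<omega>
    using Pi0(2)[OF that] by (simp add: Lpi_def Lmix_diag P0)

  obtain rho where rho: "0 < rho" "\<And>a. a \<in> A \<Longrightarrow>
      (\<lambda>(b, u, v). theta a b u v) ` (B \<times> Pi_set a) \<inter> cube r rho = Lam \<inter> cube r rho"
    using A6(2) unfolding loc_unif_eq_def by blast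
  have LamR: "Lam \<subseteq> Rn r" and Lam_cone: "\<And>x b. x \<in> Lam \<Longrightarrow> 0 < b \<Longrightarrow> (\<lambda>i. b * x i) \<in> Lam"
    using A6(1) by (auto simp: is_cone_def vscale_def)
  \<comment> \<open>Being a cone does not by itself include the origin; it is supplied by the true
    parameter, whose image under \<open>theta\<close> is 0 and lies in the cube.\<close>
  have Lam0: "zvec \<in> Lam"
  proof -
    have "zvec \<in> (\<lambda>(b, u, v). theta a0 b u v) ` (B \<times> Pi_set a0)"
      using A5i(2)[OF a0] B0(1) Pi0(1)[OF a0] by force
    moreover have "zvec \<in> cube r rho" using rho(1) by (simp add: cube_def zvec_def Rn_def)
    ultimately show ?thesis using rho(2)[OF a0] by blast
  qed
  have Lamv: "Lamv \<subseteq> Rn (r - ?m)" "zvec \<in> Lamv"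
  proof -
    show "Lamv \<subseteq> Rn (r - ?m)" using A7(2) unfolding is_cone_def qv by blast
    obtain u v where uv: "zvec = vjoin qth u v" "v \<in> Lamv" using Lam0 A7(3) by blast
    have "v i = 0" for i using fun_cong[OF uv(1), of "i + qth"] by (simp add: vjoin_def zvec_def)
    then have "v = zvec" by (simp add: zvec_def fun_eq_iff)
    then show "zvec \<in> Lamv" using uv(2) by simp
  qed
  have Lamv_ne: "Lamv \<noteq> {}" using Lamv(2) by blast

  \<comment> \<open>The normalised score and its autoregressive block\<close>
  define Sn where "Sn T a \<omega> = vscale (1 / sqrt (real T)) (ST T a \<omega>)" for T a \<omega>
  have SnR: "Sn T a \<omega> \<in> Rn r" for T a \<omega>
    using A5ii(1) by (simp add: Sn_def ST_def Ssum_def vscale_def Rn_def)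
  have Sn_bnd: "bnd_fun r A (\<lambda>a. Sn T a \<omega>)" if w: "\<omega> \<in> space M" for T \<omega>
  proof (rule continuous_imp_bnd_fun[OF A1ii(1) _ SnR])
    have "continuous_on A (\<lambda>a. ST T a \<omega> i)" for i
      by (rule continuous_on_product_then_coordinatewise[OF A5ii(3)[OF w]])
    then show "continuous_on A (\<lambda>a. Sn T a \<omega>)"
      unfolding Sn_def vscale_def by (intro continuous_on_coordinatewise_then_product continuous_intros)
  qed
  have Sn_conv: "weak_conv_proc r A M Sn N Slim" using A5ii(4) unfolding Sn_def .
  have Slim_bnd: "AE \<eta> in N. bnd_fun r A (\<lambda>a. Slim a \<eta>)"
    using A5ii(8) by eventually_elim (rule continuous_imp_bnd_fun[OF A1ii(1) _ A5ii(6)])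
  have tight: "\<exists>K\<ge>0. evp M \<eta> (\<lambda>T \<omega>. \<forall>a\<in>A. vnorm r (Sn T a \<omega>) \<le> K)" if e: "0 < \<eta>" for \<eta>
    by (rule weak_conv_tight[OF A1i(1) A5ii(5) Sn_conv Sn_bnd Slim_bnd e A])

  have ST_score: "ST T a \<omega> i = (\<Sum>t\<in>{1..T}. AR.score (int t) \<omega> i)"
    if "a \<in> A" "\<omega> \<in> space M" "i < ?m" for T a \<omega> i
    using A8[of a \<omega> i T] that AR.grad_dens_eq_score[OF that(2,3)] by (simp add: qth)
  \<comment> \<open>The hypothesis identifies partial sums; differencing consecutive ones recovers
    the single summands, to which the covariance hypothesis refers.\<close>
  have s_score: "s t a \<omega> i = AR.score (int t) \<omega> i"
    if "a \<in> A" "\<omega> \<in> space M" "i < ?m" and t1: "1 \<le> t" for t a \<omega> i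
  proof -
    obtain n where n: "t = Suc n" using t1 by (cases t) auto
    have "ST (Suc n) a \<omega> i = ST n a \<omega> i + s (Suc n) a \<omega> i" by (simp add: ST_def Ssum_def)
    then show ?thesis unfolding n ST_score[OF that(1-3)] by simp
  qed
  have nscore: "Sn T a \<omega> i = AR.nscore T \<omega> i" if "a \<in> A" "\<omega> \<in> space M" "i < ?m" for T a \<omega> i
    using ST_score[OF that] by (simp add: Sn_def vscale_def AR.nscore_def)
  have vdot_nscore: "vdot r (Sn T a \<omega>) h = vdot ?m (AR.nscore T \<omega>) h"
    if "a \<in> A" "\<omega> \<in> space M" "h \<in> Rn ?m" for T a \<omega> h
    using vdot_Rn_left[OF mr that(3), of "Sn T a \<omega>"] nscore[OF that(1,2)] by (simp add: vdot_def)
  have tight_nscore: "\<exists>K\<ge>0. evp M \<eta> (\<lambda>T \<omega>. vnorm ?m (AR.nscore T \<omega>) \<le> K)" if e: "0 < \<eta>" for \<eta>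
  proof -
    obtain K where K: "0 \<le> K" "evp M \<eta> (\<lambda>T \<omega>. \<forall>a\<in>A. vnorm r (Sn T a \<omega>) \<le> K)" using tight[OF e] by blast
    have "evp M \<eta> (\<lambda>T \<omega>. vnorm ?m (AR.nscore T \<omega>) \<le> K)"
    proof (rule evp_mono'[OF K(2)])
      fix T \<omega> assume w: "\<omega> \<in> space M" and "\<forall>a\<in>A. vnorm r (Sn T a \<omega>) \<le> K"
      then have "vnorm r (Sn T a0 \<omega>) \<le> K" using a0 by blast
      moreover have "vnorm ?m (AR.nscore T \<omega>) = vnorm ?m (Sn T a0 \<omega>)"
        by (rule vnorm_cong) (simp add: nscore[OF a0 w])
      ultimately show "vnorm ?m (AR.nscore T \<omega>) \<le> K" using vnorm_mono[OF mr, of "Sn T a0 \<omega>"] by linarith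
    qed
    then show ?thesis using K(1) by blast
  qed
  have score_cov: "integrable M (\<lambda>\<omega>. AR.score (int t) \<omega> i * AR.score (int t) \<omega> j)
      \<and> (\<integral>\<omega>. AR.score (int t) \<omega> i * AR.score (int t) \<omega> j \<partial>M) = Info a i j"
    if "a \<in> A" "1 \<le> t" "i < ?m" "j < ?m" for t a i j
  proof -
    have *: "AR.score (int t) \<omega> i * AR.score (int t) \<omega> j = s t a \<omega> i * s t a \<omega> j" if "\<omega> \<in> space M" for \<omega>
      using s_score[OF \<open>a \<in> A\<close> that _ \<open>1 \<le> t\<close>] \<open>i < ?m\<close> \<open>j < ?m\<close> by simp
    have ir: "i < r" "j < r" using that mr by auto
    have "integrable M (\<lambda>\<omega>. AR.score (int t) \<omega> i * AR.score (int t) \<omega> j) \<longleftrightarrow> integrable M (\<lambda>\<omega>. s t a \<omega> i * s t a \<omega> j)"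
      by (rule Bochner_Integration.integrable_cong[OF refl *])
    moreover have "(\<integral>\<omega>. AR.score (int t) \<omega> i * AR.score (int t) \<omega> j \<partial>M) = (\<integral>\<omega>. s t a \<omega> i * s t a \<omega> j \<partial>M)"
      by (rule Bochner_Integration.integral_cong[OF refl *])
    ultimately show ?thesis using A5ii(10)[OF that(2,1) ir] by simp
  qed
  \<comment> \<open>The leading block is the covariance of the autoregressive score and hence the
    same for every a.\<close>
  have Info_eq: "Info a i j = Info a0 i j" if "a \<in> A" "i < ?m" "j < ?m" for a i j
    using score_cov[OF that(1) order_refl that(2,3)] score_cov[OF a0 order_refl that(2,3)] by simp
  have qform_Info: "qform r (Info a) h = qform ?m (Info a0) h" if "a \<in> A" "h \<in> Rn ?m" for a h
    unfolding qform_Rn[OF mr that(2)] using Info_eq[OF that(1)] by (simp add: qform_def)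
  have hess_tight: "\<exists>K\<ge>0. evp M \<eta> (\<lambda>T \<omega>. qform ?m (AR.hess T \<omega>) h \<le> K)" if e: "0 < \<eta>" for \<eta> h
  proof (rule AR.qform_hess_tight[OF _ _ e, where b="\<Sum>i\<le>p. \<bar>Info a0 i i\<bar>"])
    fix t i :: nat assume ti: "1 \<le> t" "i \<le> p"
    have im: "i < ?m" using ti by simp
    show "integrable M (\<lambda>\<omega>. AR.score (int t) \<omega> i * AR.score (int t) \<omega> i)"
      using score_cov[OF a0 ti(1) im im] by blast
    have "Info a0 i i \<le> (\<Sum>i\<le>p. \<bar>Info a0 i i\<bar>)"
      using member_le_sum[of i "{..p}" "\<lambda>i. \<bar>Info a0 i i\<bar>"] ti by auto
    then show "(\<integral>\<omega>. AR.score (int t) \<omega> i * AR.score (int t) \<omega> i \<partial>M) \<le> (\<Sum>i\<le>p. \<bar>Info a0 i i\<bar>)"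
      using score_cov[OF a0 ti(1) im im] by simp
  qed

  \<comment> \<open>The remainder condition along shrinking radii becomes one on a fixed radius, and
    the reference value is rewritten as the null likelihood at the truth.\<close>
  have mix_expansion: "\<exists>\<delta>>0. evp M \<eta> (\<lambda>T \<omega>. \<forall>a\<in>A. \<forall>x\<in>B \<times> Pi_set a.
      tnorm q1 q2 (vminus (fst x) betas) (vminus (fst (snd x)) phis) (snd (snd x)) \<le> \<delta> \<longrightarrow>
      \<bar>Lpi T a (fst x) (fst (snd x)) (snd (snd x)) \<omega> - L0 p y T phits \<omega>
         - quad r (Info a) (Sn T a \<omega>) (\<lambda>i. sqrt (real T) * theta a (fst x) (fst (snd x)) (snd (snd x)) i)\<bar>
      \<le> e * (1 + vnorm r (\<lambda>i. sqrt (real T) * theta a (fst x) (fst (snd x)) (snd (snd x)) i))\<^sup>2)"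
    if e: "0 < e" and \<eta>: "0 < \<eta>" for e \<eta> :: real
  proof -
    define Bad where "Bad \<delta> T = {\<omega>\<in>space M. \<exists>a\<in>A. \<exists>b u v. b \<in> B \<and> (u, v) \<in> Pi_set a \<and>
        tnorm q1 q2 (vminus b betas) (vminus u phis) v \<le> \<delta> \<and>
        (let th = vscale (sqrt (real T)) (theta a b u v);
             R = Lpi T a b u v \<omega> - Lpi T a betas phis zvec \<omega>
                 - (vdot r (vscale (1 / sqrt (real T)) (ST T a \<omega>)) th - qform r (Info a) th / 2)
         in e < \<bar>R\<bar> / (1 + vnorm r th)\<^sup>2)}" for \<delta> and T :: nat
    have "\<exists>\<delta>>0. \<forall>\<^sub>F T in sequentially. outer_prob M (Bad \<delta> T) < \<eta>"
    proof (rule null_sequences_imp_fixed_radius[OF _ \<eta>])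
      fix \<gamma> :: "nat \<Rightarrow> real" assume "\<And>T. 0 < \<gamma> T" "\<gamma> \<longlonglongrightarrow> 0"
      then show "(\<lambda>T. outer_prob M (Bad (\<gamma> T) T)) \<longlonglongrightarrow> 0"
        unfolding Bad_def using e by (intro A5iv) auto
    qed
    then obtain \<delta> where \<delta>: "0 < \<delta>" "\<forall>\<^sub>F T in sequentially. outer_prob M (Bad \<delta> T) < \<eta>" by blast
    have "evp M \<eta> (\<lambda>T \<omega>. \<omega> \<notin> Bad \<delta> T)"
      using \<delta>(2) unfolding evp_def outer_prob_less_iff by eventually_elim blast
    then have "evp M \<eta> (\<lambda>T \<omega>. \<forall>a\<in>A. \<forall>x\<in>B \<times> Pi_set a.
      tnorm q1 q2 (vminus (fst x) betas) (vminus (fst (snd x)) phis) (snd (snd x)) \<le> \<delta> \<longrightarrow>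
      \<bar>Lpi T a (fst x) (fst (snd x)) (snd (snd x)) \<omega> - L0 p y T phits \<omega>
         - quad r (Info a) (Sn T a \<omega>) (\<lambda>i. sqrt (real T) * theta a (fst x) (fst (snd x)) (snd (snd x)) i)\<bar>
      \<le> e * (1 + vnorm r (\<lambda>i. sqrt (real T) * theta a (fst x) (fst (snd x)) (snd (snd x)) i))\<^sup>2)"
    proof (rule evp_mono', intro ballI impI)
      fix T \<omega> a x assume w: "\<omega> \<in> space M" and nb: "\<omega> \<notin> Bad \<delta> T" and a: "a \<in> A" and x: "x \<in> B \<times> Pi_set a"
        and d: "tnorm q1 q2 (vminus (fst x) betas) (vminus (fst (snd x)) phis) (snd (snd x)) \<le> \<delta>"
      let ?th = "\<lambda>i. sqrt (real T) * theta a (fst x) (fst (snd x)) (snd (snd x)) i"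
      let ?R = "Lpi T a (fst x) (fst (snd x)) (snd (snd x)) \<omega> - L0 p y T phits \<omega> - quad r (Info a) (Sn T a \<omega>) ?th"
      have xB: "fst x \<in> B" "(fst (snd x), snd (snd x)) \<in> Pi_set a" using x by auto
      have "\<not> e < \<bar>?R\<bar> / (1 + vnorm r ?th)\<^sup>2"
        using nb w a xB d unfolding Bad_def mem_Collect_eq Let_def Lpi0[OF a, symmetric] quad_def Sn_def vscale_def by blast
      moreover have "0 < (1 + vnorm r ?th)\<^sup>2" by (intro zero_less_power add_pos_nonneg) auto
      ultimately show "\<bar>?R\<bar> \<le> e * (1 + vnorm r ?th)\<^sup>2" by (simp add: not_less divide_le_eq)
    qed
    then show ?thesis using \<delta>(1) by blast
  qed

  \<comment> \<open>Convergence of the Hessian of the null likelihood\<close>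
  obtain rho0 where rho0: "0 < rho0" "\<forall>z\<in>Rn ?m. (\<forall>i<?m. \<bar>z i - phits i\<bar> < rho0) \<longrightarrow> z \<in> Phit"
    using rint_contains_cube[OF A1i(10)] by blast

  \<comment> \<open>Both regimes receive the parameter \<open>phits\<close> + h / sqrt T. The
    resulting likelihood has the autoregressive expansion and, through \<open>theta\<close>, also
    that of the mixture. One index \<open>a0\<close> is enough because the leading block does not
    vary with a.\<close>
  have hess_limit: "whp M (\<lambda>T \<omega>. \<bar>qform ?m (AR.hess T \<omega>) h - qform ?m (Info a0) h\<bar> \<le> e)"
    if h: "h \<in> Rn ?m" and e: "0 < e" for h e
  proof -
    define ph where "ph T = (\<lambda>i. phits i + h i / sqrt (real T))" for T
    define b where "b T = vtake q1 (mvmul ?m P (ph T))" for T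
    define f where "f T = vtake q2 (vdrop q1 (mvmul ?m P (ph T)))" for T
    define uv where "uv T = pimap a0 (f T, f T)" for T
    \<comment> \<open>The default \<open>zvec\<close> concerns the times at which the path is
      outside \<open>Phit\<close>; it makes t a vector of \<open>Rn r\<close> for every T.\<close>
    define t where "t T = (if ph T \<in> Phit then (\<lambda>i. sqrt (real T) * theta a0 (b T) (fst (uv T)) (snd (uv T)) i) else zvec)" for T
    have phR: "ph T \<in> Rn ?m" for T using phitsR h by (simp add: ph_def Rn_def)
    have inP: "b T \<in> B" "f T \<in> Phi" if "ph T \<in> Phit" for T
      using A1ii(7)[OF split_R, of "mvmul ?m P (ph T)" "mvmul ?m P (ph T)"] Pz[OF phR] that
      unfolding b_def f_def by auto
    have L0ph: "Lpi T a0 (b T) (fst (uv T)) (snd (uv T)) \<omega> = L0 p y T (ph T) \<omega>" if "ph T \<in> Phit" for T \<omega>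
    proof -
      have "Lpi T a0 (b T) (fst (uv T)) (snd (uv T)) \<omega> = Lmix p q1 P y wt T a0 (b T) (f T) (f T) \<omega>"
        unfolding uv_def by (rule Lpi_pimap[OF a0 inP(2)[OF that] inP(2)[OF that]])
      also have "\<dots> = L0 p y T (Pinv_join p q1 P (b T) (f T)) \<omega>" by (rule Lmix_diag)
      also have "Pinv_join p q1 P (b T) (f T) = ph T" unfolding b_def f_def by (rule Pz[OF phR])
      finally show ?thesis .
    qed
    have uvP: "uv T \<in> Pi_set a0" if "ph T \<in> Phit" for T
      unfolding uv_def Pi_set_def using inP(2)[OF that] by blast
    have tR: "t T \<in> Rn r" for T
      unfolding t_def using A5i(1)[OF a0 inP(1), of T "fst (uv T)" "snd (uv T)"] uvP Rn_scale by auto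
    have phlim: "(\<lambda>T. ph T i) \<longlonglongrightarrow> phits i" for i
    proof -
      have "(\<lambda>T. h i / sqrt (real T)) \<longlonglongrightarrow> 0"
        by (intro tendsto_divide_0[OF tendsto_const] filterlim_at_top_imp_at_infinity
            filterlim_compose[OF sqrt_at_top filterlim_real_sequentially])
      from tendsto_add[OF tendsto_const[of "phits i"] this] show ?thesis by (simp add: ph_def)
    qed
    have ph_ev: "\<forall>\<^sub>F T in sequentially. ph T \<in> Phit"
    proof -
      have "\<forall>\<^sub>F T in sequentially. \<bar>ph T i - phits i\<bar> < rho0" for i
        using tendstoD[OF phlim rho0(1)] by (simp add: dist_real_def)
      then have "\<forall>\<^sub>F T in sequentially. \<forall>i\<in>{..<?m}. \<bar>ph T i - phits i\<bar> < rho0"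
        by (intro eventually_ball_finite) auto
      then show ?thesis by eventually_elim (use rho0(2) phR in auto)
    qed
    have Plim: "(\<lambda>T. mvmul ?m P (ph T) i) \<longlonglongrightarrow> mvmul ?m P phits i" for i
      unfolding mvmul_def by (cases "i < ?m") (auto intro!: tendsto_intros phlim)
    have blim: "(\<lambda>T. b T i) \<longlonglongrightarrow> betas i" for i
    proof (cases "i < q1")
      case True
      then have "mvmul ?m P phits i = betas i" using fun_cong[OF A1ii(10), of i] by (simp add: vjoin_def)
      then show ?thesis using Plim[of i] True by (simp add: b_def vtake_def)
    next
      case False
      then show ?thesis using A1ii(8) by (simp add: b_def vtake_def Rn_def)
    qed
    have flim: "(\<lambda>T. f T i) \<longlonglongrightarrow> phis i" for i
    proof (cases "i < q2")
      case True
      then have "mvmul ?m P phits (i + q1) = phis i" using fun_cong[OF A1ii(10), of "i + q1"] by (simp add: vjoin_def)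
      then show ?thesis using Plim[of "i + q1"] True by (simp add: f_def vtake_def vdrop_def)
    next
      case False
      then show ?thesis using A1ii(9) by (simp add: f_def vtake_def Rn_def)
    qed
    have uvlim: "uv \<longlonglongrightarrow> (phis, zvec)"
    proof -
      have "continuous_on (Phi \<times> Phi) (pimap a0)" using A3(1)[OF a0] by (simp add: homeomorphism_def)
      moreover have "(\<lambda>T. (f T, f T)) \<longlonglongrightarrow> (phis, phis)" by (intro tendsto_Pair tendsto_vec flim)
      moreover have "\<forall>\<^sub>F T in sequentially. (f T, f T) \<in> Phi \<times> Phi"
        using ph_ev by eventually_elim (use inP(2) in auto)
      ultimately have "(\<lambda>T. pimap a0 (f T, f T)) \<longlonglongrightarrow> pimap a0 (phis, phis)"
        using B0(2) by (intro continuous_on_tendsto_compose[where f="pimap a0"]) auto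
      then show ?thesis by (simp add: uv_def[abs_def] A3(4)[OF a0])
    qed
    \<comment> \<open>Continuity of the reparameterization at the diagonal point makes this distance
      tend to 0, so the path eventually enters the neighbourhood of the mixture expansion.\<close>
    let ?tn = "\<lambda>T. tnorm q1 q2 (vminus (b T) betas) (vminus (fst (uv T)) phis) (snd (uv T))"
    have tn: "?tn \<longlonglongrightarrow> 0"
    proof -
      have u: "(\<lambda>T. fst (uv T) i) \<longlonglongrightarrow> phis i" "(\<lambda>T. snd (uv T) i) \<longlonglongrightarrow> 0" for i
        using tendsto_coord[OF tendsto_fst[OF uvlim], of i] tendsto_coord[OF tendsto_snd[OF uvlim], of i]
        by (simp_all add: zvec_def)
      have "?tn \<longlonglongrightarrow> tnorm q1 q2 (vminus betas betas) (vminus phis phis) zvec"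
        unfolding tnorm_def vnorm_def vminus_def zvec_def by (intro tendsto_intros blim u)
      then show ?thesis by (simp add: tnorm_def vnorm_def vminus_def zvec_def)
    qed
    have hr: "h \<in> Rn r" using h Rn_mono[OF mr] by blast
    have "whp M (\<lambda>T \<omega>. \<bar>qform ?m (AR.hess T \<omega>) h - qform r (Info a0) h\<bar> \<le> e)"
    proof (rule hessian_form_limit[where Q="\<lambda>T \<omega>. qform ?m (AR.hess T \<omega>) h" and t=t and h=h and I="Info a0" and S=Sn,
          OF A1i(1) A5ii(5) a0 Sn_conv Sn_bnd Slim_bnd A5ii(7) A5ii(9)[OF a0] A5iii(1)[OF a0]
          c(1) c(2)[OF a0] tR hr AR.qform_hess_nonneg hess_tight _ e])
      fix e' :: real assume e': "0 < e'"
      show "whp M (\<lambda>T \<omega>. \<bar>vdot r (Sn T a0 \<omega>) (\<lambda>i. h i - t T i) + qform r (Info a0) (t T) / 2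
          - qform ?m (AR.hess T \<omega>) h / 2\<bar> \<le> e' * (1 + vnorm r (t T))\<^sup>2)"
        unfolding whp_def
      proof (intro allI impI)
        fix \<eta> :: real assume \<eta>: "0 < \<eta>"
        have h2: "0 < e' / 2" "0 < \<eta> / 2" using e' \<eta> by auto
        obtain \<delta> where \<delta>: "0 < \<delta>" "evp M (\<eta> / 2) (\<lambda>T \<omega>. \<forall>a\<in>A. \<forall>x\<in>B \<times> Pi_set a.
          tnorm q1 q2 (vminus (fst x) betas) (vminus (fst (snd x)) phis) (snd (snd x)) \<le> \<delta> \<longrightarrow>
          \<bar>Lpi T a (fst x) (fst (snd x)) (snd (snd x)) \<omega> - L0 p y T phits \<omega>
             - quad r (Info a) (Sn T a \<omega>) (\<lambda>i. sqrt (real T) * theta a (fst x) (fst (snd x)) (snd (snd x)) i)\<bar>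
          \<le> e' / 2 * (1 + vnorm r (\<lambda>i. sqrt (real T) * theta a (fst x) (fst (snd x)) (snd (snd x)) i))\<^sup>2)"
          (is "evp M _ ?mix") using mix_expansion[OF h2] by blast
        have "evp M (\<eta> / 2 + \<eta> / 2) (\<lambda>T \<omega>. ?mix T \<omega> \<and> \<bar>L0 p y T (ph T) \<omega> - L0 p y T phits \<omega>
            - (vdot ?m (AR.nscore T \<omega>) h - qform ?m (AR.hess T \<omega>) h / 2)\<bar> \<le> e' / 2)"
          unfolding ph_def by (intro evp_conj[OF Mf] \<delta>(2) whpD[OF AR.path_expansion] tight_nscore hess_tight h2)
        moreover have "\<eta> / 2 + \<eta> / 2 \<le> \<eta>" by simp
        moreover have "\<forall>\<^sub>F T in sequentially. \<forall>\<omega>\<in>space M. ?mix T \<omega> \<and> \<bar>L0 p y T (ph T) \<omega> - L0 p y T phits \<omega>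
            - (vdot ?m (AR.nscore T \<omega>) h - qform ?m (AR.hess T \<omega>) h / 2)\<bar> \<le> e' / 2 \<longrightarrow>
            \<bar>vdot r (Sn T a0 \<omega>) (\<lambda>i. h i - t T i) + qform r (Info a0) (t T) / 2
             - qform ?m (AR.hess T \<omega>) h / 2\<bar> \<le> e' * (1 + vnorm r (t T))\<^sup>2"
          using ph_ev order_tendstoD(2)[OF tn \<delta>(1)]
        proof eventually_elim
          case (elim T)
          show ?case
          proof (intro ballI impI, elim conjE)
            fix \<omega> assume w: "\<omega> \<in> space M" and mix: "?mix T \<omega>"
              and nul: "\<bar>L0 p y T (ph T) \<omega> - L0 p y T phits \<omega>
                - (vdot ?m (AR.nscore T \<omega>) h - qform ?m (AR.hess T \<omega>) h / 2)\<bar> \<le> e' / 2"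
            have tT: "(\<lambda>i. sqrt (real T) * theta a0 (b T) (fst (uv T)) (snd (uv T)) i) = t T"
              using elim(1) by (simp add: t_def)
            have "(b T, uv T) \<in> B \<times> Pi_set a0" using inP(1)[OF elim(1)] uvP[OF elim(1)] by simp
            from mix[rule_format, OF a0 this]
            have 1: "\<bar>L0 p y T (ph T) \<omega> - L0 p y T phits \<omega> - quad r (Info a0) (Sn T a0 \<omega>) (t T)\<bar>
               \<le> e' / 2 * (1 + vnorm r (t T))\<^sup>2"
              using elim(2) by (simp add: L0ph[OF elim(1)] tT)
            have "1\<^sup>2 \<le> (1 + vnorm r (t T))\<^sup>2" by (intro power_mono) auto
            then have 2: "e' / 2 \<le> e' / 2 * (1 + vnorm r (t T))\<^sup>2" using e' by simp
            have 3: "vdot r (Sn T a0 \<omega>) (\<lambda>i. h i - t T i) = vdot ?m (AR.nscore T \<omega>) h - vdot r (Sn T a0 \<omega>) (t T)"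
              using vdot_add[of r "Sn T a0 \<omega>" 1 h "-1" "t T"] vdot_nscore[OF a0 w h] by simp
            let ?D = "L0 p y T (ph T) \<omega> - L0 p y T phits \<omega>"
            \<comment> \<open>The common likelihood ratio \<open>?D\<close> cancels between the two
              expansions, leaving only their errors.\<close>
            have "\<bar>vdot r (Sn T a0 \<omega>) (\<lambda>i. h i - t T i) + qform r (Info a0) (t T) / 2 - qform ?m (AR.hess T \<omega>) h / 2\<bar>
              = \<bar>(?D - quad r (Info a0) (Sn T a0 \<omega>) (t T))
                 - (?D - (vdot ?m (AR.nscore T \<omega>) h - qform ?m (AR.hess T \<omega>) h / 2))\<bar>"
              unfolding 3 quad_def by (simp add: algebra_simps)
            also have "\<dots> \<le> e' / 2 * (1 + vnorm r (t T))\<^sup>2 + e' / 2 * (1 + vnorm r (t T))\<^sup>2"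
              by (rule order_trans[OF abs_triangle_ineq4 add_mono[OF 1 order_trans[OF nul 2]]])
            finally show "\<bar>vdot r (Sn T a0 \<omega>) (\<lambda>i. h i - t T i) + qform r (Info a0) (t T) / 2
               - qform ?m (AR.hess T \<omega>) h / 2\<bar> \<le> e' * (1 + vnorm r (t T))\<^sup>2" by simp
          qed
        qed
        ultimately show "evp M \<eta> (\<lambda>T \<omega>. \<bar>vdot r (Sn T a0 \<omega>) (\<lambda>i. h i - t T i) + qform r (Info a0) (t T) / 2
          - qform ?m (AR.hess T \<omega>) h / 2\<bar> \<le> e' * (1 + vnorm r (t T))\<^sup>2)" by (rule evp_mono)
      qed
    qed
    then show ?thesis unfolding qform_Info[OF a0 h] .
  qed
  have hess_entries: "whp M (\<lambda>T \<omega>. \<forall>i<?m. \<forall>j<?m. \<bar>AR.hess T \<omega> i j - Info a0 i j\<bar> \<le> e)" if e: "0 < e" for e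
  proof (rule whp_entries_limit[OF Mf _ _ hess_limit e])
    show "AR.hess T \<omega> i j = AR.hess T \<omega> j i" for T \<omega> i j by (auto simp: AR.hess_def mult.commute)
    show "Info a0 i j = Info a0 j i" if "i < ?m" "j < ?m" for i j
      using A5iii(1)[OF a0] that mr by (simp add: symmetric_mat_def)
  qed

  \<comment> \<open>Finiteness and approximation of the suprema\<close>
  obtain lo up where dens: "\<And>t \<omega>. 0 < (lo t \<omega> :: real)"
      "\<And>t \<omega> ph. ph \<in> Phit \<Longrightarrow> lo t \<omega> \<le> dens p y t ph \<omega>" "\<And>t \<omega> ph. ph \<in> Phit \<Longrightarrow> dens p y t ph \<omega> \<le> up t \<omega>"
  proof -
    have "\<forall>t \<omega>. \<exists>l u. 0 < l \<and> (\<forall>ph\<in>Phit. l \<le> dens p y t ph \<omega> \<and> dens p y t ph \<omega> \<le> u)"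
      using dens_bounds[OF A1i(8), of p y] A1i(9) by blast
    then show ?thesis using that by metis
  qed
  \<comment> \<open>A random bound, uniform in all parameters and in a. It makes the suprema finite
    and the likelihood ratio a bounded function of a.\<close>
  define bnd where "bnd T \<omega> = (\<Sum>t\<in>{1..T}. \<bar>ln (lo (int t) \<omega>)\<bar> + \<bar>ln (up (int t) \<omega>)\<bar>)" for T :: nat and \<omega>
  have Lmix_bnd: "\<bar>Lmix p q1 P y wt T a b f g \<omega>\<bar> \<le> bnd T \<omega>"
    if "\<omega> \<in> space M" "a \<in> A" "b \<in> B" "f \<in> Phi" "g \<in> Phi" for T \<omega> a b f g
    unfolding Lmix_def bnd_def
  proof (rule order_trans[OF sum_abs], rule sum_mono, rule ln_convex_combination_bound)
    fix t
    show "0 < wt (int t) a b f g \<omega>" "wt (int t) a b f g \<omega> < 1" using A1iii[OF that(2-5)] that(1) by blast+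
  qed (use dens Pin that in auto)
  have L0_bnd: "\<bar>L0 p y T ph \<omega>\<bar> \<le> bnd T \<omega>" if "ph \<in> Phit" for T ph \<omega>
    unfolding L0_def bnd_def
  proof (rule order_trans[OF sum_abs], rule sum_mono)
    fix t
    show "\<bar>ln (dens p y (int t) ph \<omega>)\<bar> \<le> \<bar>ln (lo (int t) \<omega>)\<bar> + \<bar>ln (up (int t) \<omega>)\<bar>"
      using ln_convex_combination_bound[OF _ _ dens(1) dens(2)[OF that] dens(3)[OF that] dens(2)[OF that] dens(3)[OF that],
          of "1 / 2" "int t" \<omega>] by simp
  qed

  \<comment> \<open>The null problem takes the common form with the centred parameter as
    \<open>theta\<close> and the first p + 2 coordinates, embedded in \<open>Rn r\<close> by zeros,
    as cone. The index a can be carried along because on this subspace neither the score nor the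
    information depends on it.\<close>
  have null_sup: "whp M (\<lambda>T \<omega>. \<forall>a\<in>A. \<bar>supL0 p y Phit T \<omega> - L0 p y T phits \<omega> - (SUP l\<in>Rn ?m. quad r (Info a) (Sn T a \<omega>) l)\<bar> \<le> e)"
    if e: "0 < e" for e
    unfolding supL0_def
  proof (rule whp_sup_criterion[where ell="\<lambda>T a \<omega> ph. L0 p y T ph \<omega>" and lt="\<lambda>T \<omega>. L0 p y T phits \<omega>"
        and theta="\<lambda>a ph i. ph i - phits i" and X="\<lambda>a. Phit" and I=Info and c=c and S=Sn and rho=rho0
        and dst="\<lambda>ph. vnorm ?m (vminus ph phits)" and xt=phits and xh="\<lambda>T a. nullhat T", OF Mf c(1) c(2)])
    show "Rn ?m \<subseteq> Rn r" by (rule Rn_mono[OF mr])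
    show "(\<lambda>i. b * x i) \<in> Rn ?m" if "x \<in> Rn ?m" for x b using that by (rule Rn_scale)
    show "\<exists>K\<ge>0. evp M \<eta> (\<lambda>T \<omega>. \<forall>a\<in>A. vnorm r (Sn T a \<omega>) \<le> K)" if "0 < \<eta>" for \<eta> by (rule tight[OF that])
    have PR: "(\<lambda>i. ph i - phits i) \<in> Rn ?m" if "ph \<in> Phit" for ph
      using that A1i(9) phitsR by (intro Rn_minus) auto
    show thR: "(\<lambda>i. ph i - phits i) \<in> Rn r" if "ph \<in> Phit" for ph
      using PR[OF that] Rn_mono[OF mr] by blast
    show "(\<lambda>ph i. ph i - phits i) ` Phit \<inter> cube r rho0 = Rn ?m \<inter> cube r rho0"
    proof (intro equalityI subsetI)
      fix z assume "z \<in> (\<lambda>ph i. ph i - phits i) ` Phit \<inter> cube r rho0"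
      then show "z \<in> Rn ?m \<inter> cube r rho0" using PR by blast
    next
      fix z assume z: "z \<in> Rn ?m \<inter> cube r rho0"
      have "(\<lambda>i. z i + phits i) \<in> Phit"
      proof (rule rho0(2)[rule_format])
        show "(\<lambda>i. z i + phits i) \<in> Rn ?m" using z phitsR by (simp add: Rn_def)
        show "\<bar>z i + phits i - phits i\<bar> < rho0" if "i < ?m" for i using z that mr by (simp add: cube_def)
      qed
      then show "z \<in> (\<lambda>ph i. ph i - phits i) ` Phit \<inter> cube r rho0"
        using z by (intro IntI image_eqI[where x="\<lambda>i. z i + phits i"]) auto
    qed
    have nr: "vnorm r (\<lambda>i. ph i - phits i) = vnorm ?m (vminus ph phits)" if "ph \<in> Phit" for ph
      unfolding vminus_def by (rule vnorm_Rn[OF mr PR[OF that]])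
    show "\<exists>d>0. \<forall>a\<in>A. \<forall>ph\<in>Phit. e \<le> vnorm ?m (vminus ph phits) \<longrightarrow> d \<le> vnorm r (\<lambda>i. ph i - phits i)" if "0 < e" for e
      using that nr by (intro exI[of _ e]) auto
    show "\<exists>\<delta>>0. evp M \<eta> (\<lambda>T \<omega>. \<forall>a\<in>A. \<forall>ph\<in>Phit. vnorm ?m (vminus ph phits) \<le> \<delta> \<longrightarrow>
        \<bar>L0 p y T ph \<omega> - L0 p y T phits \<omega> - quad r (Info a) (Sn T a \<omega>) (\<lambda>i. sqrt (real T) * (ph i - phits i))\<bar>
          \<le> e * (1 + vnorm r (\<lambda>i. sqrt (real T) * (ph i - phits i)))\<^sup>2)" if e: "0 < e" and \<eta>: "0 < \<eta>" for e \<eta>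
    proof -
      obtain \<delta> where \<delta>: "0 < \<delta>" "evp M \<eta> (\<lambda>T \<omega>. \<forall>ph. vnorm ?m (vminus ph phits) \<le> \<delta> \<longrightarrow>
        \<bar>L0 p y T ph \<omega> - L0 p y T phits \<omega> - (vdot ?m (AR.nscore T \<omega>) (\<lambda>i. sqrt (real T) * (ph i - phits i))
          - qform ?m (Info a0) (\<lambda>i. sqrt (real T) * (ph i - phits i)) / 2)\<bar>
        \<le> e * (1 + vnorm ?m (\<lambda>i. sqrt (real T) * (ph i - phits i)))\<^sup>2)"
        using AR.null_expansion[OF tight_nscore hess_entries e \<eta>] by blast
      have "evp M \<eta> (\<lambda>T \<omega>. \<forall>a\<in>A. \<forall>ph\<in>Phit. vnorm ?m (vminus ph phits) \<le> \<delta> \<longrightarrow>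
        \<bar>L0 p y T ph \<omega> - L0 p y T phits \<omega> - quad r (Info a) (Sn T a \<omega>) (\<lambda>i. sqrt (real T) * (ph i - phits i))\<bar>
          \<le> e * (1 + vnorm r (\<lambda>i. sqrt (real T) * (ph i - phits i)))\<^sup>2)"
      proof (rule evp_mono'[OF \<delta>(2)], intro ballI impI)
        fix T \<omega> a ph assume w: "\<omega> \<in> space M" and a: "a \<in> A" and ph: "ph \<in> Phit"
          and d: "vnorm ?m (vminus ph phits) \<le> \<delta>" and ex: "\<forall>ph. vnorm ?m (vminus ph phits) \<le> \<delta> \<longrightarrow>
        \<bar>L0 p y T ph \<omega> - L0 p y T phits \<omega> - (vdot ?m (AR.nscore T \<omega>) (\<lambda>i. sqrt (real T) * (ph i - phits i))
          - qform ?m (Info a0) (\<lambda>i. sqrt (real T) * (ph i - phits i)) / 2)\<bar>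
        \<le> e * (1 + vnorm ?m (\<lambda>i. sqrt (real T) * (ph i - phits i)))\<^sup>2"
        have R: "(\<lambda>i. sqrt (real T) * (ph i - phits i)) \<in> Rn ?m" using PR[OF ph] by (rule Rn_scale)
        show "\<bar>L0 p y T ph \<omega> - L0 p y T phits \<omega> - quad r (Info a) (Sn T a \<omega>) (\<lambda>i. sqrt (real T) * (ph i - phits i))\<bar>
          \<le> e * (1 + vnorm r (\<lambda>i. sqrt (real T) * (ph i - phits i)))\<^sup>2"
          unfolding quad_def vdot_nscore[OF a w R] qform_Info[OF a R] vnorm_Rn[OF mr R]
          using ex d by blast
      qed
      then show ?thesis using \<delta>(1) by blast
    qed
    show "bdd_above ((\<lambda>ph. L0 p y T ph \<omega>) ` Phit)" for T \<omega>
      using L0_bnd[of _ T \<omega>] by (intro bdd_aboveI2[of _ _ "bnd T \<omega>"]) (auto simp: abs_le_iff)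
    show "nullhat T \<omega> \<in> Phit" if "\<omega> \<in> space M" for T \<omega> by (rule Null(1)[OF that])
    show "whp M (\<lambda>T \<omega>. \<forall>a\<in>A. vnorm ?m (vminus (nullhat T \<omega>) phits) \<le> e)" if "0 < e" for e
    proof -
      have "whp M (\<lambda>T \<omega>. vnorm ?m (vminus (nullhat T \<omega>) phits) \<le> e)" using Null(3) that by (simp add: o_p_iff)
      then show ?thesis by (rule whp_mono') blast
    qed
    show "whp M (\<lambda>T \<omega>. \<forall>a\<in>A. (SUP ph\<in>Phit. L0 p y T ph \<omega>) - e \<le> L0 p y T (nullhat T \<omega>) \<omega>)" if "0 < e" for e
    proof -
      have "whp M (\<lambda>T \<omega>. \<bar>L0 p y T (nullhat T \<omega>) \<omega> - supL0 p y Phit T \<omega>\<bar> \<le> e)"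
        using Null(2) that by (simp add: o_p_iff)
      then show ?thesis
      proof (rule whp_mono', intro ballI)
        fix T \<omega> assume "\<bar>L0 p y T (nullhat T \<omega>) \<omega> - supL0 p y Phit T \<omega>\<bar> \<le> e"
        then show "(SUP ph\<in>Phit. L0 p y T ph \<omega>) - e \<le> L0 p y T (nullhat T \<omega>) \<omega>"
          unfolding supL0_def by linarith
      qed
    qed
  qed (simp_all add: e rho0(1) phits)

  \<comment> \<open>The reparameterization is onto \<open>Pi_set a\<close>, so both suprema range
    over the same set of likelihood values.\<close>
  have sup_reparam: "(SUP x\<in>B \<times> Pi_set a. Lpi T a (fst x) (fst (snd x)) (snd (snd x)) \<omega>) = supLmix p q1 P y wt B Phi T a \<omega>"
    if a: "a \<in> A" for T a \<omega>
  proof -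
    have "B \<times> Pi_set a = (\<lambda>x. (fst x, pimap a (snd x))) ` (B \<times> Phi \<times> Phi)"
      unfolding Pi_set_def by force
    then have "(\<lambda>x. Lpi T a (fst x) (fst (snd x)) (snd (snd x)) \<omega>) ` (B \<times> Pi_set a)
        = (\<lambda>x. Lmix p q1 P y wt T a (fst x) (fst (snd x)) (snd (snd x)) \<omega>) ` (B \<times> Phi \<times> Phi)"
      using Lpi_pimap[OF a] by (auto simp: image_image intro!: image_cong)
    then show ?thesis by (simp add: supLmix_def)
  qed
  have mix_sup: "whp M (\<lambda>T \<omega>. \<forall>a\<in>A. \<bar>supLmix p q1 P y wt B Phi T a \<omega> - L0 p y T phits \<omega> - (SUP l\<in>Lam. quad r (Info a) (Sn T a \<omega>) l)\<bar> \<le> e)"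
    if e: "0 < e" for e
  proof -
    let ?xh = "\<lambda>T a \<omega>. (bhat T a \<omega>, pimap a (phhat T a \<omega>, vphhat T a \<omega>))"
    have "whp M (\<lambda>T \<omega>. \<forall>a\<in>A. \<bar>(SUP x\<in>B \<times> Pi_set a. Lpi T a (fst x) (fst (snd x)) (snd (snd x)) \<omega>)
        - L0 p y T phits \<omega> - (SUP l\<in>Lam. quad r (Info a) (Sn T a \<omega>) l)\<bar> \<le> e)"
    proof (rule whp_sup_criterion[where ell="\<lambda>T a \<omega> x. Lpi T a (fst x) (fst (snd x)) (snd (snd x)) \<omega>"
        and lt="\<lambda>T \<omega>. L0 p y T phits \<omega>" and theta="\<lambda>a x. theta a (fst x) (fst (snd x)) (snd (snd x))"
        and X="\<lambda>a. B \<times> Pi_set a" and I=Info and c=c and S=Sn and rho=rho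
        and dst="\<lambda>x. tnorm q1 q2 (vminus (fst x) betas) (vminus (fst (snd x)) phis) (snd (snd x))"
        and xt="(betas, phis, zvec)" and xh="?xh", OF Mf c(1) c(2) LamR Lam0 Lam_cone tight rho(1)])
      show "(\<lambda>x. theta a (fst x) (fst (snd x)) (snd (snd x))) ` (B \<times> Pi_set a) \<inter> cube r rho = Lam \<inter> cube r rho"
        if "a \<in> A" for a using rho(2)[OF that] by (simp add: case_prod_unfold)
      show "theta a (fst x) (fst (snd x)) (snd (snd x)) \<in> Rn r" if "a \<in> A" "x \<in> B \<times> Pi_set a" for a x
        using A5i(1)[OF that(1)] that(2) by auto
      show "\<exists>d>0. \<forall>a\<in>A. \<forall>x\<in>B \<times> Pi_set a.
          e \<le> tnorm q1 q2 (vminus (fst x) betas) (vminus (fst (snd x)) phis) (snd (snd x)) \<longrightarrow>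
          d \<le> vnorm r (theta a (fst x) (fst (snd x)) (snd (snd x)))" if "0 < e" for e
        using A5i(3)[OF that] by (auto simp: mem_Times_iff)
      show "bdd_above ((\<lambda>x. Lpi T a (fst x) (fst (snd x)) (snd (snd x)) \<omega>) ` (B \<times> Pi_set a))"
        if "a \<in> A" "\<omega> \<in> space M" for T a \<omega>
      proof (rule bdd_aboveI2)
        fix x assume x: "x \<in> B \<times> Pi_set a"
        then obtain f g where fg: "f \<in> Phi" "g \<in> Phi" "snd x = pimap a (f, g)" unfolding Pi_set_def by auto
        show "Lpi T a (fst x) (fst (snd x)) (snd (snd x)) \<omega> \<le> bnd T \<omega>"
          unfolding fg(3) Lpi_pimap[OF that(1) fg(1,2)]
          using Lmix_bnd[OF that(2,1) _ fg(1,2), of "fst x" T] x by (auto simp: abs_le_iff)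
      qed
      show "(betas, phis, zvec) \<in> B \<times> Pi_set a" if "a \<in> A" for a using B0(1) Pi0(1)[OF that] by simp
      show "Lpi T a (fst (betas, phis, zvec)) (fst (snd (betas, phis, zvec))) (snd (snd (betas, phis, zvec))) \<omega> = L0 p y T phits \<omega>"
        if "a \<in> A" for T a \<omega> using Lpi0[OF that] by simp
      show "?xh T a \<omega> \<in> B \<times> Pi_set a" if "a \<in> A" "\<omega> \<in> space M" for T a \<omega>
        using A2(1)[OF that] by (auto simp: Pi_set_def)
      show "whp M (\<lambda>T \<omega>. \<forall>a\<in>A. tnorm q1 q2 (vminus (fst (?xh T a \<omega>)) betas) (vminus (fst (snd (?xh T a \<omega>))) phis)
          (snd (snd (?xh T a \<omega>))) \<le> e)" if "0 < e" for e
        using A3(5) that by (simp add: o_p_unif_iff)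
      show "whp M (\<lambda>T \<omega>. \<forall>a\<in>A. (SUP x\<in>B \<times> Pi_set a. Lpi T a (fst x) (fst (snd x)) (snd (snd x)) \<omega>) - e
          \<le> Lpi T a (fst (?xh T a \<omega>)) (fst (snd (?xh T a \<omega>))) (snd (snd (?xh T a \<omega>))) \<omega>)" if "0 < e" for e
      proof (rule whp_mono')
        show "whp M (\<lambda>T \<omega>. \<forall>a\<in>A. \<bar>Lmix p q1 P y wt T a (bhat T a \<omega>) (phhat T a \<omega>) (vphhat T a \<omega>) \<omega>
                             - supLmix p q1 P y wt B Phi T a \<omega>\<bar> \<le> e)"
          using A2(2) that by (simp add: o_p_unif_iff)
        fix T \<omega> assume w: "\<omega> \<in> space M" and H: "\<forall>a\<in>A. \<bar>Lmix p q1 P y wt T a (bhat T a \<omega>) (phhat T a \<omega>) (vphhat T a \<omega>) \<omega>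
                             - supLmix p q1 P y wt B Phi T a \<omega>\<bar> \<le> e"
        show "\<forall>a\<in>A. (SUP x\<in>B \<times> Pi_set a. Lpi T a (fst x) (fst (snd x)) (snd (snd x)) \<omega>) - e
          \<le> Lpi T a (fst (?xh T a \<omega>)) (fst (snd (?xh T a \<omega>))) (snd (snd (?xh T a \<omega>))) \<omega>"
        proof
          fix a assume a: "a \<in> A"
          have "\<bar>Lmix p q1 P y wt T a (bhat T a \<omega>) (phhat T a \<omega>) (vphhat T a \<omega>) \<omega>
                             - supLmix p q1 P y wt B Phi T a \<omega>\<bar> \<le> e" using H a by blast
          moreover have "Lpi T a (fst (?xh T a \<omega>)) (fst (snd (?xh T a \<omega>))) (snd (snd (?xh T a \<omega>))) \<omega>
             = Lmix p q1 P y wt T a (bhat T a \<omega>) (phhat T a \<omega>) (vphhat T a \<omega>) \<omega>"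
            using Lpi_pimap[OF a] A2(1)[OF a w] by simp
          ultimately show "(SUP x\<in>B \<times> Pi_set a. Lpi T a (fst x) (fst (snd x)) (snd (snd x)) \<omega>) - e
          \<le> Lpi T a (fst (?xh T a \<omega>)) (fst (snd (?xh T a \<omega>))) (snd (snd (?xh T a \<omega>))) \<omega>"
            unfolding sup_reparam[OF a] by linarith
        qed
      qed
    qed (use mix_expansion e in auto)
    then show ?thesis by (rule whp_mono') (simp add: sup_reparam)
  qed

  \<comment> \<open>From the approximation to weak convergence\<close>
  let ?LR = "\<lambda>T a \<omega>. LR p q1 P y wt B Phi Phit T a \<omega>"
  let ?lim = "\<lambda>a S. lr_limit r qth (Info a) Lamv S"
  have lim_eq: "?lim a (Sn T a \<omega>) = 2 * ((SUP l\<in>Lam. quad r (Info a) (Sn T a \<omega>) l) - (SUP l\<in>Rn ?m. quad r (Info a) (Sn T a \<omega>) l))"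
    if "a \<in> A" for T a \<omega>
    unfolding A7(3) qth by (rule lr_limit_eq[OF pd[OF that] mr SnR Lamv(1) Lamv_ne])
  \<comment> \<open>The likelihood at the truth cancels in the difference. Each supremum is known up
    to e/4, and the likelihood ratio doubles their difference.\<close>
  have approx: "whp M (\<lambda>T \<omega>. \<forall>a\<in>A. vnorm 1 (vminus (vec1 (?lim a (Sn T a \<omega>))) (vec1 (?LR T a \<omega>))) \<le> e)" if e: "0 < e" for e
  proof -
    have e4: "0 < e / 4" using e by simp
    show ?thesis
    proof (rule whp_mono'[OF whp_conj[OF Mf null_sup[OF e4] mix_sup[OF e4]]], intro ballI, elim conjE)
      fix T \<omega> a assume a: "a \<in> A"
        and n: "\<forall>a\<in>A. \<bar>supL0 p y Phit T \<omega> - L0 p y T phits \<omega> - (SUP l\<in>Rn ?m. quad r (Info a) (Sn T a \<omega>) l)\<bar> \<le> e / 4"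
        and m: "\<forall>a\<in>A. \<bar>supLmix p q1 P y wt B Phi T a \<omega> - L0 p y T phits \<omega> - (SUP l\<in>Lam. quad r (Info a) (Sn T a \<omega>) l)\<bar> \<le> e / 4"
      let ?n = "supL0 p y Phit T \<omega> - L0 p y T phits \<omega> - (SUP l\<in>Rn ?m. quad r (Info a) (Sn T a \<omega>) l)"
      let ?x = "supLmix p q1 P y wt B Phi T a \<omega> - L0 p y T phits \<omega> - (SUP l\<in>Lam. quad r (Info a) (Sn T a \<omega>) l)"
      have "?lim a (Sn T a \<omega>) - ?LR T a \<omega> = 2 * (?n - ?x)"
        unfolding lim_eq[OF a] LR_def by simp
      then have eq: "\<bar>?lim a (Sn T a \<omega>) - ?LR T a \<omega>\<bar> = 2 * \<bar>?n - ?x\<bar>" by (simp only: abs_mult abs_numeral)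
      have le: "\<bar>?n - ?x\<bar> \<le> e / 4 + e / 4"
        by (rule order_trans[OF abs_triangle_ineq4 add_mono[OF bspec[OF n a] bspec[OF m a]]])
      have "2 * \<bar>?n - ?x\<bar> \<le> 2 * (e / 4 + e / 4)" by (rule mult_left_mono[OF le]) simp
      also have "\<dots> = e" by simp
      finally show "vnorm 1 (vminus (vec1 (?lim a (Sn T a \<omega>))) (vec1 (?LR T a \<omega>))) \<le> e"
        unfolding vnorm1 eq .
    qed
  qed
  have lim_conv: "weak_conv_proc 1 A M (\<lambda>T a \<omega>. vec1 (?lim a (Sn T a \<omega>))) N (\<lambda>a \<eta>. vec1 (?lim a (Slim a \<eta>)))"
    unfolding weak_conv_proc_def qth
  proof (intro allI impI)
    fix h :: "(vec \<Rightarrow> vec) \<Rightarrow> real" assume h: "bc_functional 1 A h"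
    from weak_convD[OF Sn_conv bc_functional_lr_limit[OF A pd c mr Lamv h]]
    show "(\<lambda>T. outer_exp M (\<lambda>\<omega>. h (\<lambda>a. vec1 (lr_limit r ?m (Info a) Lamv (Sn T a \<omega>)))))
      \<longlonglongrightarrow> integral\<^sup>L N (\<lambda>\<eta>. h (\<lambda>a. vec1 (lr_limit r ?m (Info a) Lamv (Slim a \<eta>))))" by simp
  qed
  have LR_bnd: "bnd_fun 1 A (\<lambda>a. vec1 (?LR T a \<omega>))" if w: "\<omega> \<in> space M" for T \<omega>
  proof -
    have "\<bar>supL0 p y Phit T \<omega>\<bar> \<le> bnd T \<omega>"
      unfolding supL0_def using phits L0_bnd[of _ T \<omega>] by (intro cSup_abs_le) auto
    moreover have "\<bar>supLmix p q1 P y wt B Phi T a \<omega>\<bar> \<le> bnd T \<omega>" if "a \<in> A" for a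
      unfolding supLmix_def using B0 Lmix_bnd[OF w that] by (intro cSup_abs_le) auto
    ultimately have "\<bar>?LR T a \<omega>\<bar> \<le> 4 * bnd T \<omega>" if "a \<in> A" for a
      using that unfolding LR_def by (fastforce simp: abs_le_iff)
    then show ?thesis unfolding bnd_fun_def vnorm1 using vec1_Rn by blast
  qed
  have lim_bnd: "bnd_fun 1 A (\<lambda>a. vec1 (?lim a (S a)))" if "bnd_fun r A S" for S
    unfolding qth by (rule bnd_fun_lr_limit[OF pd c mr Lamv that])
  have LR_conv: "weak_conv_proc 1 A M (\<lambda>T a \<omega>. vec1 (?LR T a \<omega>)) N (\<lambda>a \<eta>. vec1 (?lim a (Slim a \<eta>)))"
  proof (rule weak_conv_slutsky[OF A1i(1) A5ii(5) A lim_conv _ LR_bnd _ approx])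
    show "bnd_fun 1 A (\<lambda>a. vec1 (?lim a (Sn T a \<omega>)))" if "\<omega> \<in> space M" for T \<omega> by (rule lim_bnd[OF Sn_bnd[OF that]])
    show "AE \<eta> in N. bnd_fun 1 A (\<lambda>a. vec1 (?lim a (Slim a \<eta>)))" using Slim_bnd by eventually_elim (rule lim_bnd)
  qed
  moreover have "conv_distr M (\<lambda>T \<omega>. LRsup p q1 P y wt A B Phi Phit T \<omega>) N (\<lambda>\<eta>. SUP a\<in>A. ?lim a (Slim a \<eta>))"
    unfolding LRsup_def by (rule weak_conv_imp_conv_distr_sup[OF A LR_conv])
  ultimately show ?thesis by blast
qed

end
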